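(* Let $\Omega$ be a bounded open subset of $\mathbb{R}^d$ with $C^{1,1}$ boundary, and let $X=(X_t)_{t\ge 0}$ be a translation invariant isotropic stochastic process on $\mathbb{R}^d$ with càdlàg paths such that, for every $\varepsilon>0$, $$\lim_{t\downarrow 0}\frac{1}{\mu(t)}\,\mathbb{P}_0\Big(\sup_{0\le s\le t}X^{(1)}_s>\varepsilon\Big)=0,\qquad\text{where}\quad \mu(t)=\mathbb{E}_0\Big[\Big(\sup_{0\le s\le t}X^{(1)}_s\Big)\wedge 1\Big].$$ Then $$\lim_{t\downarrow 0}\frac{\mathrm{Vol}(\Omega)-Q^X_\Omega(t)}{\mu(t)}=\mathrm{Per}(\Omega).$$
   Context: $X=(X_t)_{t\ge0}$, $X_t=(X^{(1)}_t,\dots,X^{(d)}_t)$, is an $\mathbb{R}^d$-valued stochastic process with càdlàg paths; $\mathbb{P}_x$ (expectation $\mathbb{E}_x$) denotes the probability measure when $X_0=x$. Translation invariant isotropic means: for any $t\ge0$, $x\in\mathbb{R}^d$ and Borel set $A\subset\mathbb{R}^d$, $\mathbb{P}_x(X_t\in A)=\mathbb{P}_0(X_t+x\in A)$ and $\mathbb{P}_0(X_t\in A)=\mathbb{P}_0(UX_t\in A)$ for all $d\times d$ orthogonal matrices $U$. The spectral heat content of a bounded open set $\Omega\subset\mathbb{R}^d$ is $Q^X_\Omega(t)=\int_\Omega\mathbb{P}_x(\tau^X_\Omega>t)\,dx$, where $\tau^X_\Omega=\inf\{t\ge0:X_t\notin\Omega\}$. $\mathrm{Vol}(\Omega)$ is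 the volume of $\Omega$. The perimeter is $\mathrm{Per}(\Omega)=\sup\{\int_\Omega\sum_{i=1}^dD_i\varphi_i\,dx:\ \varphi_i\in C_c^\infty(\mathbb{R}^d),\ \sum_{i=1}^d\varphi_i^2\le1\}$ (equal to the $(d-1)$-dimensional Hausdorff measure of $\partial\Omega$ when $\partial\Omega$ is $C^1$). A function $f$ is $C^{1,\kappa}$ ($\kappa>0$) if it is $C^1$ and there is $L>0$ with $|\nabla f(x)-\nabla f(y)|\le L|x-y|^\kappa$ for all $x,y$. $\Omega$ has $C^{1,\kappa}$ boundary if for every $x\in\partial\Omega$ there are a neighborhood $V_x$ of $x$ and a $C^{1,\kappa}$ function $\gamma:\mathbb{R}^{d-1}\to\mathbb{R}$ such that, in suitable orthonormal coordinates (depending on $x$), $\Omega\cap V_x=\{(y_1,\dots,y_d):y_d>\gamma(y_1,\dots,y_{d-1})\}\cap V_x$.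
   Formalization: Translation invariance and isotropy are assumed for all finite-dimensional distributions of X, not only for X_t at single times (with single-time laws alone the claim is false: the limit can be Per/2), and μ(t) is assumed nonzero for small t. *)

theory Defs
  imports "HOL-Probability.Probability"
begin

section \<open>Translation invariant isotropic processes\<close>

definition cadlag :: "(real \<Rightarrow> 'a::topological_space) \<Rightarrow> bool" where
  "cadlag f \<longleftrightarrow>
     (\<forall>t\<ge>0. (f \<longlongrightarrow> f t) (at_right t)) \<and> (\<forall>t>0. \<exists>l. (f \<longlongrightarrow> l) (at_left t))"

text \<open>
  The process is a single family of random variables \<open>X t\<close>, \<open>t \<ge> 0\<close>, on one measurable space
  that carries all the measures \<open>P x\<close>. Values of \<open>X\<close> at negative times are never used.
\<close>

definition cadlag_process ::
    "(real^'d \<Rightarrow> 'w measure) \<Rightarrow> (real \<Rightarrow> 'w \<Rightarrow> real^'d) \<Rightarrow> bool" where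
  "cadlag_process P X \<longleftrightarrow>
     (\<forall>x. prob_space (P x) \<and> sets (P x) = sets (P 0)) \<and>
     (\<forall>t\<ge>0. X t \<in> borel_measurable (P 0)) \<and>
     (\<forall>\<omega>\<in>space (P 0). cadlag (\<lambda>t. X t \<omega>)) \<and>
     (\<forall>x. AE \<omega> in P x. X 0 \<omega> = x)"

text \<open>
  Both invariance properties concern the law of the process, i.e. all finite-dimensional
  distributions, and not only the law of \<open>X t\<close> at single times (the case of a singleton \<open>J\<close>).
  One-time marginals do not determine the laws of \<open>sup\<^sub>s\<^sub>\<le>\<^sub>t X\<^sub>s\<close> or of exit times: a Brownian motion
  and \<open>\<surd>t Z\<close> with \<open>Z\<close> standard normal have the same marginals.
\<close>

definition translation_invariant ::
    "(real^'d \<Rightarrow> 'w measure) \<Rightarrow> (real \<Rightarrow> 'w \<Rightarrow> real^'d) \<Rightarrow> bool" where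
  "translation_invariant P X \<longleftrightarrow>
     (\<forall>x J A. finite J \<and> J \<subseteq> {0..} \<and> (\<forall>t\<in>J. A t \<in> sets borel) \<longrightarrow>
        measure (P x) {\<omega>\<in>space (P x). \<forall>t\<in>J. X t \<omega> \<in> A t} =
        measure (P 0) {\<omega>\<in>space (P 0). \<forall>t\<in>J. X t \<omega> + x \<in> A t})"

definition isotropic ::
    "(real^'d \<Rightarrow> 'w measure) \<Rightarrow> (real \<Rightarrow> 'w \<Rightarrow> real^'d) \<Rightarrow> bool" where
  "isotropic P X \<longleftrightarrow>
     (\<forall>U J A. orthogonal_matrix U \<and> finite J \<and> J \<subseteq> {0..} \<and> (\<forall>t\<in>J. A t \<in> sets borel) \<longrightarrow>
        measure (P 0) {\<omega>\<in>space (P 0). \<forall>t\<in>J. X t \<omega> \<in> A t} =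
        measure (P 0) {\<omega>\<in>space (P 0). \<forall>t\<in>J. U *v X t \<omega> \<in> A t})"

text \<open>
  A finite index type has no distinguished first element; an arbitrary index \<open>i\<close> plays the role
  of the first coordinate.
\<close>

definition running_sup :: "(real \<Rightarrow> 'w \<Rightarrow> real^'d) \<Rightarrow> 'd \<Rightarrow> real \<Rightarrow> 'w \<Rightarrow> real" where
  "running_sup X i t \<omega> = (SUP s\<in>{0..t}. X s \<omega> $ i)"

definition mu ::
    "(real^'d \<Rightarrow> 'w measure) \<Rightarrow> (real \<Rightarrow> 'w \<Rightarrow> real^'d) \<Rightarrow> 'd \<Rightarrow> real \<Rightarrow> real" where
  "mu P X i t = (\<integral>\<omega>. min (running_sup X i t \<omega>) 1 \<partial>P 0)"

section \<open>Spectral heat content\<close>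

definition exit_time :: "(real \<Rightarrow> 'w \<Rightarrow> real^'d) \<Rightarrow> (real^'d) set \<Rightarrow> 'w \<Rightarrow> ereal" where
  "exit_time X D \<omega> = Inf (ereal ` {t. 0 \<le> t \<and> X t \<omega> \<notin> D})"

text \<open>
  For a cadlag process the event \<open>\<tau> > t\<close> need not belong to the sigma-algebra on which \<open>P x\<close> is
  given; it is the complement of the projection of a jointly measurable set, hence measurable
  with respect to the completion of \<open>P x\<close>. Likewise, its probability is integrated over \<open>D\<close>
  against the completed measure \<open>lebesgue\<close>.
\<close>

definition spectral_heat_content ::
    "(real^'d \<Rightarrow> 'w measure) \<Rightarrow> (real \<Rightarrow> 'w \<Rightarrow> real^'d) \<Rightarrow> (real^'d) set \<Rightarrow> real \<Rightarrow> real" where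
  "spectral_heat_content P X D t =
     (LINT x:D|lebesgue.
        measure (completion (P x)) {\<omega>\<in>space (P x). exit_time X D \<omega> > ereal t})"

section \<open>Perimeter\<close>

definition partial_deriv :: "'d \<Rightarrow> (real^'d \<Rightarrow> real) \<Rightarrow> real^'d \<Rightarrow> real" where
  "partial_deriv i f x = frechet_derivative f (at x) (axis i 1)"

primrec C_k :: "nat \<Rightarrow> (real^'d \<Rightarrow> real) \<Rightarrow> bool" where
  "C_k 0 f \<longleftrightarrow> continuous_on UNIV f"
| "C_k (Suc k) f \<longleftrightarrow> (\<forall>x. f differentiable at x) \<and> (\<forall>i. C_k k (partial_deriv i f))"

definition test_function :: "(real^'d \<Rightarrow> real) \<Rightarrow> bool" where
  "test_function f \<longleftrightarrow> (\<forall>k. C_k k f) \<and> compact (closure {x. f x \<noteq> 0})"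

text \<open>The supremum may be infinite for a general open set, hence the extended reals.\<close>

definition perimeter :: "(real^'d) set \<Rightarrow> ereal" where
  "perimeter D =
     (SUP \<phi> \<in> {\<phi> :: real^'d \<Rightarrow> real^'d.
                 (\<forall>i. test_function (\<lambda>x. \<phi> x $ i)) \<and> (\<forall>x. (\<Sum>i\<in>UNIV. (\<phi> x $ i)\<^sup>2) \<le> 1)}.
        ereal (LINT x:D|lborel. \<Sum>i\<in>UNIV. partial_deriv i (\<lambda>y. \<phi> y $ i) x))"

section \<open>Boundary regularity\<close>

definition C1_holder :: "real \<Rightarrow> (real^'d \<Rightarrow> real) \<Rightarrow> bool" where
  "C1_holder \<kappa> f \<longleftrightarrow>
     (\<exists>G. (\<forall>x. GDERIV f x :> G x) \<and> continuous_on UNIV G \<and>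
          (\<exists>L>0. \<forall>x y. norm (G x - G y) \<le> L * norm (x - y) powr \<kappa>))"

text \<open>
  The local coordinates of a point \<open>z\<close> are \<open>y = U *v z\<close>, and \<open>y $ k\<close> plays the role of \<open>y\<^sub>d\<close>. A \<open>C\<^sup>1\<^sup>,\<^sup>\<kappa>\<close> function on the space \<open>\<real>\<^sup>d\<^sup>-\<^sup>1\<close> of the remaining coordinates is represented by a
  \<open>C\<^sup>1\<^sup>,\<^sup>\<kappa>\<close> function \<open>\<gamma>\<close> on \<open>\<real>\<^sup>d\<close> that does not depend on the \<open>k\<close>-th coordinate; the gradients
  agree up to a zero entry, so the constants \<open>L\<close> are the same. This also covers \<open>d = 1\<close>.
\<close>

definition C1_boundary :: "real \<Rightarrow> (real^'d) set \<Rightarrow> bool" where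
  "C1_boundary \<kappa> D \<longleftrightarrow>
     (\<forall>x\<in>frontier D. \<exists>V U k \<gamma>.
        open V \<and> x \<in> V \<and> orthogonal_matrix U \<and>
        C1_holder \<kappa> \<gamma> \<and> (\<forall>y c. \<gamma> (y + c *\<^sub>R axis k 1) = \<gamma> y) \<and>
        D \<inter> V = {z. (U *v z) $ k > \<gamma> (U *v z)} \<inter> V)"

end

theory Submission
  imports Defs
begin

text \<open>
  By Fubini and translation invariance, \<open>Vol \<Omega> - Q t\<close> is the expected volume of the layer of points
  \<open>x \<in> \<Omega>\<close> for which the translated path \<open>x + X\<^sub>s\<close>, \<open>s \<le> t\<close>, leaves \<open>\<Omega>\<close>. Surface measure is avoided:
  regularity of the boundary is used only through a cone condition, namely that near a boundary
  point with outer unit normal \<open>u\<close> one stays outside \<open>\<Omega>\<close> when moving by a vector \<open>w\<close> with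
  \<open>\<delta> |w| \<le> w \<bullet> u\<close>. For a function \<open>\<psi> \<ge> 0\<close> of a partition of unity supported there, the cone condition
  squeezes the \<open>\<psi>\<close>-weighted volume of the layer of a path of radius \<open>r\<close> between
  \<open>\<integral> \<psi> x * (1\<^bsub>\<Omega>\<^esub> x - 1\<^bsub>\<Omega>\<^esub> (x + m)) dx\<close> for two vectors \<open>m = (h + O(\<delta> r)) u\<close>, where \<open>h\<close> is the maximum of the
  path in direction \<open>u\<close>, and such an integral is \<open>m \<bullet> \<integral>\<^bsub>\<Omega>\<^esub> \<nabla>\<psi> + o(|m|)\<close>. By isotropy \<open>E[h \<and> 1] = \<mu> t\<close> for every
  direction, so the expected volume is \<open>\<mu> t * (A + o(1))\<close> with \<open>A = \<Sum> \<integral>\<^bsub>\<Omega>\<^esub> \<partial>\<^sub>u \<psi>\<close>, which is the integral of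
  the divergence of the admissible field \<open>\<Sum> \<psi> u\<close>. Conversely, the cone condition shows
  \<open>\<integral>\<^bsub>\<Omega>\<^esub> div \<phi> \<le> (1 + \<eta>) * A\<close> for any given admissible \<open>\<phi>\<close> once the partition is fine enough.
\<close>

section \<open>Smooth partitions of unity\<close>

text \<open>The maximum of a path in one direction may be far smaller than its radius r, so an error
  \<eta> * r cannot be absorbed path by path. Here r is the sum of the suprema along the 2d vectors
  \<open>axis j 1\<close> and \<open>- axis j 1\<close>. By isotropy each of them, cut off at 1, has
  expectation \<open>mu P X i t\<close>, so the error costs O(\<eta>) times
  \<open>mu P X i t\<close> on average. Paths for which one of these suprema exceeds a fixed
  threshold have probability o(\<open>mu P X i t\<close>) by hypothesis. The other obstacle is
  measurability: invariance concerns finitely many times, the exit event all of them. A countable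
  set of times decides whether a cadlag path stays in a closed set, but not whether it stays in an
  open one, because the path may touch the boundary at a missed time. The cone condition shows that,
  for almost every starting point, a path whose grid positions lie in D almost surely keeps them at
  a positive distance from the complement. This traps the exit event between grid events of equal
  probability. The constant A varies with the partition. It is only compared with the perimeter from
  both sides, and finiteness of the perimeter is never presupposed.\<close>

lemma frechet_derivative_partial_deriv:
  fixes f :: "real^'d \<Rightarrow> real"
  assumes "f differentiable at x"
  shows "frechet_derivative f (at x) w = (\<Sum>i\<in>UNIV. w $ i * partial_deriv i f x)"
proof -
  interpret linear "frechet_derivative f (at x)"
    using assms by (rule linear_frechet_derivative)
  have "frechet_derivative f (at x) w = frechet_derivative f (at x) (\<Sum>i\<in>UNIV. (w $ i) *\<^sub>R axis i 1)"
    by (subst basis_expansion[of w, unfolded scalar_mult_eq_scaleR, symmetric]) simp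
  also have "\<dots> = (\<Sum>i\<in>UNIV. w $ i * partial_deriv i f x)"
    by (simp only: sum scale real_scaleR_def partial_deriv_def)
  finally show ?thesis .
qed

lemma partial_deriv_eqI:
  "(f has_derivative f') (at x) \<Longrightarrow> partial_deriv i f x = f' (axis i 1)"
  unfolding partial_deriv_def using frechet_derivative_at[of f f' x] by simp

section \<open>Closure of \<open>C_k\<close> under algebraic operations\<close>

lemma C_k_imp_continuous: "C_k k f \<Longrightarrow> continuous_on UNIV f"
  by (cases k) (auto simp: continuous_at_imp_continuous_on differentiable_imp_continuous_within)

lemma C_k_Suc_imp: "C_k (Suc k) f \<Longrightarrow> C_k k f"
proof (induction k arbitrary: f)
  case 0
  then show ?case using C_k_imp_continuous[of "Suc 0" f] by simp
next
  case (Suc k)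
  then show ?case by (metis C_k.simps(2))
qed

lemma C_k_const: "C_k k (\<lambda>_. c)"
proof (induction k arbitrary: c)
  case (Suc k)
  have "partial_deriv i (\<lambda>_::real^'a. c) = (\<lambda>_. 0)" for i
    by (rule ext) (simp add: partial_deriv_eqI[OF has_derivative_const])
  then show ?case using Suc by simp
qed simp

lemma C_k_add: "C_k k f \<Longrightarrow> C_k k g \<Longrightarrow> C_k k (\<lambda>x. f x + g x)"
proof (induction k arbitrary: f g)
  case (Suc k)
  have "partial_deriv i (\<lambda>x. f x + g x) = (\<lambda>x. partial_deriv i f x + partial_deriv i g x)" for i
  proof (rule ext)
    fix x
    have "(f has_derivative frechet_derivative f (at x)) (at x)"
      "(g has_derivative frechet_derivative g (at x)) (at x)"
      using Suc.prems by (auto simp: frechet_derivative_works)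
    from has_derivative_add[OF this]
    show "partial_deriv i (\<lambda>x. f x + g x) x = partial_deriv i f x + partial_deriv i g x"
      by (simp add: partial_deriv_eqI) (simp add: partial_deriv_def)
  qed
  then show ?case using Suc by (simp add: differentiable_add)
qed (simp add: continuous_on_add)

lemma C_k_mult: "C_k k f \<Longrightarrow> C_k k g \<Longrightarrow> C_k k (\<lambda>x. f x * g x)"
proof (induction k arbitrary: f g)
  case (Suc k)
  have "partial_deriv i (\<lambda>x. f x * g x) = (\<lambda>x. f x * partial_deriv i g x + partial_deriv i f x * g x)"
    for i
  proof (rule ext)
    fix x
    have "(f has_derivative frechet_derivative f (at x)) (at x)"
      "(g has_derivative frechet_derivative g (at x)) (at x)"
      using Suc.prems by (auto simp: frechet_derivative_works)
    from has_derivative_mult[OF this]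
    show "partial_deriv i (\<lambda>x. f x * g x) x = f x * partial_deriv i g x + partial_deriv i f x * g x"
      by (simp add: partial_deriv_eqI) (simp add: partial_deriv_def)
  qed
  moreover have "C_k k (\<lambda>x. f x * partial_deriv i g x + partial_deriv i f x * g x)" for i
    using Suc.prems C_k_Suc_imp[OF Suc.prems(1)] C_k_Suc_imp[OF Suc.prems(2)]
    by (intro C_k_add Suc.IH) simp_all
  moreover have "(\<lambda>x. f x * g x) differentiable at x" for x
    using Suc.prems by (simp add: differentiable_mult)
  ultimately show ?case by simp
qed (simp add: continuous_on_mult)

lemma C_k_sum: "(\<And>i. i \<in> I \<Longrightarrow> C_k k (f i)) \<Longrightarrow> C_k k (\<lambda>x. \<Sum>i\<in>I. f i x)"
  by (induction I rule: infinite_finite_induct) (auto simp: C_k_const intro: C_k_add)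

lemma C_k_diff: "C_k k f \<Longrightarrow> C_k k g \<Longrightarrow> C_k k (\<lambda>x. f x - g x)"
  using C_k_add[of k f "\<lambda>x. (-1) * g x"] C_k_mult[OF C_k_const, of k g "-1"] by simp

lemma C_k_component: "C_k k (\<lambda>x. x $ i)"
proof (cases k)
  case (Suc k')
  have "partial_deriv j (\<lambda>x::real^'a. x $ i) = (\<lambda>_. axis j 1 $ i)" for j
    by (rule ext) (simp add: partial_deriv_eqI[OF bounded_linear_imp_has_derivative[OF bounded_linear_vec_nth]])
  then show ?thesis
    using Suc by (simp add: C_k_const bounded_linear_imp_differentiable bounded_linear_vec_nth)
qed (simp add: continuous_on_component)

section \<open>Flat functions, smooth bumps and finite partitions\<close>

definition flat_exp :: "real poly \<Rightarrow> real \<Rightarrow> real" where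
  "flat_exp p x = (if x > 0 then poly p (1 / x) * exp (- (1 / x)) else 0)"

text \<open>With y = 1/x, the x-derivative of p(y) exp(-y) is y^2 (p - p')(y) exp(-y). Carrying a
  polynomial p makes the family closed under differentiation, so smoothness across 0 follows from
  one formula for all orders.\<close>

definition flat_exp_deriv :: "real poly \<Rightarrow> real poly" where
  "flat_exp_deriv p = monom 1 2 * (p - pderiv p)"

lemma flat_exp_tendsto_0: "((\<lambda>x. poly p (1 / x) * exp (- (1 / x))) \<longlongrightarrow> 0) (at_right (0::real))"
proof -
  have "((\<lambda>y::real. y ^ n / exp y) \<longlongrightarrow> 0) at_top" for n
    by (rule tendsto_power_div_exp_0)
  then have "((\<lambda>y. \<Sum>n\<le>degree p. coeff p n * (y ^ n / exp y)) \<longlongrightarrow> (\<Sum>n\<le>degree p. coeff p n * 0)) at_top"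
    by (intro tendsto_sum tendsto_mult_left)
  moreover have "(\<Sum>n\<le>degree p. coeff p n * (y ^ n / exp y)) = poly p y * exp (- y)" for y
    unfolding poly_altdef sum_distrib_right by (simp add: exp_minus field_simps)
  ultimately have "((\<lambda>y. poly p y * exp (- y)) \<longlongrightarrow> 0) at_top" by simp
  from filterlim_compose[OF this filterlim_inverse_at_top_right]
  show ?thesis by (simp add: inverse_eq_divide)
qed

lemma has_field_derivative_flat_exp:
  "(flat_exp p has_field_derivative flat_exp (flat_exp_deriv p) x) (at x)"
proof (cases x "0::real" rule: linorder_cases)
  case greater
  have inv: "((\<lambda>x. 1 / x) has_field_derivative - ((1 / x)\<^sup>2)) (at x)"
    using DERIV_inverse[of x UNIV] greater by (simp add: inverse_eq_divide power2_eq_square)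
  have "((\<lambda>x. poly p (1 / x) * exp (- (1 / x))) has_field_derivative
      poly p (1 / x) * (exp (- (1 / x)) * - (- ((1 / x)\<^sup>2))) +
      poly (pderiv p) (1 / x) * (- ((1 / x)\<^sup>2)) * exp (- (1 / x))) (at x)"
    by (rule DERIV_mult[OF DERIV_chain2[OF poly_DERIV inv]
          DERIV_chain2[OF DERIV_exp DERIV_minus[OF inv]], THEN DERIV_cong]) simp
  then have "((\<lambda>x. poly p (1 / x) * exp (- (1 / x))) has_field_derivative
      flat_exp (flat_exp_deriv p) x) (at x)"
    by (rule DERIV_cong)
      (use greater in \<open>simp add: flat_exp_def flat_exp_deriv_def poly_monom algebra_simps\<close>)
  moreover have "\<forall>\<^sub>F y in nhds x. flat_exp p y = poly p (1 / y) * exp (- (1 / y))"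
    using eventually_nhds_in_open[of "{0<..}" x] greater
    by (auto elim!: eventually_mono simp: flat_exp_def)
  ultimately show ?thesis
    by (rule DERIV_cong_ev[OF refl _ refl, THEN iffD2, rotated])
next
  case less
  have "\<forall>\<^sub>F y in nhds x. flat_exp p y = 0"
    using eventually_nhds_in_open[of "{..<0}" x] less
    by (auto elim!: eventually_mono simp: flat_exp_def)
  then have "(flat_exp p has_field_derivative 0) (at x)"
    by (rule DERIV_cong_ev[OF refl _ refl, THEN iffD2]) (rule DERIV_const)
  then show ?thesis using less by (simp add: flat_exp_def)
next
  case equal
  have "((\<lambda>y. flat_exp p y / y) \<longlongrightarrow> 0) (at_right 0)"
  proof (rule Lim_transform_eventually)
    \<comment> \<open>Dividing by y multiplies the polynomial by its variable 1/y, which is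
      \<open>pCons 0 p\<close>. The difference quotient at 0 is therefore again of the form treated
      in \<open>flat_exp_tendsto_0\<close>.\<close>
    show "((\<lambda>y. poly (pCons 0 p) (1 / y) * exp (- (1 / y))) \<longlongrightarrow> 0) (at_right (0::real))"
      by (rule flat_exp_tendsto_0)
    show "\<forall>\<^sub>F y in at_right 0. poly (pCons 0 p) (1 / y) * exp (- (1 / y)) = flat_exp p y / y"
      using eventually_at_right_less[of "0::real"]
      by eventually_elim (simp add: flat_exp_def)
  qed
  moreover have "((\<lambda>y. flat_exp p y / y) \<longlongrightarrow> 0) (at_left 0)"
    by (rule Lim_transform_eventually[OF tendsto_const])
      (auto simp: eventually_at_left_field flat_exp_def intro!: exI[of _ "-1"])
  ultimately have "((\<lambda>y. flat_exp p y / y) \<longlongrightarrow> 0) (at 0)"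
    using filterlim_split_at by blast
  then show ?thesis using equal by (simp add: DERIV_def flat_exp_def)
qed

text \<open>The chain rule replaces p by \<open>flat_exp_deriv p\<close>, so the induction on k must
  keep p arbitrary.\<close>

lemma C_k_flat_exp: "\<forall>k. C_k k F \<Longrightarrow> C_k k (\<lambda>x. flat_exp p (F x))"
proof (induction k arbitrary: p)
  case 0
  have "continuous_on UNIV (flat_exp p)"
    using has_field_derivative_flat_exp DERIV_isCont continuous_at_imp_continuous_on by blast
  then show ?case
    using 0 C_k_imp_continuous continuous_on_compose2 by (metis C_k.simps(1) subset_UNIV)
next
  case (Suc k)
  have der: "((\<lambda>x. flat_exp p (F x)) has_derivative
      (\<lambda>h. frechet_derivative F (at x) h * flat_exp (flat_exp_deriv p) (F x))) (at x)" for x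
  proof -
    have "F differentiable at x" using Suc.prems by (metis C_k.simps(2))
    then have "(F has_derivative frechet_derivative F (at x)) (at x)"
      by (simp add: frechet_derivative_works)
    from has_derivative_compose[OF this has_field_derivative_flat_exp[unfolded has_field_derivative_def]]
    show ?thesis by (simp add: mult.commute)
  qed
  have "partial_deriv i (\<lambda>x. flat_exp p (F x)) =
      (\<lambda>x. partial_deriv i F x * flat_exp (flat_exp_deriv p) (F x))" for i
    by (rule ext) (simp add: partial_deriv_eqI[OF der], simp add: partial_deriv_def)
  moreover have "C_k k (partial_deriv i F)" for i using Suc.prems by (metis C_k.simps(2))
  ultimately show ?case
    using Suc by (auto intro!: C_k_mult differentiableI[OF der])
qed

lemma flat_exp_1_mono: "x \<le> y \<Longrightarrow> flat_exp 1 x \<le> flat_exp 1 y"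
  by (auto simp: flat_exp_def frac_le)

lemma flat_exp_1_pos: "x > 0 \<Longrightarrow> flat_exp 1 x > 0"
  by (simp add: flat_exp_def)

text \<open>Composing \<open>flat_exp 1\<close> with itself gives a plateau without dividing smooth functions.\<close>

lemma smooth_bump_exists:
  fixes p :: "real^'d"
  assumes "\<rho> > 0"
  obtains b :: "real^'d \<Rightarrow> real" where "\<forall>k. C_k k b" "\<And>x. 0 \<le> b x" "\<And>x. b x \<le> 1"
    "\<And>x. x \<in> ball p (\<rho> / 2) \<Longrightarrow> b x = 1" "\<And>x. x \<notin> ball p \<rho> \<Longrightarrow> b x = 0"
proof
  define N where "N x = (\<Sum>i\<in>UNIV. (x $ i - p $ i) * (x $ i - p $ i))" for x :: "real^'d"
  \<comment> \<open>Normalised so that F is at least 1 on the half ball, where N is at most \<rho>^2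
    / 4, and at most 0 outside the full ball.\<close>
  define F where "F x = 4 / (3 * \<rho>\<^sup>2) * (\<rho>\<^sup>2 - N x)" for x
  define c where "c = flat_exp 1 1"
  \<comment> \<open>Where F >= 1 the inner flat function vanishes and b takes its maximum 1. Where F
    <= 0 the inner value is at least c, so the outer argument is nonpositive and b vanishes.\<close>
  define b where "b x = (1 / flat_exp 1 c) * flat_exp 1 (c - flat_exp 1 (1 - F x))" for x
  have N: "N x = (dist p x)\<^sup>2" for x
    by (simp add: N_def dist_norm norm_vec_def L2_set_def sum_nonneg power2_eq_square[symmetric]
        power2_commute)
  have c: "c > 0" unfolding c_def by (rule flat_exp_1_pos) simp
  have cc: "flat_exp 1 c > 0" by (rule flat_exp_1_pos[OF c])
  have nn: "flat_exp 1 x \<ge> 0" for x by (simp add: flat_exp_def)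
  show "\<forall>k. C_k k b"
    unfolding b_def F_def N_def
    by (intro allI C_k_mult C_k_const C_k_flat_exp C_k_diff C_k_sum C_k_component)
  show "0 \<le> b x" for x using cc nn by (simp add: b_def)
  show "b x \<le> 1" for x
    using flat_exp_1_mono[of "c - flat_exp 1 (1 - F x)" c] cc nn[of "1 - F x"]
    by (simp add: b_def divide_le_eq)
  show "b x = 1" if "x \<in> ball p (\<rho> / 2)" for x
  proof -
    have "N x \<le> (\<rho> / 2)\<^sup>2" using that by (auto simp: N intro!: power_mono)
    then have "F x \<ge> 1" using assms by (simp add: F_def field_simps)
    then have "flat_exp 1 (1 - F x) = 0" by (simp add: flat_exp_def)
    then show ?thesis using cc by (simp add: b_def)
  qed
  show "b x = 0" if "x \<notin> ball p \<rho>" for x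
  proof -
    have "N x \<ge> \<rho>\<^sup>2" using that assms by (auto simp: N intro!: power_mono)
    then have "F x \<le> 0" unfolding F_def by (intro mult_nonneg_nonpos) auto
    then have "flat_exp 1 (1 - F x) \<ge> c" unfolding c_def by (intro flat_exp_1_mono) simp
    then show ?thesis by (simp add: b_def flat_exp_def[of 1 "c - _"])
  qed
qed

text \<open>By induction on F: the new function is a bump b times the defect 1 - S of the sum S so
  far. The new sum S' satisfies 1 - S' = (1 - b)(1 - S), so it never exceeds 1 and equals 1 as soon
  as b or S does.\<close>

lemma smooth_partition_finite:
  fixes \<rho> :: "real^'d \<Rightarrow> real"
  assumes "finite F" "\<And>p. p \<in> F \<Longrightarrow> \<rho> p > 0"
  shows "\<exists>\<psi> :: real^'d \<Rightarrow> real^'d \<Rightarrow> real. (\<forall>p\<in>F. (\<forall>k. C_k k (\<psi> p)) \<and> (\<forall>x. \<psi> p x \<ge> 0) \<and> (\<forall>x. x \<notin> ball p (\<rho> p) \<longrightarrow> \<psi> p x = 0)) \<and>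
     (\<forall>x. (\<Sum>p\<in>F. \<psi> p x) \<le> 1) \<and> (\<forall>x\<in>(\<Union>p\<in>F. ball p (\<rho> p / 2)). (\<Sum>p\<in>F. \<psi> p x) = 1)"
  using assms
proof (induction F rule: finite_induct)
  case (insert q F)
  then obtain \<psi> :: "real^'d \<Rightarrow> real^'d \<Rightarrow> real"
    where \<psi>: "\<And>p k. p \<in> F \<Longrightarrow> C_k k (\<psi> p)" "\<And>p x. p \<in> F \<Longrightarrow> \<psi> p x \<ge> 0"
      "\<And>p x. p \<in> F \<Longrightarrow> x \<notin> ball p (\<rho> p) \<Longrightarrow> \<psi> p x = 0"
      "\<And>x. (\<Sum>p\<in>F. \<psi> p x) \<le> 1"
      "\<And>p x. p \<in> F \<Longrightarrow> x \<in> ball p (\<rho> p / 2) \<Longrightarrow> (\<Sum>p\<in>F. \<psi> p x) = 1"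
    by (smt (verit) UN_I insertCI)
  obtain b :: "real^'d \<Rightarrow> real" where b: "\<forall>k. C_k k b" "\<And>x. 0 \<le> b x" "\<And>x. b x \<le> 1"
    "\<And>x. x \<in> ball q (\<rho> q / 2) \<Longrightarrow> b x = 1" "\<And>x. x \<notin> ball q (\<rho> q) \<Longrightarrow> b x = 0"
    using smooth_bump_exists[of "\<rho> q" q] insert by blast
  define S where "S x = (\<Sum>p\<in>F. \<psi> p x)" for x
  define \<psi>' where "\<psi>' = \<psi>(q := \<lambda>x. b x * (1 - S x))"
  have eq: "\<psi>' p = \<psi> p" if "p \<in> F" for p using that insert by (auto simp: \<psi>'_def)
  have sum: "(\<Sum>p\<in>insert q F. \<psi>' p x) = S x + b x * (1 - S x)" for x
    using insert by (simp add: S_def \<psi>'_def) (auto intro!: sum.cong)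
  have S1: "S x \<le> 1" for x using \<psi>(4) by (simp add: S_def)
  have le: "S x + b x * (1 - S x) \<le> 1" for x
    using mult_right_mono[OF b(3)[of x], of "1 - S x"] S1[of x] by simp
  have "C_k k (\<lambda>x. b x * (1 - S x))" for k
    unfolding S_def using b \<psi> by (intro C_k_mult C_k_diff C_k_const C_k_sum) auto
  moreover have "b x * (1 - S x) \<ge> 0" for x using b(2) S1 by (simp add: mult_nonneg_nonneg)
  ultimately have "\<forall>p\<in>insert q F. (\<forall>k. C_k k (\<psi>' p)) \<and> (\<forall>x. \<psi>' p x \<ge> 0) \<and> (\<forall>x. x \<notin> ball p (\<rho> p) \<longrightarrow> \<psi>' p x = 0)"
    using \<psi> eq b by (auto simp: \<psi>'_def)
  moreover have "S x + b x * (1 - S x) = 1" if "x \<in> (\<Union>p\<in>insert q F. ball p (\<rho> p / 2))" for x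
    using that \<psi>(5)[of _ x, folded S_def] b(4)[of x] by auto
  ultimately show ?case using sum le by (intro exI[of _ \<psi>']) auto
qed simp

section \<open>Directional integrals and cone conditions\<close>

text \<open>By the divergence theorem this stands for the surface integral of g (w . \<nu>) with
  outer normal \<nu>. The expansion in partial derivatives makes it linear in w without any
  assumption on g or D.\<close>

definition dir_integral :: "(real^'d) set \<Rightarrow> (real^'d) \<Rightarrow> (real^'d \<Rightarrow> real) \<Rightarrow> real" where
  "dir_integral D w g = (\<Sum>i\<in>UNIV. w $ i * (LINT x:D|lborel. partial_deriv i g x))"

lemma set_integrable_continuous_bounded:
  fixes f :: "'a::euclidean_space \<Rightarrow> real"
  assumes "bounded D" "D \<in> sets borel" "continuous_on UNIV f"
  shows "set_integrable lborel D f"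
proof -
  obtain B where "D \<subseteq> cball 0 B"
    using bounded_subset_ballD[OF assms(1), of 0] ball_subset_cball by blast
  moreover have "set_integrable lborel (cball 0 B) f"
    unfolding set_integrable_def
    by (rule borel_integrable_compact[OF compact_cball continuous_on_subset[OF assms(3) subset_UNIV]])
  moreover have "D \<in> sets lborel" using assms(2) by simp
  ultimately show ?thesis by (intro set_integrable_subset[of lborel "cball 0 B" f D])
qed

lemma dir_integral_scale: "dir_integral D (c *\<^sub>R w) g = c * dir_integral D w g"
  by (simp add: dir_integral_def sum_distrib_left mult.assoc)

lemma dir_integral_add: "dir_integral D (v + w) g = dir_integral D v g + dir_integral D w g"
  by (simp add: dir_integral_def sum.distrib distrib_right)

lemma dir_integral_diff: "dir_integral D (v - w) g = dir_integral D v g - dir_integral D w g"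
  by (simp add: dir_integral_def sum_subtractf left_diff_distrib)

lemma dir_integral_axis: "dir_integral D (axis i 1) g = (LINT x:D|lborel. partial_deriv i g x)"
proof -
  have "dir_integral D (axis i 1) g = (\<Sum>j\<in>{i}. (LINT x:D|lborel. partial_deriv j g x))"
    unfolding dir_integral_def by (rule sum.mono_neutral_cong_right) (auto simp: axis_def)
  then show ?thesis by simp
qed

lemma dir_integral_alt: "dir_integral D w g = (\<Sum>i\<in>UNIV. w $ i * dir_integral D (axis i 1) g)"
  unfolding dir_integral_axis by (simp add: dir_integral_def)

lemma C_k_1_has_derivative:
  assumes "C_k 1 g"
  shows "(g has_derivative (\<lambda>w. \<Sum>i\<in>UNIV. w $ i * partial_deriv i g x)) (at x)"
proof -
  have d: "g differentiable at x" using assms by simp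
  then have "frechet_derivative g (at x) = (\<lambda>w. \<Sum>i\<in>UNIV. w $ i * partial_deriv i g x)"
    using frechet_derivative_partial_deriv by blast
  then show ?thesis using d by (simp add: frechet_derivative_works)
qed

lemma partial_deriv_sum:
  assumes "\<And>j. j \<in> I \<Longrightarrow> C_k 1 (f j)"
  shows "partial_deriv i (\<lambda>x. \<Sum>j\<in>I. f j x) x = (\<Sum>j\<in>I. partial_deriv i (f j) x)"
proof -
  have "((\<lambda>x. \<Sum>j\<in>I. f j x) has_derivative (\<lambda>h. \<Sum>j\<in>I. frechet_derivative (f j) (at x) h)) (at x)"
    using assms by (intro has_derivative_sum) (simp add: frechet_derivative_works)
  from partial_deriv_eqI[OF this] show ?thesis by (simp add: partial_deriv_def)
qed

lemma dir_integral_sum: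
  fixes f :: "'a \<Rightarrow> real^'d \<Rightarrow> real"
  assumes "bounded D" "open D" "\<And>j. j \<in> I \<Longrightarrow> C_k 1 (f j)"
  shows "dir_integral D w (\<lambda>x. \<Sum>j\<in>I. f j x) = (\<Sum>j\<in>I. dir_integral D w (f j))"
proof -
  have "set_integrable lborel D (partial_deriv i (f j))" if "j \<in> I" for i j
    using assms(1,2) assms(3)[OF that] by (intro set_integrable_continuous_bounded) auto
  then have "integrable lborel (\<lambda>x. indicator D x *\<^sub>R partial_deriv i (f j) x)" if "j \<in> I" for i j
    using that by (simp only: set_integrable_def)
  from Bochner_Integration.integral_sum[of I lborel, OF this]
  have "(LINT x:D|lborel. partial_deriv i (\<lambda>x. \<Sum>j\<in>I. f j x) x) =
      (\<Sum>j\<in>I. LINT x:D|lborel. partial_deriv i (f j) x)" for i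
    by (simp only: partial_deriv_sum[of I f, OF assms(3)] set_lebesgue_integral_def scaleR_sum_right)
  then show ?thesis
    by (simp add: dir_integral_def sum_distrib_left) (rule sum.swap)
qed

lemma dir_integral_add_fun:
  fixes f :: "real^'d \<Rightarrow> real"
  assumes "bounded D" "open D" "C_k 1 f" "C_k 1 g"
  shows "dir_integral D w (\<lambda>x. f x + g x) = dir_integral D w f + dir_integral D w g"
  using dir_integral_sum[OF assms(1,2), of UNIV "\<lambda>b. if b then f else g" w] assms(3,4)
  by (simp add: UNIV_bool add.commute split: if_splits)

lemma partial_deriv_cmult:
  assumes "C_k 1 f"
  shows "partial_deriv i (\<lambda>x. c * f x) x = c * partial_deriv i f x"
proof -
  have "(f has_derivative frechet_derivative f (at x)) (at x)"
    using assms by (simp add: frechet_derivative_works)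
  from partial_deriv_eqI[OF has_derivative_mult_right[OF this]] show ?thesis
    by (simp add: partial_deriv_def)
qed

lemma dir_integral_cmult_fun: "C_k 1 f \<Longrightarrow> dir_integral D w (\<lambda>x. c * f x) = c * dir_integral D w f"
  by (simp add: dir_integral_def partial_deriv_cmult sum_distrib_left mult.left_commute)

text \<open>The g-weighted volume of the points that leave D under the shift by m, minus that of the
  points that enter D. It is the finite-difference counterpart of
  \<open>dir_integral\<close>.\<close>

definition shift_integral :: "(real^'d) set \<Rightarrow> (real^'d \<Rightarrow> real) \<Rightarrow> (real^'d) \<Rightarrow> real" where
  "shift_integral D g m = (\<integral>x. g x * (indicator D x - indicator D (x + m)) \<partial>lborel)"

lemma integrable_shift:
  fixes g :: "real^'d \<Rightarrow> real"
  assumes "bounded D" "open D" "continuous_on UNIV g"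
  shows "integrable lborel (\<lambda>x. g x * indicator D (x + m))"
    and "(\<integral>x. g x * indicator D (x + m) \<partial>lborel) = (\<integral>x. g (x - m) * indicator D x \<partial>lborel)"
proof -
  have c: "continuous_on UNIV (\<lambda>x. g (x - m))"
    by (intro continuous_on_compose2[OF assms(3)] continuous_intros) auto
  have i: "integrable lborel (\<lambda>x. g (x - m) * indicator D x)"
    using set_integrable_continuous_bounded[OF assms(1) _ c] assms(2)
    by (simp add: set_integrable_def mult.commute)
  have "integrable (distr lborel borel ((+) m)) (\<lambda>x. g (x - m) * indicator D x)"
    using i by (simp add: lborel_distr_plus)
  then show "integrable lborel (\<lambda>x. g x * indicator D (x + m))"
    by (subst (asm) integrable_distr_eq)
      (use i in \<open>auto simp: add.commute borel_measurable_integrable\<close>)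
  have "(\<integral>x. g (x - m) * indicator D x \<partial>lborel) =
      (\<integral>x. g (x - m) * indicator D x \<partial>(distr lborel borel ((+) m)))"
    by (simp add: lborel_distr_plus)
  also have "\<dots> = (\<integral>x. g x * indicator D (x + m) \<partial>lborel)"
    by (subst integral_distr) (use i in \<open>auto simp: add.commute borel_measurable_integrable\<close>)
  finally show "(\<integral>x. g x * indicator D (x + m) \<partial>lborel) = (\<integral>x. g (x - m) * indicator D x \<partial>lborel)" ..
qed

lemma integrable_shift_integrand:
  fixes g :: "real^'d \<Rightarrow> real"
  assumes "bounded D" "open D" "continuous_on UNIV g"
  shows "integrable lborel (\<lambda>x. g x * (indicator D x - indicator D (x + m)))"
  using integrable_shift(1)[OF assms, of 0] integrable_shift(1)[OF assms, of m]
  by (simp add: right_diff_distrib)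

lemma shift_integral_eq:
  fixes g :: "real^'d \<Rightarrow> real"
  assumes "bounded D" "open D" "continuous_on UNIV g"
  shows "shift_integral D g m = (LINT x:D|lborel. g x - g (x - m))"
proof -
  have c: "continuous_on UNIV (\<lambda>x. g (x - m))"
    by (intro continuous_on_compose2[OF assms(3)] continuous_intros) auto
  have "shift_integral D g m = (\<integral>x. g x * indicator D x \<partial>lborel) - (\<integral>x. g x * indicator D (x + m) \<partial>lborel)"
    unfolding shift_integral_def
    using integrable_shift(1)[OF assms, of 0] integrable_shift(1)[OF assms, of m]
    by (simp add: right_diff_distrib)
  also have "\<dots> = (LINT x:D|lborel. g x) - (LINT x:D|lborel. g (x - m))"
    by (simp add: integrable_shift(2)[OF assms] set_lebesgue_integral_def mult.commute)
  also have "\<dots> = (LINT x:D|lborel. g x - g (x - m))"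
    using assms(2) by (intro set_integral_diff(2)[symmetric] set_integrable_continuous_bounded assms(1,3) c) auto
  finally show ?thesis .
qed

text \<open>A change of variables moves the shift from the rough indicator to g. What remains is the
  integral over D of g x - g (x - m), whose first-order expansion is uniform because the gradient is
  uniformly continuous on a ball containing D with room to spare.\<close>

lemma shift_integral_asymp:
  fixes g :: "real^'d \<Rightarrow> real"
  assumes D: "bounded D" "open D" and g: "C_k 1 g" and "\<eta> > 0"
  shows "\<exists>\<epsilon>>0. \<forall>m. norm m \<le> \<epsilon> \<longrightarrow> \<bar>shift_integral D g m - dir_integral D m g\<bar> \<le> \<eta> * norm m"
proof -
  define G where "G x = (\<chi> i. partial_deriv i g x)" for x
  have der: "(g has_derivative (\<lambda>w. w \<bullet> G x)) (at x)" for x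
    using C_k_1_has_derivative[OF g, of x] by (simp add: inner_vec_def G_def)
  have contG: "continuous_on UNIV G"
    using g unfolding G_def by (intro continuous_on_vec_lambda) simp
  have cg: "continuous_on UNIV g" using g C_k_imp_continuous by blast
  obtain B where B: "D \<subseteq> cball 0 B" using bounded_subset_ballD[OF D(1), of 0] ball_subset_cball by blast
  have fin: "emeasure lborel D < \<infinity>" using D(1) emeasure_bounded_finite by blast
  define V where "V = measure lborel D"
  \<comment> \<open>The pointwise error is integrated over D, which multiplies it by the volume V;
    the summand 1 covers V = 0.\<close>
  define \<eta>' where "\<eta>' = \<eta> / (V + 1)"
  have V: "V \<ge> 0" by (simp add: V_def)
  have \<eta>': "\<eta>' > 0" using assms(4) V by (simp add: \<eta>'_def)
  have "uniformly_continuous_on (cball 0 (B + 1)) G"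
    by (intro compact_uniformly_continuous continuous_on_subset[OF contG]) auto
  then obtain e where e: "e > 0"
    "\<And>x y. x \<in> cball 0 (B + 1) \<Longrightarrow> y \<in> cball 0 (B + 1) \<Longrightarrow> dist y x < e \<Longrightarrow> dist (G y) (G x) < \<eta>'"
    unfolding uniformly_continuous_on_def using \<eta>' by blast
  \<comment> \<open>At most 1, so that all intermediate points stay in the ball of radius B + 1
    where the modulus of continuity is valid.\<close>
  define \<epsilon> where "\<epsilon> = min (e / 2) 1"
  have \<epsilon>: "\<epsilon> > 0" "\<epsilon> < e" "\<epsilon> \<le> 1" using e by (auto simp: \<epsilon>_def min_def)
  have pw: "\<bar>g x - g (x - m) - m \<bullet> G x\<bar> \<le> \<eta>' * norm m" if "x \<in> D" "norm m \<le> \<epsilon>" for x m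
  proof -
    define h where "h y = g y - y \<bullet> G x" for y
    have "norm (h x - h (x - m)) \<le> \<eta>' * norm (x - (x - m))"
    proof (rule differentiable_bound[of "cball x \<epsilon>" h "\<lambda>y w. w \<bullet> (G y - G x)"])
      show "(h has_derivative (\<lambda>w. w \<bullet> (G y - G x))) (at y within cball x \<epsilon>)" for y
        unfolding h_def inner_diff_right
        by (intro has_derivative_diff has_derivative_at_withinI[OF der]
            has_derivative_inner_left has_derivative_ident)
      show "onorm (\<lambda>w. w \<bullet> (G y - G x)) \<le> \<eta>'" if y: "y \<in> cball x \<epsilon>" for y
      proof (rule onorm_le)
        fix w :: "real^'d"
        have nx: "norm x \<le> B" using B \<open>x \<in> D\<close> by auto
        have "dist y 0 \<le> dist y x + dist x 0" by (rule dist_triangle)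
        then have "y \<in> cball 0 (B + 1)" "x \<in> cball 0 (B + 1)" "dist y x < e"
          using y \<epsilon> nx by (auto simp: dist_commute)
        then have "norm (G y - G x) \<le> \<eta>'" using e(2)[of x y] by (simp add: dist_norm)
        then have "norm w * norm (G y - G x) \<le> \<eta>' * norm w"
          by (subst mult.commute) (rule mult_right_mono, simp_all)
        then show "norm (w \<bullet> (G y - G x)) \<le> \<eta>' * norm w"
          using Cauchy_Schwarz_ineq2[of w "G y - G x"] by (simp add: real_norm_def)
      qed
      show "x \<in> cball x \<epsilon>" "x - m \<in> cball x \<epsilon>" using \<epsilon> that by (auto simp: dist_norm)
    qed simp
    moreover have "h x - h (x - m) = g x - g (x - m) - m \<bullet> G x"
      by (simp add: h_def inner_diff_left)
    ultimately show ?thesis by simp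
  qed
  have "\<bar>shift_integral D g m - dir_integral D m g\<bar> \<le> \<eta> * norm m" if m: "norm m \<le> \<epsilon>" for m
  proof -
    have c1: "continuous_on UNIV (\<lambda>x. g x - g (x - m))"
      by (intro continuous_on_diff cg continuous_on_compose2[OF cg] continuous_intros) auto
    have si: "set_integrable lborel D (\<lambda>x. m $ i * partial_deriv i g x)" for i
      using g D by (intro set_integrable_continuous_bounded continuous_intros) auto
    have s1: "set_integrable lborel D (\<lambda>x. g x - g (x - m))"
      using D by (intro set_integrable_continuous_bounded c1) auto
    have s2: "set_integrable lborel D (\<lambda>x. m \<bullet> G x)"
      using D by (intro set_integrable_continuous_bounded continuous_on_inner continuous_on_const contG) auto
    have "dir_integral D m g = (LINT x:D|lborel. m \<bullet> G x)"
      using Bochner_Integration.integral_sum[of UNIV lborel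
          "\<lambda>i x. indicator D x *\<^sub>R (m $ i * partial_deriv i g x)", OF si[unfolded set_integrable_def]]
      by (simp add: dir_integral_def inner_vec_def G_def set_lebesgue_integral_def
          sum_distrib_left mult.left_commute)
    then have "shift_integral D g m - dir_integral D m g = (LINT x:D|lborel. g x - g (x - m) - m \<bullet> G x)"
      using D s1 s2 by (simp add: shift_integral_eq[OF D cg] set_integral_diff)
    also have "\<bar>\<dots>\<bar> \<le> (LINT x:D|lborel. \<bar>g x - g (x - m) - m \<bullet> G x\<bar>)"
      using set_integral_norm_bound[OF set_integral_diff(1)[OF s1 s2]] by simp
    also have "\<dots> \<le> (LINT x:D|lborel. \<eta>' * norm m)"
      using pw m D fin
      by (intro set_integral_mono set_integrable_abs set_integral_diff s1 s2)
        (auto simp: set_integrable_def)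
    also have "\<dots> = \<eta>' * norm m * V"
      using fin by (simp add: set_lebesgue_integral_def V_def)
    also have "\<dots> \<le> \<eta> * norm m"
    proof -
      have "\<eta>' * V \<le> \<eta>" using assms(4) V by (simp add: \<eta>'_def field_simps)
      from mult_right_mono[OF this norm_ge_zero[of m]] show ?thesis by (simp add: algebra_simps)
    qed
    finally show ?thesis .
  qed
  then show ?thesis using \<epsilon> by blast
qed

text \<open>A derivative inherits the sign of small increments. This is how geometric information on
  D, which speaks of shifts only, reaches \<open>dir_integral\<close>.\<close>

lemma dir_integral_nonnegI:
  fixes g :: "real^'d \<Rightarrow> real"
  assumes D: "bounded D" "open D" and g: "C_k 1 g"
    and "\<epsilon> > 0" and nn: "\<And>h. h > 0 \<Longrightarrow> h * norm w \<le> \<epsilon> \<Longrightarrow> shift_integral D g (h *\<^sub>R w) \<ge> 0"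
  shows "dir_integral D w g \<ge> 0"
proof (rule ccontr)
  define L where "L = dir_integral D w g"
  assume "\<not> dir_integral D w g \<ge> 0"
  then have L: "L < 0" by (simp add: L_def)
  \<comment> \<open>With this choice the remainder is at most half of h * |L|, so a negative L would
    make the shift integral negative. The summand 1 covers w = 0.\<close>
  define \<eta> where "\<eta> = - L / (2 * (norm w + 1))"
  have \<eta>: "\<eta> > 0" using L by (simp add: \<eta>_def divide_neg_pos add_nonneg_pos)
  then obtain e where e: "e > 0"
    "\<And>m. norm m \<le> e \<Longrightarrow> \<bar>shift_integral D g m - dir_integral D m g\<bar> \<le> \<eta> * norm m"
    using shift_integral_asymp[OF D g] by blast
  define h where "h = min e \<epsilon> / (norm w + 1)"
  have h: "h > 0" using e assms by (simp add: h_def add_nonneg_pos)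
  have "h * norm w \<le> h * (norm w + 1)" using h by simp
  also have "h * (norm w + 1) = min e \<epsilon>"
    using add_nonneg_pos[OF norm_ge_zero[of w] zero_less_one] by (simp add: h_def)
  finally have "h * norm w \<le> e" "h * norm w \<le> \<epsilon>" by auto
  then have "0 \<le> h * L + \<eta> * (h * norm w)"
    using e(2)[of "h *\<^sub>R w"] nn[of h] h by (simp add: dir_integral_scale L_def)
  also have "\<dots> = h * (L + \<eta> * norm w)" by (simp add: algebra_simps)
  finally have "0 \<le> L + \<eta> * norm w" using h by (simp add: zero_le_mult_iff)
  also have "\<eta> * norm w \<le> \<eta> * (norm w + 1)" using \<eta> by simp
  also have "\<dots> = - L / 2" using add_nonneg_pos[OF norm_ge_zero[of w] zero_less_one]
    by (simp add: \<eta>_def del: distrib_left_numeral)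
  finally show False using L by simp
qed

lemma frontier_between:
  fixes D :: "'a::euclidean_space set"
  assumes "x \<in> D" "y \<notin> D"
  obtains z where "z \<in> frontier D" "dist z x \<le> dist x y" "dist z y \<le> dist x y"
proof -
  have "closed_segment x y \<inter> frontier D \<noteq> {}"
    using assms by (intro connected_Int_frontier) auto
  then obtain z where "z \<in> closed_segment x y" "z \<in> frontier D" by auto
  then show thesis using that dist_in_closed_segment[of z x y] by (auto simp: dist_commute)
qed

text \<open>A segment from D to its complement meets the frontier, so a shift of length at most e
  changes membership in D only at points where g vanishes. The sign criterion applied to w and to -w
  then gives both inequalities. This allows functions to be altered away from the boundary.\<close>

lemma dir_integral_zero:
  fixes g :: "real^'d \<Rightarrow> real"
  assumes D: "bounded D" "open D" and g: "C_k 1 g"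
    and e: "e > 0" "\<And>x z. z \<in> frontier D \<Longrightarrow> dist z x \<le> e \<Longrightarrow> g x = 0"
  shows "dir_integral D w g = 0"
proof -
  have "shift_integral D g m = 0" if "norm m \<le> e" for m
  proof -
    have "g x * (indicator D x - indicator D (x + m)) = 0" for x
    proof (cases "x \<in> D \<longleftrightarrow> x + m \<in> D")
      case False
      have "dist x (x + m) \<le> e" using that by (simp add: dist_norm)
      then have "g x = 0" using False frontier_between[of x D "x + m"] frontier_between[of "x + m" D x] e(2)
        by (metis dist_commute order_trans)
      then show ?thesis by simp
    qed (auto simp: indicator_def)
    then show ?thesis unfolding shift_integral_def by (simp only: Bochner_Integration.integral_zero)
  qed
  then have "dir_integral D v g \<ge> 0" if "norm v = norm w" for v
    using that by (intro dir_integral_nonnegI[OF D g e(1)]) auto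
  from this[of w] this[of "-w"] dir_integral_scale[of D "-1" w g] show ?thesis by simp
qed

text \<open>\<open>u\<close> is an approximate outer unit normal of \<open>D\<close> at all boundary points in \<open>B\<close>.\<close>

definition cone_on :: "(real^'d) set \<Rightarrow> (real^'d) \<Rightarrow> real \<Rightarrow> (real^'d) set \<Rightarrow> bool" where
  "cone_on D u \<delta> B \<longleftrightarrow> (\<forall>x\<in>B. \<forall>y\<in>B. x \<notin> D \<and> \<delta> * norm (y - x) \<le> (y - x) \<bullet> u \<longrightarrow> y \<notin> D)"

lemma cone_onD:
  "cone_on D u \<delta> B \<Longrightarrow> x \<in> B \<Longrightarrow> y \<in> B \<Longrightarrow> x \<notin> D \<Longrightarrow>
    \<delta> * norm (y - x) \<le> (y - x) \<bullet> u \<Longrightarrow> y \<notin> D"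
  unfolding cone_on_def by blast

text \<open>In surface terms, w . \<nu> >= 0 for each w in the cone around u. In terms of shifts: on
  the support of g, a point outside D cannot enter D when moved by h * w, and h * |w| <= \<rho> / 2
  keeps it in the ball where the cone condition holds.\<close>

lemma dir_integral_nonneg:
  fixes g :: "real^'d \<Rightarrow> real"
  assumes D: "bounded D" "open D" and g: "C_k 1 g"
    and nn: "\<And>x. g x \<ge> 0" and supp: "\<And>x. x \<notin> ball p (\<rho> / 2) \<Longrightarrow> g x = 0"
    and cone: "cone_on D u \<delta> (ball p \<rho>)" and "\<rho> > 0" and w: "\<delta> * norm w \<le> w \<bullet> u"
  shows "dir_integral D w g \<ge> 0"
proof (rule dir_integral_nonnegI[OF D g, of "\<rho> / 2"])
  fix h :: real
  assume h: "h > 0" "h * norm w \<le> \<rho> / 2"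
  have "g x * (indicator D x - indicator D (x + h *\<^sub>R w)) \<ge> 0" for x
  proof (cases "x \<in> ball p (\<rho> / 2) \<and> x \<notin> D")
    case True
    have "dist p (x + h *\<^sub>R w) \<le> dist p x + dist x (x + h *\<^sub>R w)" by (rule dist_triangle)
    then have "x \<in> ball p \<rho>" "x + h *\<^sub>R w \<in> ball p \<rho>"
      using True h zero_le_dist[of p x] \<open>\<rho> > 0\<close> by (simp_all add: dist_norm)
    moreover have "\<delta> * norm (x + h *\<^sub>R w - x) \<le> (x + h *\<^sub>R w - x) \<bullet> u"
      using mult_left_mono[OF w, of h] h by (simp add: algebra_simps)
    ultimately have "x + h *\<^sub>R w \<notin> D" using cone True unfolding cone_on_def by blast
    then show ?thesis using True by simp
  next
    case False
    then show ?thesis using supp nn[of x] by (auto simp: indicator_def)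
  qed
  then show "shift_integral D g (h *\<^sub>R w) \<ge> 0"
    unfolding shift_integral_def by simp
qed (use \<open>\<rho> > 0\<close> in simp)

section \<open>Cone condition at a differentiable boundary\<close>

lemma cone_on_subset: "cone_on D u \<delta> B \<Longrightarrow> A \<subseteq> B \<Longrightarrow> cone_on D u \<delta> A"
  unfolding cone_on_def by blast

text \<open>Near p the set D is the superlevel set of a C^1 function with nonzero gradient. The
  gradient is almost constant on a small ball, so the function cannot increase along any vector of
  the cone around its descent direction.\<close>

lemma C1_boundary_cone:
  fixes D :: "(real^'d) set"
  assumes C1: "C1_boundary \<kappa> D" and p: "p \<in> frontier D" and "\<delta> > 0"
  obtains u \<rho> where "norm u = 1" "\<rho> > 0" "cone_on D u \<delta> (ball p \<rho>)"
proof -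
  obtain V U k \<gamma> where V: "open V" "p \<in> V" and U: "orthogonal_matrix U"
    and \<gamma>: "C1_holder \<kappa> \<gamma>" and inv: "\<And>y c. \<gamma> (y + c *\<^sub>R axis k 1) = \<gamma> y"
    and DV: "D \<inter> V = {z. (U *v z) $ k > \<gamma> (U *v z)} \<inter> V"
    using C1 p unfolding C1_boundary_def by meson
  obtain G where G: "\<And>x. GDERIV \<gamma> x :> G x" and contG: "continuous_on UNIV G"
    using \<gamma> unfolding C1_holder_def by blast
  have G0: "G y $ k = 0" for y
  proof -
    have "((\<lambda>c. y + c *\<^sub>R axis k 1) has_derivative (\<lambda>c. c *\<^sub>R axis k 1)) (at (0::real))"
      by (auto intro!: derivative_eq_intros)
    moreover have "(\<gamma> has_derivative (\<lambda>h. h \<bullet> G y)) (at (y + 0 *\<^sub>R axis k 1))"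
      using G[of y] by (simp add: gderiv_def)
    ultimately have "((\<lambda>c. \<gamma> (y + c *\<^sub>R axis k 1)) has_derivative (\<lambda>c. (c *\<^sub>R axis k 1) \<bullet> G y)) (at 0)"
      by (rule has_derivative_compose)
    then have "((\<lambda>c::real. \<gamma> y) has_derivative (\<lambda>c. (c *\<^sub>R axis k 1) \<bullet> G y)) (at 0)"
      by (simp only: inv)
    from has_derivative_unique[OF this has_derivative_const]
    have "(1 *\<^sub>R axis k 1) \<bullet> G y = 0" by (rule fun_cong)
    then show ?thesis by (simp add: inner_axis')
  qed
  \<comment> \<open>Within V, D is exactly where F is positive; H is the gradient of F. The outer
    direction u below is therefore minus the normalised gradient at p.\<close>
  define F where "F z = (U *v z) $ k - \<gamma> (U *v z)" for z
  define H where "H z = transpose U *v (axis k 1 - G (U *v z))" for z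
  have lin: "bounded_linear ((*v) U)" for U :: "real^'d^'d"
    by (rule matrix_vector_mul_bounded_linear)
  have innerH: "w \<bullet> H z = (U *v w) $ k - (U *v w) \<bullet> G (U *v z)" for w z
  proof -
    have "w \<bullet> H z = (axis k 1 - G (U *v z)) \<bullet> (U *v w)"
      by (simp add: H_def inner_commute[of w] dot_lmul_matrix)
    then show ?thesis by (simp add: inner_diff_left inner_axis' inner_commute[of _ "U *v w"] inner_diff_right inner_axis)
  qed
  have derF: "(F has_derivative (\<lambda>w. w \<bullet> H z)) (at z)" for z
  proof -
    have 1: "((\<lambda>z. \<gamma> (U *v z)) has_derivative (\<lambda>w. (U *v w) \<bullet> G (U *v z))) (at z)"
      using has_derivative_compose[OF bounded_linear_imp_has_derivative[OF lin[of U]]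
          G[of "U *v z", unfolded gderiv_def]] .
    have 2: "((\<lambda>z. (U *v z) $ k) has_derivative (\<lambda>w. (U *v w) $ k)) (at z)"
      using bounded_linear_compose[OF bounded_linear_vec_nth lin] by (rule bounded_linear_imp_has_derivative)
    show ?thesis unfolding F_def innerH by (rule has_derivative_diff[OF 2 1])
  qed
  have contH: "continuous_on UNIV H"
    unfolding H_def
    by (intro bounded_linear.continuous_on[OF lin] continuous_on_diff continuous_on_const
        continuous_on_compose2[OF contG] continuous_on_id) auto
  define N where "N = H p"
  \<comment> \<open>Since \<gamma> is constant in direction \<open>k\<close>, the
    \<open>k\<close>-th entry of \<open>axis k 1 - G (U *v p)\<close> is 1, and the orthogonal
    matrix preserves nonvanishing.\<close>
  have "N \<noteq> 0"
  proof
    assume "N = 0"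
    then have "U *v (transpose U *v (axis k 1 - G (U *v p))) = 0" by (simp add: N_def H_def)
    then have "axis k 1 - G (U *v p) = 0"
      using U by (simp add: matrix_vector_mul_assoc orthogonal_matrix_def del: transpose_matrix_vector)
    then have "(axis k 1 :: real^'d) $ k - G (U *v p) $ k = 0"
      by (metis vector_minus_component zero_index)
    then show False using G0 by simp
  qed
  \<comment> \<open>The variation of the gradient that the cone can absorb: \<delta> |w| <= w . u
    means w . N <= - \<eta> |w|.\<close>
  define \<eta> where "\<eta> = norm N * \<delta>"
  have "\<eta> > 0" using \<open>N \<noteq> 0\<close> \<open>\<delta> > 0\<close> by (simp add: \<eta>_def)
  obtain e where e: "e > 0" "\<And>z. dist z p < e \<Longrightarrow> dist (H z) N < \<eta>"
    using contH \<open>\<eta> > 0\<close> unfolding continuous_on_iff N_def by (metis UNIV_I)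
  obtain e' where e': "e' > 0" "ball p e' \<subseteq> V"
    using V openE by blast
  define \<rho> where "\<rho> = min e e'"
  define u where "u = - (1 / norm N) *\<^sub>R N"
  have est: "F y - F x - (y - x) \<bullet> N \<le> \<eta> * norm (y - x)" if "x \<in> ball p \<rho>" "y \<in> ball p \<rho>" for x y
  proof -
    have "norm ((F y - y \<bullet> N) - (F x - x \<bullet> N)) \<le> \<eta> * norm (y - x)"
    proof (rule differentiable_bound[of "ball p \<rho>" _ "\<lambda>z w. w \<bullet> (H z - N)"])
      show "((\<lambda>z. F z - z \<bullet> N) has_derivative (\<lambda>w. w \<bullet> (H z - N))) (at z within ball p \<rho>)" for z
        unfolding inner_diff_right
        by (intro has_derivative_diff has_derivative_at_withinI[OF derF]
            has_derivative_inner_left has_derivative_ident)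
      show "onorm (\<lambda>w. w \<bullet> (H z - N)) \<le> \<eta>" if "z \<in> ball p \<rho>" for z
      proof (rule onorm_le)
        fix w :: "real^'d"
        have "norm (H z - N) \<le> \<eta>"
          using e(2)[of z] that by (simp add: \<rho>_def dist_norm norm_minus_commute)
        then have "norm w * norm (H z - N) \<le> \<eta> * norm w"
          by (subst mult.commute) (rule mult_right_mono, simp_all)
        then show "norm (w \<bullet> (H z - N)) \<le> \<eta> * norm w"
          using Cauchy_Schwarz_ineq2[of w "H z - N"] by (simp add: real_norm_def)
      qed
    qed (use that in auto)
    then show ?thesis by (simp add: inner_diff_left)
  qed
  have "cone_on D u \<delta> (ball p \<rho>)"
    unfolding cone_on_def
  proof (intro ballI impI, elim conjE)
    fix x y assume xy: "x \<in> ball p \<rho>" "y \<in> ball p \<rho>" "x \<notin> D" and c: "\<delta> * norm (y - x) \<le> (y - x) \<bullet> u"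
    have inV: "x \<in> V" "y \<in> V" using e'(2) xy by (auto simp: \<rho>_def)
    have "norm N * (\<delta> * norm (y - x)) \<le> norm N * ((y - x) \<bullet> u)"
      by (rule mult_left_mono[OF c]) simp
    also have "\<dots> = - ((y - x) \<bullet> N)" using \<open>N \<noteq> 0\<close> by (simp add: u_def)
    finally have "F y \<le> F x" using est[OF xy(1,2)] by (simp add: \<eta>_def algebra_simps)
    moreover have "F x \<le> 0" using xy(3) inV DV unfolding F_def by force
    ultimately show "y \<notin> D" using inV DV unfolding F_def by force
  qed
  moreover have "norm u = 1" "\<rho> > 0" using \<open>N \<noteq> 0\<close> e e' by (auto simp: u_def \<rho>_def)
  ultimately show thesis using that by blast
qed

text \<open>Compactness is used twice: for a finite subcover by half balls, and for a uniform e such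
  that the e-neighbourhood of C is still covered. The sum being 1 on a whole neighbourhood is what
  \<open>dir_integral_zero\<close> and the exit layers require.\<close>

lemma smooth_partition_compact:
  fixes \<rho> :: "real^'d \<Rightarrow> real"
  assumes "compact C" "\<And>p. p \<in> C \<Longrightarrow> \<rho> p > 0"
  obtains F \<psi> e where "finite F" "F \<subseteq> C" "e > 0"
    "\<And>p k. p \<in> F \<Longrightarrow> C_k k (\<psi> p)" "\<And>p x. p \<in> F \<Longrightarrow> \<psi> p x \<ge> 0"
    "\<And>p x. p \<in> F \<Longrightarrow> x \<notin> ball p (\<rho> p) \<Longrightarrow> \<psi> p x = 0"
    "\<And>x. (\<Sum>p\<in>F. \<psi> p x) \<le> (1::real)"
    "\<And>z x. z \<in> C \<Longrightarrow> dist z x \<le> e \<Longrightarrow> (\<Sum>p\<in>F. \<psi> p x) = 1"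
proof -
  have "C \<subseteq> (\<Union>p\<in>C. ball p (\<rho> p / 2))" using assms(2) by force
  then obtain F where F: "F \<subseteq> C" "finite F" "C \<subseteq> (\<Union>p\<in>F. ball p (\<rho> p / 2))"
    using compactE_image[OF assms(1), of C "\<lambda>p. ball p (\<rho> p / 2)"] by auto
  have pos: "\<rho> p > 0" if "p \<in> F" for p using that F assms(2) by auto
  obtain \<psi> :: "real^'d \<Rightarrow> real^'d \<Rightarrow> real" where \<psi>: "\<forall>p\<in>F. (\<forall>k. C_k k (\<psi> p)) \<and> (\<forall>x. \<psi> p x \<ge> 0) \<and>
      (\<forall>x. x \<notin> ball p (\<rho> p) \<longrightarrow> \<psi> p x = 0)" "\<forall>x. (\<Sum>p\<in>F. \<psi> p x) \<le> 1"
    "\<forall>x\<in>(\<Union>p\<in>F. ball p (\<rho> p / 2)). (\<Sum>p\<in>F. \<psi> p x) = 1"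
    using smooth_partition_finite[of F \<rho>, OF F(2) pos] by blast
  have "open (\<Union>p\<in>F. ball p (\<rho> p / 2))" by blast
  then obtain e where e: "e > 0" "(\<Union>x\<in>C. ball x e) \<subseteq> (\<Union>p\<in>F. ball p (\<rho> p / 2))"
    using compact_subset_open_imp_ball_epsilon_subset[OF assms(1) _ F(3)] by blast
  show thesis
  proof (rule that[of F "e / 2" \<psi>])
    show "(\<Sum>p\<in>F. \<psi> p x) = 1" if "z \<in> C" "dist z x \<le> e / 2" for z x
    proof -
      have "x \<in> ball z e" using that e(1) by simp
      then have "x \<in> (\<Union>p\<in>F. ball p (\<rho> p / 2))" using e(2) that(1) by blast
      then show ?thesis using \<psi>(3) by blast
    qed
  qed (use F e \<psi> in auto)
qed

text \<open>Controls the part of a vector field that varies within one ball. The vector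
  \<open>axis i 1\<close> itself need not lie in the cone, but adding 3 u on either side brings it
  there.\<close>

lemma dir_integral_oscillation_le:
  fixes g b :: "real^'d \<Rightarrow> real"
  assumes D: "bounded D" "open D" and g: "C_k 1 g" and b: "C_k 1 b"
    and nn: "\<And>x. g x \<ge> 0" and supp: "\<And>x. x \<notin> ball p (\<rho> / 2) \<Longrightarrow> g x = 0"
    and cone: "cone_on D u \<delta> (ball p \<rho>)" and "\<rho> > 0" and \<delta>: "0 < \<delta>" "\<delta> \<le> 1 / 2" and u: "norm u = 1"
    and bd: "\<And>x. x \<in> ball p \<rho> \<Longrightarrow> \<bar>b x\<bar> \<le> \<delta>'"
  shows "dir_integral D (axis i 1) (\<lambda>x. g x * b x) \<le> 3 * \<delta>' * dir_integral D u g"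
proof -
  have gb: "C_k 1 (\<lambda>x. g x * b x)" using g b by (rule C_k_mult)
  \<comment> \<open>The factor 3 suffices: |w| <= 4 and w . u >= 2, while \<delta> <= 1/2.\<close>
  have w: "\<delta> * norm w \<le> w \<bullet> u" if w: "w = 3 *\<^sub>R u + c *\<^sub>R axis i 1" and c: "\<bar>c\<bar> = 1" for w :: "real^'d" and c
  proof -
    have "norm w \<le> norm (3 *\<^sub>R u) + norm (c *\<^sub>R axis i (1::real))"
      unfolding w by (rule norm_triangle_ineq)
    then have "norm w \<le> 4" using u c by simp
    have "\<bar>c * u $ i\<bar> \<le> 1" using component_le_norm_cart[of u i] u c by (simp add: abs_mult)
    moreover have "w \<bullet> u = 3 + c * u $ i"
      using u by (simp add: w inner_add_left inner_axis' dot_square_norm)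
    ultimately have "w \<bullet> u \<ge> 2" by simp
    moreover have "\<delta> * norm w \<le> 1 / 2 * 4" using \<delta> \<open>norm w \<le> 4\<close> by (intro mult_mono) auto
    ultimately show ?thesis by simp
  qed
  have *: "0 \<le> dir_integral D (3 *\<^sub>R u + c *\<^sub>R axis i 1) (\<lambda>x. \<delta>' * g x + - c * (g x * b x))"
    if c: "c = 1 \<or> c = -1" for c
  proof (rule dir_integral_nonneg[OF D _ _ _ cone \<open>\<rho> > 0\<close> w])
    show "C_k 1 (\<lambda>x. \<delta>' * g x + - c * (g x * b x))"
      by (intro C_k_add C_k_mult[OF C_k_const] g gb)
    show "\<delta>' * g x + - c * (g x * b x) \<ge> 0" for x
    proof (cases "x \<in> ball p \<rho>")
      case True
      have "0 \<le> g x * (\<delta>' - c * b x)" using nn bd[OF True] c by (intro mult_nonneg_nonneg) auto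
      then show ?thesis by (simp add: algebra_simps)
    next
      case False
      then have "x \<notin> ball p (\<rho> / 2)" using \<open>\<rho> > 0\<close> by auto
      then show ?thesis by (simp add: supp)
    qed
    show "\<delta>' * g x + - c * (g x * b x) = 0" if "x \<notin> ball p (\<rho> / 2)" for x
      using supp[OF that] by simp
  qed (use c in auto)
  have eq: "dir_integral D v (\<lambda>x. \<delta>' * g x + - c * (g x * b x)) =
      \<delta>' * dir_integral D v g - c * dir_integral D v (\<lambda>x. g x * b x)" for v c
    using dir_integral_add_fun[OF D C_k_mult[OF C_k_const g] C_k_mult[OF C_k_const gb], of v \<delta>' "- c"]
    by (simp only: dir_integral_cmult_fun[OF g] dir_integral_cmult_fun[OF gb])
  \<comment> \<open>Adding the inequalities for c = 1 and c = -1 cancels the terms with b in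
    direction u and those with g in direction \<open>axis i 1\<close>. This leaves 6 \<delta>' times
    the integral of g along u against twice the wanted one.\<close>
  show ?thesis
    using *[of 1] *[of "-1"]
    by (simp only: eq dir_integral_add dir_integral_scale) (simp add: algebra_simps)
qed

text \<open>For w = (1 + \<eta>) u - c and z = w . u, expanding the square gives |w|^2 <= 4 z, and z
  >= \<eta>. Hence \<delta>^2 |w|^2 <= 4 \<delta>^2 z <= z^2. It serves to bound the flux of a
  constant field c by (1 + \<eta>) times that of u.\<close>

lemma cone_unit_vector_le:
  fixes u c :: "'a::real_inner"
  assumes "norm u = 1" "norm c \<le> 1" "0 < \<delta>" "4 * \<delta>\<^sup>2 \<le> \<eta>" "\<eta> \<le> 1"
  shows "\<delta> * norm ((1 + \<eta>) *\<^sub>R u - c) \<le> ((1 + \<eta>) *\<^sub>R u - c) \<bullet> u"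
proof -
  define s where "s = c \<bullet> u"
  define z where "z = 1 + \<eta> - s"
  have uu: "u \<bullet> u = 1" using assms(1) by (simp add: dot_square_norm)
  have "0 < 4 * \<delta>\<^sup>2" using assms(3) by simp
  then have eta: "\<eta> > 0" using assms(4) by linarith
  have "s \<le> 1" using norm_cauchy_schwarz[of c u] assms(1,2) by (simp add: s_def)
  then have z: "z \<ge> \<eta>" by (simp add: z_def)
  have eq: "((1 + \<eta>) *\<^sub>R u - c) \<bullet> u = z"
    by (simp add: z_def s_def inner_diff_left uu)
  have cc: "c \<bullet> c \<le> 1" using assms(2) by (simp add: dot_square_norm power_le_one)
  have "(norm ((1 + \<eta>) *\<^sub>R u - c))\<^sup>2 = (1 + \<eta>)\<^sup>2 - 2 * (1 + \<eta>) * s + c \<bullet> c"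
    unfolding power2_norm_eq_inner
    by (simp add: inner_diff_left inner_diff_right uu s_def inner_commute power2_eq_square algebra_simps)
  also have "\<dots> \<le> 2 * (1 + \<eta>) * z + 1 - (1 + \<eta>)\<^sup>2"
    using cc by (simp add: z_def power2_eq_square algebra_simps)
  also have "\<dots> \<le> 2 * (1 + \<eta>) * z" using eta by (simp add: power2_eq_square algebra_simps)
  also have "\<dots> \<le> 4 * z" using assms(5) z eta by (intro mult_right_mono) auto
  finally have n: "(norm ((1 + \<eta>) *\<^sub>R u - c))\<^sup>2 \<le> 4 * z" .
  have "(\<delta> * norm ((1 + \<eta>) *\<^sub>R u - c))\<^sup>2 \<le> \<delta>\<^sup>2 * (4 * z)"
    unfolding power_mult_distrib by (intro mult_left_mono n) auto
  also have "\<dots> = 4 * \<delta>\<^sup>2 * z" by simp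
  also have "\<dots> \<le> z * z" using assms(4) z eta by (intro mult_right_mono) auto
  finally have "(\<delta> * norm ((1 + \<eta>) *\<^sub>R u - c))\<^sup>2 \<le> z\<^sup>2" by (simp add: power2_eq_square)
  then show ?thesis unfolding eq by (rule power2_le_imp_le) (use z eta in simp)
qed

definition div_integral :: "(real^'d) set \<Rightarrow> (real^'d \<Rightarrow> real^'d) \<Rightarrow> real" where
  "div_integral D \<phi> = (\<Sum>i\<in>UNIV. dir_integral D (axis i 1) (\<lambda>x. \<phi> x $ i))"

lemma div_integral_eq:
  fixes \<phi> :: "real^'d \<Rightarrow> real^'d"
  assumes D: "bounded D" "open D" and "\<And>i. C_k 1 (\<lambda>x. \<phi> x $ i)"
  shows "(LINT x:D|lborel. \<Sum>i\<in>UNIV. partial_deriv i (\<lambda>y. \<phi> y $ i) x) = div_integral D \<phi>"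
proof -
  have "set_integrable lborel D (partial_deriv i (\<lambda>y. \<phi> y $ i))" for i
    using assms(3)[of i] D by (intro set_integrable_continuous_bounded) auto
  then have "integrable lborel (\<lambda>x. indicator D x *\<^sub>R partial_deriv i (\<lambda>y. \<phi> y $ i) x)" for i
    by (simp only: set_integrable_def)
  from Bochner_Integration.integral_sum[of UNIV lborel, OF this]
  show ?thesis
    by (simp only: div_integral_def dir_integral_axis set_lebesgue_integral_def scaleR_sum_right)
qed

text \<open>The field is frozen at the centre p. Its constant part is compared with u through
  \<open>cone_unit_vector_le\<close>, and each of the d components of the remainder costs 3
  \<delta>'.\<close>

lemma div_integral_local_le:
  fixes \<phi> :: "real^'d \<Rightarrow> real^'d"
  assumes D: "bounded D" "open D" and g: "C_k 1 g" and \<phi>: "\<And>i. C_k 1 (\<lambda>x. \<phi> x $ i)"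
    and nn: "\<And>x. g x \<ge> 0" and supp: "\<And>x. x \<notin> ball p (\<rho> / 2) \<Longrightarrow> g x = 0"
    and cone: "cone_on D u \<delta> (ball p \<rho>)" and "\<rho> > 0" and \<delta>: "0 < \<delta>" "\<delta> \<le> 1 / 2" and u: "norm u = 1"
    and bd: "\<And>x i. x \<in> ball p \<rho> \<Longrightarrow> \<bar>\<phi> x $ i - \<phi> p $ i\<bar> \<le> \<delta>'"
    and "norm (\<phi> p) \<le> 1" "4 * \<delta>\<^sup>2 \<le> \<eta>" "\<eta> \<le> 1"
  shows "div_integral D (\<lambda>x. g x *\<^sub>R \<phi> x) \<le> (1 + \<eta> + 3 * real CARD('d) * \<delta>') * dir_integral D u g"
proof -
  define c where "c = \<phi> p"
  define b where "b i x = \<phi> x $ i - c $ i" for i x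
  have b: "C_k 1 (b i)" for i unfolding b_def by (intro C_k_diff \<phi> C_k_const)
  have "dir_integral D (axis i 1) (\<lambda>x. (g x *\<^sub>R \<phi> x) $ i) \<le>
      c $ i * dir_integral D (axis i 1) g + 3 * \<delta>' * dir_integral D u g" for i
  proof -
    have "(\<lambda>x. (g x *\<^sub>R \<phi> x) $ i) = (\<lambda>x. c $ i * g x + g x * b i x)"
      by (rule ext) (simp add: b_def algebra_simps)
    then have "dir_integral D (axis i 1) (\<lambda>x. (g x *\<^sub>R \<phi> x) $ i) =
        c $ i * dir_integral D (axis i 1) g + dir_integral D (axis i 1) (\<lambda>x. g x * b i x)"
      using dir_integral_add_fun[OF D C_k_mult[OF C_k_const g] C_k_mult[OF g b]]
      by (simp only: dir_integral_cmult_fun[OF g])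
    moreover have "dir_integral D (axis i 1) (\<lambda>x. g x * b i x) \<le> 3 * \<delta>' * dir_integral D u g"
      using bd by (intro dir_integral_oscillation_le[OF D g b nn supp cone \<open>\<rho> > 0\<close> \<delta> u])
        (auto simp: b_def c_def)
    ultimately show ?thesis by simp
  qed
  then have "div_integral D (\<lambda>x. g x *\<^sub>R \<phi> x) \<le>
      (\<Sum>i\<in>UNIV. c $ i * dir_integral D (axis i 1) g + 3 * \<delta>' * dir_integral D u g)"
    unfolding div_integral_def by (intro sum_mono)
  also have "\<dots> = dir_integral D c g + 3 * real CARD('d) * \<delta>' * dir_integral D u g"
    by (simp add: sum.distrib dir_integral_alt[of D c])
  also have "dir_integral D c g \<le> (1 + \<eta>) * dir_integral D u g"
    using dir_integral_nonneg[OF D g nn supp cone \<open>\<rho> > 0\<close> cone_unit_vector_le[OF u, of c \<delta> \<eta>]]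
      assms \<delta> by (simp add: c_def dir_integral_diff dir_integral_scale)
  finally show ?thesis by (simp add: algebra_simps)
qed

section \<open>Volume of exit layers\<close>

text \<open>K will be the set of positions of a path started at 0, restricted to countably many
  times, so the layer consists of the starting points in D from which the translated path is seen
  outside D.\<close>

definition exit_layer :: "(real^'d) set \<Rightarrow> (real^'d) set \<Rightarrow> (real^'d) set" where
  "exit_layer D K = {x\<in>D. \<exists>k\<in>K. x + k \<notin> D}"

lemma exit_layer_borel [measurable]:
  assumes "open D" "countable K"
  shows "exit_layer D K \<in> sets borel"
proof -
  have "exit_layer D K = (\<Union>k\<in>K. D - (\<lambda>x. x + k) -` D)"
    by (auto simp: exit_layer_def)
  moreover have "D - (\<lambda>x. x + k) -` D \<in> sets borel" for k
    using assms(1) by (intro sets.Diff borel_open open_vimage continuous_intros) auto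
  ultimately show ?thesis using assms(2) by (simp only: sets.countable_UN'')
qed

text \<open>With m = (h + 3 \<delta> r) u, each k in K satisfies |m - k| <= 3 r and (m - k) . u >= 3
  \<delta> r. So m - k lies in the cone, and x + k outside D forces x + m outside D. The condition 4
  r <= \<rho> keeps all these points in the ball.\<close>

lemma indicator_exit_layer_le:
  fixes u :: "real^'d"
  assumes cone: "cone_on D u \<delta> (ball p \<rho>)" and u: "norm u = 1" and \<delta>: "0 < \<delta>" "\<delta> \<le> 1 / 3"
    and x: "x \<in> ball p (\<rho> / 2)" and r: "0 < r" "4 * r \<le> \<rho>" and h: "0 \<le> h" "h \<le> r"
    and K: "\<And>k. k \<in> K \<Longrightarrow> norm k \<le> r" "\<And>k. k \<in> K \<Longrightarrow> k \<bullet> u \<le> h"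
  shows "indicator (exit_layer D K) x \<le> (indicator D x - indicator D (x + (h + 3 * \<delta> * r) *\<^sub>R u) :: real)"
proof -
  define m where "m = (h + 3 * \<delta> * r) *\<^sub>R u"
  have "\<delta> * r \<le> 1 / 3 * r" using \<delta> r by (intro mult_right_mono) auto
  then have c: "0 \<le> h + 3 * \<delta> * r" "h + 3 * \<delta> * r \<le> 2 * r"
    using h \<delta> r by simp (use h \<open>\<delta> * r \<le> 1 / 3 * r\<close> in linarith)
  then have m: "norm m \<le> 2 * r" "norm m = h + 3 * \<delta> * r" using u by (auto simp: m_def)
  have mu: "m \<bullet> u = h + 3 * \<delta> * r" using u by (simp add: m_def dot_square_norm)
  have inball: "x + w \<in> ball p \<rho>" if "norm w \<le> 2 * r" for w
  proof -
    have "dist p (x + w) \<le> dist p x + dist x (x + w)" by (rule dist_triangle)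
    then show ?thesis using x r that by (simp add: dist_norm)
  qed
  have "x + m \<notin> D" if "x \<notin> D"
  proof -
    have "\<delta> * norm m \<le> 1 * norm m" using \<delta> by (intro mult_right_mono) auto
    then have "\<delta> * norm (x + m - x) \<le> (x + m - x) \<bullet> u" using m mu by simp
    moreover have "x \<in> ball p \<rho>" using inball[of 0] r by simp
    ultimately show ?thesis
      using cone_onD[OF cone _ inball[OF m(1)] that] by blast
  qed
  moreover have "x + m \<notin> D" if L: "x \<in> exit_layer D K"
  proof -
    obtain k where k: "k \<in> K" "x + k \<notin> D" using L by (auto simp: exit_layer_def)
    have "norm (m - k) \<le> norm m + norm k" by (rule norm_triangle_ineq4)
    then have "norm (m - k) \<le> 3 * r" using m K(1)[OF k(1)] by simp
    then have "\<delta> * norm (m - k) \<le> \<delta> * (3 * r)" using \<delta> by (intro mult_left_mono) auto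
    also have "\<dots> \<le> (m - k) \<bullet> u" using K(2)[OF k(1)] mu by (simp add: inner_diff_left)
    finally have "\<delta> * norm (x + m - (x + k)) \<le> (x + m - (x + k)) \<bullet> u" by simp
    moreover have "norm k \<le> 2 * r" using K(1)[OF k(1)] r by simp
    ultimately show ?thesis
      using cone_onD[OF cone inball inball[OF m(1)] k(2)] by blast
  qed
  ultimately show ?thesis
    unfolding m_def[symmetric] by (auto simp: indicator_def exit_layer_def)
qed

text \<open>The same argument with the roles of k and m exchanged. The supremum h need not be
  attained, so one more \<delta> r is lost and 3 becomes 4. If h - 4 \<delta> r is not positive, the
  truncated shift is 0 and the left side vanishes.\<close>

lemma indicator_exit_layer_ge:
  fixes u :: "real^'d"
  assumes cone: "cone_on D u \<delta> (ball p \<rho>)" and u: "norm u = 1" and \<delta>: "0 < \<delta>"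
    and x: "x \<in> ball p (\<rho> / 2)" and r: "0 < r" "4 * r \<le> \<rho>" and h: "h \<le> r"
    and K: "\<And>k. k \<in> K \<Longrightarrow> norm k \<le> r" and ex: "\<exists>k\<in>K. k \<bullet> u \<ge> h - \<delta> * r"
  shows "(indicator D x - indicator D (x + max 0 (h - 4 * \<delta> * r) *\<^sub>R u) :: real) \<le> indicator (exit_layer D K) x"
proof -
  define c where "c = max 0 (h - 4 * \<delta> * r)"
  define m where "m = c *\<^sub>R u"
  have m: "norm m = c" using u by (simp add: m_def c_def)
  have mu: "m \<bullet> u = c" using u by (simp add: m_def dot_square_norm)
  have inball: "x + w \<in> ball p \<rho>" if "norm w \<le> 2 * r" for w
  proof -
    have "dist p (x + w) \<le> dist p x + dist x (x + w)" by (rule dist_triangle)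
    then show ?thesis using x r that by (simp add: dist_norm)
  qed
  have "x \<in> exit_layer D K" if "x \<in> D" "x + m \<notin> D"
  proof -
    have "c > 0" using that by (cases "c = 0") (auto simp: m_def c_def)
    then have ch: "c = h - 4 * \<delta> * r" by (auto simp: c_def max_def split: if_splits)
    moreover have "0 < \<delta> * r" using \<delta> r by simp
    ultimately have "c \<le> r" using h by linarith
    obtain k where k: "k \<in> K" "k \<bullet> u \<ge> h - \<delta> * r" using ex by blast
    have "norm (k - m) \<le> norm k + norm m" by (rule norm_triangle_ineq4)
    then have "norm (k - m) \<le> 3 * r" using m K[OF k(1)] \<open>c \<le> r\<close> r by simp
    then have "\<delta> * norm (k - m) \<le> \<delta> * (3 * r)" using \<delta> by (intro mult_left_mono) auto
    also have "\<dots> \<le> (k - m) \<bullet> u" using k(2) mu ch by (simp add: inner_diff_left)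
    finally have "\<delta> * norm (x + k - (x + m)) \<le> (x + k - (x + m)) \<bullet> u" by simp
    moreover have "norm k \<le> 2 * r" "norm m \<le> 2 * r" using K[OF k(1)] r m \<open>c \<le> r\<close> by auto
    ultimately have "x + k \<notin> D"
      using cone_onD[OF cone inball inball that(2)] by blast
    then show ?thesis using that(1) k(1) by (auto simp: exit_layer_def)
  qed
  then show ?thesis
    unfolding c_def[symmetric] m_def[symmetric] by (auto simp: indicator_def)
qed

section \<open>Perimeter and layer volume compared through one partition\<close>

lemma finite_pos_lower_bound:
  fixes f :: "'a \<Rightarrow> real"
  assumes "finite I" "\<And>i. i \<in> I \<Longrightarrow> f i > 0"
  obtains e where "e > 0" "\<And>i. i \<in> I \<Longrightarrow> e \<le> f i"
proof (rule that[of "Min (insert 1 (f ` I))"])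
  show "Min (insert 1 (f ` I)) > 0" using assms by (subst Min_gr_iff) auto
  show "Min (insert 1 (f ` I)) \<le> f i" if "i \<in> I" for i using assms(1) that by (intro Min_le) auto
qed

lemma perimeter_ge:
  fixes \<phi> :: "real^'d \<Rightarrow> real^'d"
  assumes D: "bounded D" "open D" and "\<And>i. test_function (\<lambda>x. \<phi> x $ i)" "\<And>x. norm (\<phi> x) \<le> 1"
  shows "ereal (div_integral D \<phi>) \<le> perimeter D"
proof -
  have "C_k 1 (\<lambda>x. \<phi> x $ i)" for i using assms(3)[of i] unfolding test_function_def by blast
  note eq = div_integral_eq[OF D this]
  have "(\<Sum>i\<in>UNIV. (\<phi> x $ i)\<^sup>2) \<le> 1" for x
  proof -
    have "(\<Sum>i\<in>UNIV. (\<phi> x $ i)\<^sup>2) = (norm (\<phi> x))\<^sup>2"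
      by (simp add: norm_vec_def L2_set_def sum_nonneg)
    then show ?thesis using assms(4)[of x] by (simp add: power_le_one)
  qed
  then show ?thesis
    unfolding perimeter_def eq[symmetric] using assms(3) by (intro SUP_upper) auto
qed

text \<open>The sum of \<psi> p x times unit vectors has norm at most the sum of the weights, hence
  at most 1, and its support lies in finitely many balls.\<close>

lemma perimeter_partition_ge:
  fixes \<psi> :: "'a \<Rightarrow> real^'d \<Rightarrow> real" and u :: "'a \<Rightarrow> real^'d"
  assumes D: "bounded D" "open D" and "finite F"
    and sm: "\<And>p k. p \<in> F \<Longrightarrow> C_k k (\<psi> p)" and nn: "\<And>p x. p \<in> F \<Longrightarrow> \<psi> p x \<ge> 0"
    and supp: "\<And>p x. p \<in> F \<Longrightarrow> x \<notin> ball (c p) (\<rho> p) \<Longrightarrow> \<psi> p x = 0"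
    and le: "\<And>x. (\<Sum>p\<in>F. \<psi> p x) \<le> 1" and u: "\<And>p. p \<in> F \<Longrightarrow> norm (u p) = 1"
  shows "ereal (\<Sum>p\<in>F. dir_integral D (u p) (\<psi> p)) \<le> perimeter D"
proof -
  define \<phi> where "\<phi> x = (\<Sum>p\<in>F. \<psi> p x *\<^sub>R u p)" for x
  have comp: "(\<lambda>x. \<phi> x $ i) = (\<lambda>x. \<Sum>p\<in>F. u p $ i * \<psi> p x)" for i
    by (rule ext) (simp add: \<phi>_def mult.commute)
  have "bounded (\<Union>p\<in>F. cball (c p) (\<rho> p))" using \<open>finite F\<close> by blast
  then obtain R where R: "(\<Union>p\<in>F. cball (c p) (\<rho> p)) \<subseteq> cball 0 R"
    using bounded_subset_ballD[of _ 0] ball_subset_cball by (metis order_trans)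
  have z: "\<phi> x = 0" if "x \<notin> cball 0 R" for x
  proof -
    have "\<psi> p x = 0" if "p \<in> F" for p
      using R \<open>x \<notin> cball 0 R\<close> that ball_subset_cball by (intro supp) blast+
    then show ?thesis by (simp add: \<phi>_def)
  qed
  have "test_function (\<lambda>x. \<phi> x $ i)" for i
  proof -
    have "closure {x. \<phi> x $ i \<noteq> 0} \<subseteq> cball 0 R"
      using z by (intro closure_minimal) (auto, metis zero_index z mem_cball_0)
    then have "compact (closure {x. \<phi> x $ i \<noteq> 0})"
      by (meson bounded_cball bounded_subset closed_closure compact_eq_bounded_closed)
    moreover have "C_k k (\<lambda>x. \<phi> x $ i)" for k
      unfolding comp by (intro C_k_sum C_k_mult C_k_const sm)
    ultimately show ?thesis by (simp add: test_function_def)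
  qed
  moreover have "norm (\<phi> x) \<le> 1" for x
  proof -
    have "norm (\<phi> x) \<le> (\<Sum>p\<in>F. norm (\<psi> p x *\<^sub>R u p))"
      unfolding \<phi>_def by (rule norm_sum)
    also have "\<dots> = (\<Sum>p\<in>F. \<psi> p x)" using u nn by (intro sum.cong) auto
    also have "\<dots> \<le> 1" by (rule le)
    finally show ?thesis .
  qed
  ultimately have "ereal (div_integral D \<phi>) \<le> perimeter D" by (rule perimeter_ge[OF D])
  moreover have "div_integral D \<phi> = (\<Sum>p\<in>F. dir_integral D (u p) (\<psi> p))"
  proof -
    have "dir_integral D (axis i 1) (\<lambda>x. \<phi> x $ i) = (\<Sum>p\<in>F. u p $ i * dir_integral D (axis i 1) (\<psi> p))" for i
      unfolding comp
      by (subst dir_integral_sum[OF D C_k_mult[OF C_k_const sm]]) (simp_all only: dir_integral_cmult_fun[OF sm] cong: sum.cong)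
    then have "div_integral D \<phi> = (\<Sum>i\<in>UNIV. \<Sum>p\<in>F. u p $ i * dir_integral D (axis i 1) (\<psi> p))"
      by (simp add: div_integral_def)
    also have "\<dots> = (\<Sum>p\<in>F. dir_integral D (u p) (\<psi> p))"
      by (subst sum.swap) (simp only: dir_integral_alt[symmetric])
    finally show ?thesis .
  qed
  ultimately show ?thesis by simp
qed

text \<open>The part of f not captured by the partition vanishes near the frontier, so
  \<open>dir_integral_zero\<close> removes it.\<close>

lemma dir_integral_partition:
  fixes f :: "real^'d \<Rightarrow> real"
  assumes D: "bounded D" "open D" and f: "C_k 1 f" and \<psi>: "\<And>p. p \<in> F \<Longrightarrow> C_k 1 (\<psi> p)"
    and "e > 0" and one: "\<And>z x. z \<in> frontier D \<Longrightarrow> dist z x \<le> e \<Longrightarrow> (\<Sum>p\<in>F. \<psi> p x) = 1"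
  shows "dir_integral D w f = (\<Sum>p\<in>F. dir_integral D w (\<lambda>x. \<psi> p x * f x))"
proof -
  have c: "C_k 1 (\<lambda>x. \<psi> p x * f x)" if "p \<in> F" for p by (rule C_k_mult[OF \<psi>[OF that] f])
  define g where "g x = f x - (\<Sum>p\<in>F. \<psi> p x * f x)" for x
  have g: "C_k 1 g" unfolding g_def by (intro C_k_diff C_k_sum c f)
  have "g x = 0" if "z \<in> frontier D" "dist z x \<le> e" for x z
    using one[OF that] by (simp add: g_def sum_distrib_right[symmetric])
  then have "dir_integral D w g = 0" using dir_integral_zero[OF D g \<open>e > 0\<close>] by blast
  moreover have "dir_integral D w f = dir_integral D w (\<lambda>x. g x + (\<Sum>p\<in>F. \<psi> p x * f x))"
    by (simp add: g_def)
  ultimately show ?thesis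
    using dir_integral_add_fun[OF D g C_k_sum, of F "\<lambda>p x. \<psi> p x * f x" w]
      dir_integral_sum[OF D, of F "\<lambda>p x. \<psi> p x * f x" w] c by simp
qed

text \<open>Local comparisons of indicators are weighted by \<psi> p and summed. The upper bound
  relies on total weight 1 on the layer, the lower bound on total weight at most 1
  everywhere.\<close>

lemma measure_exit_layer_bounds:
  fixes \<psi> :: "'a \<Rightarrow> real^'d \<Rightarrow> real" and m m' :: "'a \<Rightarrow> real^'d"
  assumes D: "bounded D" "open D" and "countable K"
    and cont: "\<And>p. p \<in> F \<Longrightarrow> continuous_on UNIV (\<psi> p)" and nn: "\<And>p x. p \<in> F \<Longrightarrow> \<psi> p x \<ge> 0"
    and le: "\<And>x. (\<Sum>p\<in>F. \<psi> p x) \<le> 1"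
    and one: "\<And>x. x \<in> exit_layer D K \<Longrightarrow> (\<Sum>p\<in>F. \<psi> p x) = 1"
    and up: "\<And>p x. p \<in> F \<Longrightarrow> \<psi> p x \<noteq> 0 \<Longrightarrow>
      indicator (exit_layer D K) x \<le> (indicator D x - indicator D (x + m p) :: real)"
    and lo: "\<And>p x. p \<in> F \<Longrightarrow> \<psi> p x \<noteq> 0 \<Longrightarrow>
      (indicator D x - indicator D (x + m' p) :: real) \<le> indicator (exit_layer D K) x"
  shows "measure lborel (exit_layer D K) \<le> (\<Sum>p\<in>F. shift_integral D (\<psi> p) (m p))"
    and "(\<Sum>p\<in>F. shift_integral D (\<psi> p) (m' p)) \<le> measure lborel (exit_layer D K)"
proof -
  let ?L = "indicator (exit_layer D K) :: real^'d \<Rightarrow> real"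
  have sL: "exit_layer D K \<in> sets lborel" using exit_layer_borel[OF D(2) assms(3)] by simp
  have "emeasure lborel (exit_layer D K) \<le> emeasure lborel D"
    using D by (intro emeasure_mono) (auto simp: exit_layer_def)
  also have "\<dots> < \<infinity>" using D(1) emeasure_bounded_finite by blast
  finally have iL: "integrable lborel ?L" using sL by (simp add: integrable_indicator_iff)
  have mL: "measure lborel (exit_layer D K) = (\<integral>x. ?L x \<partial>lborel)" using sL by simp
  have si: "integrable lborel (\<lambda>x. \<Sum>p\<in>F. \<psi> p x * (indicator D x - indicator D (x + m p)))" for m :: "'a \<Rightarrow> real^'d"
    by (intro Bochner_Integration.integrable_sum integrable_shift_integrand[OF D cont])
  have s: "(\<Sum>p\<in>F. shift_integral D (\<psi> p) (m p)) =
      (\<integral>x. (\<Sum>p\<in>F. \<psi> p x * (indicator D x - indicator D (x + m p))) \<partial>lborel)" for m :: "'a \<Rightarrow> real^'d"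
    unfolding shift_integral_def
    by (rule Bochner_Integration.integral_sum[symmetric]) (rule integrable_shift_integrand[OF D cont])
  show "measure lborel (exit_layer D K) \<le> (\<Sum>p\<in>F. shift_integral D (\<psi> p) (m p))"
    unfolding mL s
  proof (rule integral_mono[OF iL si])
    fix x
    have "?L x = (\<Sum>p\<in>F. \<psi> p x) * ?L x" using one[of x] by (auto simp: indicator_def)
    also have "\<dots> = (\<Sum>p\<in>F. \<psi> p x * ?L x)" by (rule sum_distrib_right)
    also have "\<dots> \<le> (\<Sum>p\<in>F. \<psi> p x * (indicator D x - indicator D (x + m p)))"
    proof (rule sum_mono)
      fix p assume p: "p \<in> F"
      show "\<psi> p x * ?L x \<le> \<psi> p x * (indicator D x - indicator D (x + m p))"
        by (cases "\<psi> p x = 0") (use mult_left_mono[OF up[OF p] nn[OF p]] in auto)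
    qed
    finally show "?L x \<le> (\<Sum>p\<in>F. \<psi> p x * (indicator D x - indicator D (x + m p)))" .
  qed
  show "(\<Sum>p\<in>F. shift_integral D (\<psi> p) (m' p)) \<le> measure lborel (exit_layer D K)"
    unfolding mL s
  proof (rule integral_mono[OF si iL])
    fix x
    have "(\<Sum>p\<in>F. \<psi> p x * (indicator D x - indicator D (x + m' p))) \<le> (\<Sum>p\<in>F. \<psi> p x * ?L x)"
    proof (rule sum_mono)
      fix p assume p: "p \<in> F"
      show "\<psi> p x * (indicator D x - indicator D (x + m' p)) \<le> \<psi> p x * ?L x"
        by (cases "\<psi> p x = 0") (use mult_left_mono[OF lo[OF p] nn[OF p]] in auto)
    qed
    also have "\<dots> = (\<Sum>p\<in>F. \<psi> p x) * ?L x" by (rule sum_distrib_right[symmetric])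
    also have "\<dots> \<le> 1 * ?L x" by (intro mult_right_mono le) simp
    finally show "(\<Sum>p\<in>F. \<psi> p x * (indicator D x - indicator D (x + m' p))) \<le> ?L x" by simp
  qed
qed

text \<open>One partition, fine enough both for the cones and for the oscillation of \<phi>, yields
  both comparisons of the weights a with the perimeter as well as the layer estimate. The radius
  \<epsilon> is chosen after the partition, since it depends on the first-order expansions of the
  finitely many \<psi> p.\<close>

lemma boundary_layer_approx:
  fixes \<phi> :: "real^'d \<Rightarrow> real^'d"
  assumes D: "bounded D" "open D" and C1: "C1_boundary \<kappa> D"
    and \<phi>: "\<And>i. C_k 1 (\<lambda>x. \<phi> x $ i)" "\<And>x. norm (\<phi> x) \<le> 1" and \<eta>: "0 < \<eta>" "\<eta> \<le> 1"
  obtains F :: "(real^'d) set" and u a \<epsilon> where "finite F" "\<And>p. p \<in> F \<Longrightarrow> norm (u p :: real^'d) = 1"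
    "\<And>p. p \<in> F \<Longrightarrow> a p \<ge> 0" "\<epsilon> > 0" "ereal (\<Sum>p\<in>F. a p) \<le> perimeter D"
    "div_integral D \<phi> \<le> (1 + \<eta>) * (\<Sum>p\<in>F. a p)"
    "\<And>K r h. countable K \<Longrightarrow> 0 \<in> K \<Longrightarrow> 0 < r \<Longrightarrow> r \<le> \<epsilon> \<Longrightarrow> (\<And>k. k \<in> K \<Longrightarrow> norm k \<le> r) \<Longrightarrow>
      (\<And>p. p \<in> F \<Longrightarrow> h p = (SUP k\<in>K. k \<bullet> u p)) \<Longrightarrow>
      \<bar>measure lborel (exit_layer D K) - (\<Sum>p\<in>F. a p * h p)\<bar> \<le> \<eta> * r * ((\<Sum>p\<in>F. a p) + 1)"
proof -
  \<comment> \<open>The slack 3 \<delta> r or 4 \<delta> r of the layer bounds is at most \<eta> r,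
    and 4 \<delta>^2 <= \<eta> / 2. With \<delta>' below, the oscillation contributes another \<eta>
    / 2, which makes 1 + \<eta> in the divergence bound.\<close>
  define \<delta> where "\<delta> = \<eta> / 8"
  define \<delta>' where "\<delta>' = \<eta> / (6 * real CARD('d))"
  have \<delta>: "0 < \<delta>" "\<delta> \<le> 1 / 8" "\<delta> \<le> 1 / 2" "\<delta> \<le> 1 / 3" "\<delta> \<le> 1" using \<eta> by (auto simp: \<delta>_def)
  have \<delta>': "\<delta>' > 0" "3 * real CARD('d) * \<delta>' = \<eta> / 2" using \<eta> by (auto simp: \<delta>'_def)
  have "\<eta> * \<eta> \<le> \<eta>" using \<eta> mult_right_mono[of \<eta> 1 \<eta>] by simp
  then have \<delta>\<eta>: "4 * \<delta>\<^sup>2 \<le> \<eta> / 2" using \<eta> by (simp add: \<delta>_def power2_eq_square)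
  have cont: "continuous_on UNIV \<phi>"
    using continuous_on_vec_lambda[of UNIV "\<lambda>i x. \<phi> x $ i", OF C_k_imp_continuous[OF \<phi>(1)]] by simp
  have "\<exists>v \<rho>. norm v = 1 \<and> \<rho> > 0 \<and> cone_on D v \<delta> (ball p \<rho>) \<and>
      (\<forall>x\<in>ball p \<rho>. \<forall>i. \<bar>\<phi> x $ i - \<phi> p $ i\<bar> \<le> \<delta>')" if p: "p \<in> frontier D" for p
  proof -
    obtain v \<rho>\<^sub>1 where 1: "norm v = 1" "\<rho>\<^sub>1 > 0" "cone_on D v \<delta> (ball p \<rho>\<^sub>1)"
      using C1_boundary_cone[OF C1 p \<delta>(1)] by blast
    obtain \<rho>\<^sub>2 where 2: "\<rho>\<^sub>2 > 0" "\<And>x. dist x p < \<rho>\<^sub>2 \<Longrightarrow> dist (\<phi> x) (\<phi> p) < \<delta>'"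
      using cont \<delta>'(1) unfolding continuous_on_iff by (metis UNIV_I)
    have "\<bar>\<phi> x $ i - \<phi> p $ i\<bar> \<le> \<delta>'" if "x \<in> ball p (min \<rho>\<^sub>1 \<rho>\<^sub>2)" for x i
      using component_le_norm_cart[of "\<phi> x - \<phi> p" i] 2(2)[of x] that
      by (simp add: dist_norm norm_minus_commute)
    moreover have "cone_on D v \<delta> (ball p (min \<rho>\<^sub>1 \<rho>\<^sub>2))"
      by (rule cone_on_subset[OF 1(3)]) auto
    ultimately show ?thesis using 1 2 by (intro exI[of _ v] exI[of _ "min \<rho>\<^sub>1 \<rho>\<^sub>2"]) auto
  qed
  then obtain u \<rho> where u: "\<And>p. p \<in> frontier D \<Longrightarrow> norm (u p) = 1"
    and \<rho>: "\<And>p. p \<in> frontier D \<Longrightarrow> \<rho> p > 0"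
    and cone: "\<And>p. p \<in> frontier D \<Longrightarrow> cone_on D (u p) \<delta> (ball p (\<rho> p))"
    and osc: "\<And>p x i. p \<in> frontier D \<Longrightarrow> x \<in> ball p (\<rho> p) \<Longrightarrow> \<bar>\<phi> x $ i - \<phi> p $ i\<bar> \<le> \<delta>'"
    by metis
  have "compact (frontier D)" using D(1) by (rule compact_frontier_bounded)
  moreover have "\<rho> p / 2 > 0" if "p \<in> frontier D" for p using \<rho>[OF that] by simp
  ultimately obtain F \<psi> e where F: "finite F" "F \<subseteq> frontier D" and e: "e > 0"
    and sm: "\<And>p k. p \<in> F \<Longrightarrow> C_k k (\<psi> p)" and nn: "\<And>p x. p \<in> F \<Longrightarrow> \<psi> p x \<ge> 0"
    and supp: "\<And>p x. p \<in> F \<Longrightarrow> x \<notin> ball p (\<rho> p / 2) \<Longrightarrow> \<psi> p x = 0"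
    and le: "\<And>x. (\<Sum>p\<in>F. \<psi> p x) \<le> (1::real)"
    and one: "\<And>z x. z \<in> frontier D \<Longrightarrow> dist z x \<le> e \<Longrightarrow> (\<Sum>p\<in>F. \<psi> p x) = 1"
    by (rule smooth_partition_compact[of "frontier D" "\<lambda>p. \<rho> p / 2"]) (assumption | rule that)+
  have fr: "p \<in> frontier D" if "p \<in> F" for p using F that by blast
  define a where "a p = dir_integral D (u p) (\<psi> p)" for p
  define A where "A = (\<Sum>p\<in>F. a p)"
  have a: "a p \<ge> 0" if p: "p \<in> F" for p
    unfolding a_def
    by (rule dir_integral_nonneg[OF D sm[OF p] nn[OF p] supp[OF p] cone[OF fr[OF p]] \<rho>[OF fr[OF p]]])
      (use u[OF fr[OF p]] \<delta> in \<open>auto simp: dot_square_norm\<close>)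
  have per: "ereal (\<Sum>p\<in>F. a p) \<le> perimeter D"
    unfolding a_def using F(1) sm nn supp le u fr
    by (intro perimeter_partition_ge[OF D, of F \<psi> "\<lambda>p. p" "\<lambda>p. \<rho> p / 2"]) auto
  have div: "div_integral D \<phi> \<le> (1 + \<eta>) * (\<Sum>p\<in>F. a p)"
  proof -
    have "div_integral D \<phi> = (\<Sum>p\<in>F. div_integral D (\<lambda>x. \<psi> p x *\<^sub>R \<phi> x))"
      unfolding div_integral_def
      by (subst sum.swap)
        (simp add: dir_integral_partition[OF D \<phi>(1) sm e one, symmetric])
    also have "\<dots> \<le> (\<Sum>p\<in>F. (1 + \<eta>) * a p)"
    proof (rule sum_mono)
      fix p assume p: "p \<in> F"
      have "div_integral D (\<lambda>x. \<psi> p x *\<^sub>R \<phi> x) \<le> (1 + \<eta> / 2 + 3 * real CARD('d) * \<delta>') * a p"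
        unfolding a_def
        by (rule div_integral_local_le[OF D sm[OF p] \<phi>(1) nn[OF p] supp[OF p] cone[OF fr[OF p]] \<rho>[OF fr[OF p]]
              \<delta>(1,3) u[OF fr[OF p]] osc[OF fr[OF p]] \<phi>(2) \<delta>\<eta>]) (use \<eta> in auto)
      then show "div_integral D (\<lambda>x. \<psi> p x *\<^sub>R \<phi> x) \<le> (1 + \<eta>) * a p"
        unfolding \<delta>'(2) by (simp add: add.commute)
    qed
    finally show ?thesis by (simp add: sum_distrib_left)
  qed
  \<comment> \<open>Each expansion leaves a remainder of at most 2 \<eta>' r; over all of F these
    add up to at most \<eta> r, the source of the summand 1 beside the sum of the weights.\<close>
  define \<eta>' where "\<eta>' = \<eta> / (2 * (real (card F) + 1))"
  have \<eta>': "\<eta>' > 0" using \<eta> by (simp add: \<eta>'_def add_nonneg_pos)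
  have card: "real (card F) * (2 * \<eta>') \<le> \<eta>" using \<eta> by (simp add: \<eta>'_def field_simps)
  have "\<forall>p\<in>F. \<exists>e>0. \<forall>m. norm m \<le> e \<longrightarrow>
      \<bar>shift_integral D (\<psi> p) m - dir_integral D m (\<psi> p)\<bar> \<le> \<eta>' * norm m"
    using shift_integral_asymp[OF D sm \<eta>'] by blast
  then obtain e' where e': "\<And>p. p \<in> F \<Longrightarrow> e' p > 0"
    "\<And>p m. p \<in> F \<Longrightarrow> norm m \<le> e' p \<Longrightarrow> \<bar>shift_integral D (\<psi> p) m - dir_integral D m (\<psi> p)\<bar> \<le> \<eta>' * norm m"
    by metis
  have "min (e' p) (\<rho> p) > 0" if "p \<in> F" for p using e'(1) \<rho> fr that by auto
  then obtain \<epsilon>\<^sub>0 where \<epsilon>\<^sub>0: "\<epsilon>\<^sub>0 > 0" "\<And>p. p \<in> F \<Longrightarrow> \<epsilon>\<^sub>0 \<le> min (e' p) (\<rho> p)"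
    using finite_pos_lower_bound[OF F(1), of "\<lambda>p. min (e' p) (\<rho> p)"] by blast
  \<comment> \<open>The quarter gives shifts of length 2 r within the range of the expansions and 4
    r <= \<rho> p; the bound e places the layer where the partition sums to 1.\<close>
  define \<epsilon> where "\<epsilon> = min (\<epsilon>\<^sub>0 / 4) e"
  have \<epsilon>: "\<epsilon> > 0" using \<epsilon>\<^sub>0 e by (simp add: \<epsilon>_def)
  have main: "\<bar>measure lborel (exit_layer D K) - (\<Sum>p\<in>F. a p * h p)\<bar> \<le> \<eta> * r * ((\<Sum>p\<in>F. a p) + 1)"
    if K: "countable K" "0 \<in> K" and r: "0 < r" "r \<le> \<epsilon>" and Kr: "\<And>k. k \<in> K \<Longrightarrow> norm k \<le> r"
      and h: "\<And>p. p \<in> F \<Longrightarrow> h p = (SUP k\<in>K. k \<bullet> u p)" for K r h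
  proof -
    have r': "2 * r \<le> e' p" "4 * r \<le> \<rho> p" "r \<le> e" if "p \<in> F" for p
      using \<epsilon>\<^sub>0(2)[OF that] r by (auto simp: \<epsilon>_def)
    have ku: "k \<bullet> u p \<le> r" if "k \<in> K" "p \<in> F" for k p
      using norm_cauchy_schwarz[of k "u p"] Kr[OF that(1)] u[OF fr[OF that(2)]] by simp
    have bdd: "bdd_above ((\<lambda>k. k \<bullet> u p) ` K)" if "p \<in> F" for p
      using ku that by (intro bdd_aboveI2) blast
    have hk: "k \<bullet> u p \<le> h p" if "k \<in> K" "p \<in> F" for k p
      unfolding h[OF that(2)] by (rule cSUP_upper[OF that(1) bdd[OF that(2)]])
    have h0: "0 \<le> h p" if "p \<in> F" for p using hk[OF K(2) that] by simp
    have hr: "h p \<le> r" if "p \<in> F" for p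
      unfolding h[OF that] using K(2) ku that by (intro cSUP_least) auto
    have \<delta>r: "0 < \<delta> * r" "\<delta> * r \<le> 1 / 8 * r" using \<delta> r by (auto intro: mult_right_mono)
    have hex: "\<exists>k\<in>K. h p - \<delta> * r \<le> k \<bullet> u p" if pF: "p \<in> F" for p
    proof -
      have "h p - \<delta> * r < (SUP k\<in>K. k \<bullet> u p)" using \<delta>r by (simp add: h[OF pF])
      then obtain k where "k \<in> K" "h p - \<delta> * r < k \<bullet> u p"
        using less_cSUP_iff[OF _ bdd[OF pF]] K(2) by blast
      then show ?thesis by (intro bexI[of _ k]) auto
    qed
    define m where "m p = (h p + 3 * \<delta> * r) *\<^sub>R u p" for p
    define m' where "m' p = max 0 (h p - 4 * \<delta> * r) *\<^sub>R u p" for p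
    have one': "(\<Sum>p\<in>F. \<psi> p x) = 1" if xL: "x \<in> exit_layer D K" for x
    proof -
      obtain k where k: "k \<in> K" "x \<in> D" "x + k \<notin> D" using xL unfolding exit_layer_def by blast
      obtain z where z: "z \<in> frontier D" "dist z x \<le> dist x (x + k)"
        using frontier_between[OF k(2,3)] by blast
      have "dist x (x + k) \<le> r" using Kr[OF k(1)] by (simp add: dist_norm)
      then have "dist z x \<le> e" using z(2) r by (simp add: \<epsilon>_def)
      then show ?thesis using one z(1) by blast
    qed
    have cont\<psi>: "continuous_on UNIV (\<psi> p)" if "p \<in> F" for p
      by (rule C_k_imp_continuous[OF sm[OF that]])
    have up: "indicator (exit_layer D K) x \<le> (indicator D x - indicator D (x + m p) :: real)"
      if p: "p \<in> F" and x: "\<psi> p x \<noteq> 0" for p x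
      unfolding m_def
      by (rule indicator_exit_layer_le[OF cone[OF fr[OF p]] u[OF fr[OF p]] \<delta>(1,4) _ r(1) r'(2)[OF p] h0[OF p] hr[OF p] Kr])
        (use supp[OF p, of x] x hk[OF _ p] in auto)
    have lo: "(indicator D x - indicator D (x + m' p) :: real) \<le> indicator (exit_layer D K) x"
      if p: "p \<in> F" and x: "\<psi> p x \<noteq> 0" for p x
      unfolding m'_def
      by (rule indicator_exit_layer_ge[OF cone[OF fr[OF p]] u[OF fr[OF p]] \<delta>(1) _ r(1) r'(2)[OF p] hr[OF p] Kr hex[OF p]])
        (use supp[OF p, of x] x in auto)
    note bounds = measure_exit_layer_bounds[OF D K(1), of F \<psi> m m', OF cont\<psi> nn le one' up lo]
    have u1: "shift_integral D (\<psi> p) (m p) \<le> a p * h p + \<eta> * r * a p + 2 * \<eta>' * r" if p: "p \<in> F" for p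
    proof -
      have nm: "norm (m p) = h p + 3 * \<delta> * r"
        using u[OF fr[OF p]] h0[OF p] \<delta>r by (simp add: m_def)
      then have nm2: "norm (m p) \<le> 2 * r" using hr[OF p] \<delta>r by linarith
      have "shift_integral D (\<psi> p) (m p) \<le> dir_integral D (m p) (\<psi> p) + \<eta>' * norm (m p)"
        using e'(2)[OF p, of "m p"] nm2 r'(1)[OF p] by (simp add: abs_le_iff)
      also have "dir_integral D (m p) (\<psi> p) = (h p + 3 * \<delta> * r) * a p"
        by (simp add: m_def dir_integral_scale a_def)
      also have "\<dots> = a p * h p + 3 * \<delta> * (r * a p)" by (simp add: algebra_simps)
      also have "3 * \<delta> * (r * a p) \<le> \<eta> * (r * a p)"
        using r a[OF p] \<eta> by (intro mult_right_mono) (auto simp: \<delta>_def)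
      also have "\<eta>' * norm (m p) \<le> \<eta>' * (2 * r)" using nm2 \<eta>' by (intro mult_left_mono) auto
      finally show ?thesis by (simp add: algebra_simps)
    qed
    have l1: "a p * h p - \<eta> * r * a p - 2 * \<eta>' * r \<le> shift_integral D (\<psi> p) (m' p)" if p: "p \<in> F" for p
    proof -
      have "norm (m' p) = max 0 (h p - 4 * \<delta> * r)"
        using u[OF fr[OF p]] by (simp add: m'_def)
      then have nm2: "norm (m' p) \<le> 2 * r" using hr[OF p] \<delta>r r by linarith
      have "4 * \<delta> * (r * a p) \<le> \<eta> * (r * a p)"
        using r a[OF p] \<eta> by (intro mult_right_mono) (auto simp: \<delta>_def)
      then have "a p * h p - \<eta> * r * a p \<le> (h p - 4 * \<delta> * r) * a p" by (simp add: algebra_simps)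
      also have "\<dots> \<le> max 0 (h p - 4 * \<delta> * r) * a p" by (intro mult_right_mono a[OF p]) simp
      also have "\<dots> = dir_integral D (m' p) (\<psi> p)"
        by (simp add: m'_def dir_integral_scale a_def)
      also have "\<dots> \<le> shift_integral D (\<psi> p) (m' p) + \<eta>' * norm (m' p)"
        using e'(2)[OF p, of "m' p"] nm2 r'(1)[OF p] by (simp add: abs_le_iff)
      also have "\<eta>' * norm (m' p) \<le> \<eta>' * (2 * r)" using nm2 \<eta>' by (intro mult_left_mono) auto
      finally show ?thesis by simp
    qed
    have cr: "real (card F) * (2 * \<eta>' * r) \<le> \<eta> * r"
      using mult_right_mono[OF card, of r] r by (simp add: algebra_simps)
    have "measure lborel (exit_layer D K) \<le> (\<Sum>p\<in>F. a p * h p + \<eta> * r * a p + 2 * \<eta>' * r)"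
      using bounds(1) sum_mono[of F _ "\<lambda>p. a p * h p + \<eta> * r * a p + 2 * \<eta>' * r", OF u1] by linarith
    also have "\<dots> = (\<Sum>p\<in>F. a p * h p) + \<eta> * r * (\<Sum>p\<in>F. a p) + real (card F) * (2 * \<eta>' * r)"
      by (simp only: sum.distrib sum_distrib_left sum_constant)
    finally have 1: "measure lborel (exit_layer D K) - (\<Sum>p\<in>F. a p * h p) \<le> \<eta> * r * ((\<Sum>p\<in>F. a p) + 1)"
      using cr by (simp add: algebra_simps)
    have "(\<Sum>p\<in>F. a p * h p) - \<eta> * r * (\<Sum>p\<in>F. a p) - real (card F) * (2 * \<eta>' * r) =
        (\<Sum>p\<in>F. a p * h p - \<eta> * r * a p - 2 * \<eta>' * r)"
      by (simp only: sum_subtractf sum_distrib_left sum_constant)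
    also have "\<dots> \<le> measure lborel (exit_layer D K)"
      using bounds(2) sum_mono[of F "\<lambda>p. a p * h p - \<eta> * r * a p - 2 * \<eta>' * r", OF l1] by linarith
    finally have 2: "(\<Sum>p\<in>F. a p * h p) - measure lborel (exit_layer D K) \<le> \<eta> * r * ((\<Sum>p\<in>F. a p) + 1)"
      using cr by (simp add: algebra_simps)
    show ?thesis using 1 2 by (simp add: abs_le_iff)
  qed
  show thesis
    by (rule that[OF F(1) u[OF fr] a \<epsilon> per div main])
qed

section \<open>Cadlag paths and touching sets\<close>

text \<open>Around each time, one-sided limits bound f separately on the left, at the point and on
  the right; compactness of the interval makes finitely many of these bounds suffice.\<close>

lemma cadlag_bounded:
  fixes f :: "real \<Rightarrow> 'a::real_normed_vector"
  assumes "cadlag f"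
  shows "bounded (f ` {0..t})"
proof -
  have "\<exists>e>0. \<exists>B. \<forall>y\<in>ball s e \<inter> {0..t}. norm (f y) \<le> B" if s: "s \<in> {0..t}" for s
  proof -
    have lim: "(f \<longlongrightarrow> f s) (at_right s)" using assms s unfolding cadlag_def by auto
    have "\<forall>\<^sub>F y in at_right s. dist (f y) (f s) < 1" by (rule tendstoD[OF lim]) simp
    then obtain b where b: "b > s" "\<And>y. s < y \<Longrightarrow> y < b \<Longrightarrow> dist (f y) (f s) < 1"
      unfolding eventually_at_right_field by blast
    \<comment> \<open>At s = 0 there is no left limit, and the condition 0 <= y makes the claim
      vacuous there.\<close>
    have "\<exists>c l. c < s \<and> (\<forall>y. c < y \<and> y < s \<and> 0 \<le> y \<longrightarrow> dist (f y) l < 1)"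
    proof (cases "s > 0")
      case True
      then obtain l where lim: "(f \<longlongrightarrow> l) (at_left s)" using assms unfolding cadlag_def by blast
      have "\<forall>\<^sub>F y in at_left s. dist (f y) l < 1" by (rule tendstoD[OF lim]) simp
      then show ?thesis unfolding eventually_at_left_field by blast
    qed (auto intro!: exI[of _ "s - 1"])
    then obtain c l where c: "c < s" "\<And>y. c < y \<Longrightarrow> y < s \<Longrightarrow> 0 \<le> y \<Longrightarrow> dist (f y) l < 1" by blast
    define e where "e = min (b - s) (s - c)"
    have "norm (f y) \<le> max (norm (f s)) (norm l) + 1" if y: "y \<in> ball s e \<inter> {0..t}" for y
    proof -
      have "y < b" "c < y" "0 \<le> y" using y by (auto simp: e_def dist_real_def)
      then consider "dist (f y) (f s) < 1" | "y = s" | "dist (f y) l < 1"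
        using b c by (cases y s rule: linorder_cases) auto
      then show ?thesis
        using norm_triangle_ineq2[of "f y" "f s"] norm_triangle_ineq2[of "f y" l]
        by cases (auto simp: dist_norm)
    qed
    moreover have "e > 0" using b c by (simp add: e_def)
    ultimately show ?thesis by blast
  qed
  then obtain e B where e: "\<And>s. s \<in> {0..t} \<Longrightarrow> e s > 0"
    "\<And>s y. s \<in> {0..t} \<Longrightarrow> y \<in> ball s (e s) \<inter> {0..t} \<Longrightarrow> norm (f y) \<le> B s"
    by metis
  have "{0..t} \<subseteq> (\<Union>s\<in>{0..t}. ball s (e s))" using e(1) by force
  from compactE_image[OF compact_Icc open_ball this]
  obtain F where F: "F \<subseteq> {0..t}" "finite F" "{0..t} \<subseteq> (\<Union>s\<in>F. ball s (e s))"
    by blast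
  have "norm (f y) \<le> Max (insert 0 (B ` F))" if "y \<in> {0..t}" for y
  proof -
    obtain s where s: "s \<in> F" "y \<in> ball s (e s)" using F(3) \<open>y \<in> {0..t}\<close> by blast
    then have "norm (f y) \<le> B s" using e(2)[of s y] F(1) \<open>y \<in> {0..t}\<close> by blast
    also have "\<dots> \<le> Max (insert 0 (B ` F))" using F(2) s(1) by (intro Max_ge) auto
    finally show ?thesis .
  qed
  then show ?thesis unfolding bounded_iff by blast
qed

text \<open>The end point t is added because a path may jump at t, which right-continuity does not
  reveal at earlier times.\<close>

definition time_grid :: "real \<Rightarrow> real set" where
  "time_grid t = insert t (\<rat> \<inter> {0..t})"

lemma countable_time_grid [simp]: "countable (time_grid t)"
  unfolding time_grid_def by (auto intro: countable_subset[OF _ countable_rat])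

lemma time_grid_subset: "t \<ge> 0 \<Longrightarrow> time_grid t \<subseteq> {0..t}"
  by (auto simp: time_grid_def)

lemma zero_in_time_grid: "t \<ge> 0 \<Longrightarrow> 0 \<in> time_grid t"
  by (auto simp: time_grid_def)

text \<open>A path outside C at s < t remains outside just after s, by right-continuity and openness
  of the complement, and a rational time before t lies there.\<close>

lemma cadlag_mem_closed:
  fixes f :: "real \<Rightarrow> 'a::topological_space"
  assumes "cadlag f" "closed C" "\<And>s. s \<in> time_grid t \<Longrightarrow> f s \<in> C" "s \<in> {0..t}"
  shows "f s \<in> C"
proof (rule ccontr)
  assume n: "f s \<notin> C"
  have "s \<noteq> t" using n assms(3)[of t] by (auto simp: time_grid_def)
  then have s: "0 \<le> s" "s < t" using assms(4) by auto
  have lim: "(f \<longlongrightarrow> f s) (at_right s)" using assms(1) s unfolding cadlag_def by auto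
  have "\<forall>\<^sub>F y in at_right s. f y \<in> - C"
    using n assms(2) by (intro topological_tendstoD[OF lim]) auto
  then obtain b where b: "b > s" "\<And>y. s < y \<Longrightarrow> y < b \<Longrightarrow> f y \<in> - C"
    unfolding eventually_at_right_field by blast
  obtain r where r: "r \<in> \<rat>" "s < r" "r < min b t"
    using Rats_dense_in_real[of s "min b t"] b s by auto
  then have "f r \<in> C" using s by (intro assms(3)) (auto simp: time_grid_def)
  then show False using b(2)[of r] r by auto
qed

lemma SUP_time_grid:
  fixes f :: "real \<Rightarrow> real^'d"
  assumes "cadlag f" "t \<ge> 0"
  shows "(SUP s\<in>{0..t}. f s \<bullet> v) = (SUP s\<in>time_grid t. f s \<bullet> v)"
    and "bdd_above ((\<lambda>s. f s \<bullet> v) ` {0..t})"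
proof -
  obtain B where B: "\<And>s. s \<in> {0..t} \<Longrightarrow> norm (f s) \<le> B"
    using cadlag_bounded[OF assms(1), of t] unfolding bounded_iff by blast
  show bdd: "bdd_above ((\<lambda>s. f s \<bullet> v) ` {0..t})"
  proof (rule bdd_aboveI2)
    fix s assume "s \<in> {0..t}"
    then have "norm (f s) * norm v \<le> B * norm v" by (intro mult_right_mono B) auto
    then show "f s \<bullet> v \<le> B * norm v" using norm_cauchy_schwarz[of "f s" v] by linarith
  qed
  have sub: "time_grid t \<subseteq> {0..t}" by (rule time_grid_subset[OF assms(2)])
  have ne: "time_grid t \<noteq> {}" by (simp add: time_grid_def)
  have bdd': "bdd_above ((\<lambda>s. f s \<bullet> v) ` time_grid t)"
    by (rule bdd_above_mono[OF bdd image_mono[OF sub]])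
  define c where "c = (SUP s\<in>time_grid t. f s \<bullet> v)"
  \<comment> \<open>The supremum over the grid defines a closed half-space, which therefore contains
    the whole path.\<close>
  have "f s \<in> {y. v \<bullet> y \<le> c}" if "s \<in> {0..t}" for s
  proof (rule cadlag_mem_closed[OF assms(1) closed_halfspace_le _ that])
    fix s assume "s \<in> time_grid t"
    then show "f s \<in> {y. v \<bullet> y \<le> c}"
      unfolding c_def using cSUP_upper[OF _ bdd', of s] by (simp add: inner_commute)
  qed
  then have "(SUP s\<in>{0..t}. f s \<bullet> v) \<le> c"
    using assms(2) by (intro cSUP_least) (auto simp: inner_commute)
  moreover have "c \<le> (SUP s\<in>{0..t}. f s \<bullet> v)"
    unfolding c_def by (rule cSUP_subset_mono[OF ne bdd sub]) simp
  ultimately show "(SUP s\<in>{0..t}. f s \<bullet> v) = (SUP s\<in>time_grid t. f s \<bullet> v)"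
    by (simp add: c_def)
qed

text \<open>Infinitely many disjoint sets of equal measure fit into one bounded ball only if that
  measure is 0.\<close>

lemma disjoint_translates_null:
  fixes N :: "'a::euclidean_space set" and w :: "nat \<Rightarrow> 'a"
  assumes "compact N" "bounded (range w)"
    and disj: "\<And>i j x y. i < j \<Longrightarrow> x \<in> N \<Longrightarrow> y \<in> N \<Longrightarrow> w i + x \<noteq> w j + y"
  shows "N \<in> null_sets lborel"
proof -
  obtain R where R: "\<And>x. x \<in> N \<Longrightarrow> norm x \<le> R"
    using compact_imp_bounded[OF assms(1)] unfolding bounded_iff by blast
  obtain R' where R': "\<And>i. norm (w i) \<le> R'" using assms(2) unfolding bounded_iff by blast
  define A where "A i = (+) (w i) ` N" for i
  have cA: "compact (A i)" for i unfolding A_def by (rule compact_translation[OF assms(1)])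
  have lA: "A i \<in> lmeasurable" for i using cA by (rule lmeasurable_compact)
  have mA: "measure lebesgue (A i) = measure lebesgue N" for i
    unfolding A_def by (rule measure_translation)
  have sub: "A i \<subseteq> cball 0 (R' + R)" for i
    unfolding A_def using norm_triangle_le[OF add_mono[OF R' R]] by auto
  have "A i \<inter> A j = {}" if "i < j" for i j using disj[OF that] unfolding A_def by blast
  then have dj: "disjoint_family_on A {..<n}" for n
    unfolding disjoint_family_on_def by (metis Int_commute linorder_neqE_nat)
  have "real n * measure lebesgue N \<le> measure lebesgue (cball (0::'a) (R' + R))" for n
  proof -
    have "emeasure lebesgue (A i) \<noteq> \<infinity>" for i using fmeasurableD2[OF lA] by simp
    then have "measure lebesgue (\<Union>i\<in>{..<n}. A i) = (\<Sum>i\<in>{..<n}. measure lebesgue (A i))"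
      using dj lA by (intro measure_finite_Union) auto
    also have "\<dots> = real n * measure lebesgue N" by (simp add: mA)
    finally have "real n * measure lebesgue N = measure lebesgue (\<Union>i\<in>{..<n}. A i)" ..
    also have "\<dots> \<le> measure lebesgue (cball (0::'a) (R' + R))"
      using sub lA by (intro measure_mono_fmeasurable sets.finite_UN lmeasurable_cball) auto
    finally show ?thesis .
  qed
  then have "measure lebesgue N \<le> 0"
    by (metis not_le reals_Archimedean3)
  then have m: "measure lebesgue N = 0" by (simp add: measure_le_0_iff)
  have l: "N \<in> lmeasurable" using assms(1) by (rule lmeasurable_compact)
  have "emeasure lebesgue N = 0" using emeasure_eq_measure2[OF l] m by simp
  moreover have "N \<in> sets borel" using assms(1) by (simp add: compact_imp_closed borel_closed)
  ultimately show ?thesis by (auto simp: null_sets_def)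
qed

text \<open>
  Moving outwards from a boundary point leaves \<open>closure D\<close>, so that small outward translates of
  the set of positions at which \<open>K\<close> touches the boundary from inside are disjoint.
\<close>

lemma AE_not_touching:
  fixes D :: "(real^'d) set"
  assumes D: "bounded D" "open D" and C1: "C1_boundary \<kappa> D" and K: "bounded K"
  shows "AE x in lborel. (\<forall>k\<in>K. k + x \<in> D) \<longrightarrow> (\<exists>n::nat. \<forall>k\<in>K. 1 / real (Suc n) \<le> infdist (k + x) (- D))"
proof -
  define K' where "K' = closure K"
  have K': "compact K'" using K by (simp add: K'_def compact_closure)
  have "\<exists>u \<rho>. norm u = 1 \<and> \<rho> > 0 \<and> cone_on D u (1 / 2) (ball p \<rho>)" if "p \<in> frontier D" for p
    using C1_boundary_cone[OF C1 that, of "1 / 2"] by (metis half_gt_zero zero_less_one)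
  then obtain u \<rho> where u: "\<And>p. p \<in> frontier D \<Longrightarrow> norm (u p) = 1"
    and \<rho>: "\<And>p. p \<in> frontier D \<Longrightarrow> \<rho> p > 0"
    and cone: "\<And>p. p \<in> frontier D \<Longrightarrow> cone_on D (u p) (1 / 2) (ball p (\<rho> p))"
    by metis
  have "frontier D \<subseteq> (\<Union>p\<in>frontier D. ball p (\<rho> p / 2))" using \<rho> by force
  then obtain F where F: "F \<subseteq> frontier D" "finite F" "frontier D \<subseteq> (\<Union>p\<in>F. ball p (\<rho> p / 2))"
    using compactE_image[OF compact_frontier_bounded[OF D(1)], of "frontier D" "\<lambda>p. ball p (\<rho> p / 2)"]
    by auto
  \<comment> \<open>The translations x for which the closure of K, moved by x, stays in
    \<open>closure D\<close> but meets the complement of D near p. The vectors used to translate it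
    are multiples of u p by \<rho> p / (4 (j + 1)), so two of them differ by some s u p with 0 < s
    <= \<rho> p / 4.\<close>
  define N where "N p = {x. \<forall>k\<in>K'. k + x \<in> closure D} \<inter>
    {c - k | c k. c \<in> cball p (\<rho> p / 2) \<inter> - D \<and> k \<in> K'}" for p
  have null: "N p \<in> null_sets lborel" if p: "p \<in> F" for p
  proof (rule disjoint_translates_null[where w = "\<lambda>j. (\<rho> p / (4 * real (Suc j))) *\<^sub>R u p"])
    have fr: "p \<in> frontier D" using F p by blast
    note u = u[OF fr] and \<rho> = \<rho>[OF fr] and cone = cone[OF fr]
    show "compact (N p)"
      unfolding N_def
    proof (rule closed_Int_compact)
      have "{x. \<forall>k\<in>K'. k + x \<in> closure D} = (\<Inter>k\<in>K'. (\<lambda>x. k + x) -` closure D)" by auto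
      then show "closed {x. \<forall>k\<in>K'. k + x \<in> closure D}"
        by (simp only:) (intro closed_INT ballI closed_vimage closed_closure continuous_intros)
      show "compact {c - k | c k. c \<in> cball p (\<rho> p / 2) \<inter> - D \<and> k \<in> K'}"
        using D K' by (intro compact_differences compact_Int_closed) auto
    qed
    show "bounded (range (\<lambda>j. (\<rho> p / (4 * real (Suc j))) *\<^sub>R u p))"
      unfolding bounded_iff using \<rho> u
      by (intro exI[of _ "\<rho> p / 4"]) (auto simp: field_simps)
    fix i j :: nat and x y
    assume ij: "i < j" and x: "x \<in> N p" and y: "y \<in> N p"
    define s where "s = \<rho> p / (4 * real (Suc i)) - \<rho> p / (4 * real (Suc j))"
    have "\<rho> p / (4 * real (Suc j)) < \<rho> p / (4 * real (Suc i))"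
      using ij \<rho> by (intro divide_strict_left_mono) auto
    moreover have "\<rho> p / (4 * real (Suc j)) > 0" using \<rho> by simp
    moreover have "\<rho> p / (4 * real (Suc i)) \<le> \<rho> p / 4" using \<rho> by (intro divide_left_mono) auto
    ultimately have s: "0 < s" "s \<le> \<rho> p / 4" unfolding s_def by linarith+
    show "(\<rho> p / (4 * real (Suc i))) *\<^sub>R u p + x \<noteq> (\<rho> p / (4 * real (Suc j))) *\<^sub>R u p + y"
    proof
      assume "(\<rho> p / (4 * real (Suc i))) *\<^sub>R u p + x = (\<rho> p / (4 * real (Suc j))) *\<^sub>R u p + y"
      then have yx: "y = x + s *\<^sub>R u p" by (simp add: s_def algebra_simps)
      obtain c k where ck: "x = c - k" "c \<in> cball p (\<rho> p / 2)" "c \<notin> D" "k \<in> K'"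
        using x unfolding N_def by blast
      have "c + s *\<^sub>R u p = k + y" by (simp add: yx ck(1))
      then have "c + s *\<^sub>R u p \<in> closure D" using y ck(4) unfolding N_def by simp
      \<comment> \<open>The margin s / 3 is what a cone with \<delta> = 1/2 tolerates: |z - c| <= 4
        s / 3 and (z - c) . u p >= 2 s / 3.\<close>
      then obtain z where z: "z \<in> D" "dist z (c + s *\<^sub>R u p) < s / 3"
        unfolding closure_approachable using s(1) by (metis divide_pos_pos zero_less_numeral)
      define e where "e = z - (c + s *\<^sub>R u p)"
      have e: "norm e < s / 3" "z - c = s *\<^sub>R u p + e" using z(2) by (auto simp: e_def dist_norm)
      have "norm (z - c) \<le> s + norm e"
        unfolding e(2) using norm_triangle_ineq[of "s *\<^sub>R u p" e] u s by simp
      moreover have "(z - c) \<bullet> u p \<ge> s - norm e"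
        unfolding e(2) using norm_cauchy_schwarz[of "- e" "u p"] u
        by (simp add: inner_add_left dot_square_norm)
      ultimately have "1 / 2 * norm (z - c) \<le> (z - c) \<bullet> u p" "norm (z - c) < \<rho> p / 2"
        using e(1) s by linarith+
      moreover have "c \<in> ball p (\<rho> p)" using ck(2) \<rho> by simp
      moreover have "z \<in> ball p (\<rho> p)"
        using ck(2) \<open>norm (z - c) < \<rho> p / 2\<close> dist_triangle[of p z c]
        by (simp add: dist_norm norm_minus_commute)
      ultimately have "z \<notin> D" using cone_onD[OF cone _ _ ck(3)] by blast
      then show False using z(1) by simp
    qed
  qed
  have ne: "- D \<noteq> {}" using D(1) not_bounded_UNIV by (metis Compl_UNIV_eq double_complement)
  have "(\<Union>p\<in>F. N p) \<in> null_sets lborel" using null F(2) by (intro null_sets.finite_UN) auto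
  moreover have "x \<in> (\<Union>p\<in>F. N p)"
    if inD: "\<forall>k\<in>K. k + x \<in> D" and "\<not> (\<exists>n::nat. \<forall>k\<in>K. 1 / real (Suc n) \<le> infdist (k + x) (- D))" for x
  proof -
    have small: "\<exists>k\<in>K. infdist (k + x) (- D) < 1 / real (Suc n)" for n
      using that(2) by (meson not_le)
    from this[of 0] have "K' \<noteq> {}" using closure_subset[of K] unfolding K'_def by blast
    moreover have "continuous_on K' (\<lambda>k. infdist (k + x) (- D))" by (intro continuous_intros)
    ultimately obtain k where k: "k \<in> K'" "\<And>k'. k' \<in> K' \<Longrightarrow> infdist (k + x) (- D) \<le> infdist (k' + x) (- D)"
      using continuous_attains_inf[OF K'] by blast
    have le: "infdist (k + x) (- D) < inverse (real (Suc n))" for n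
      using small[of n] k(2) closure_subset[of K] unfolding K'_def
      by (metis inverse_eq_divide order_le_less_trans subset_iff)
    have "infdist (k + x) (- D) = 0"
    proof (rule ccontr)
      assume "infdist (k + x) (- D) \<noteq> 0"
      then have "infdist (k + x) (- D) > 0" using infdist_nonneg[of "k + x" "- D"] by linarith
      then obtain n where "inverse (real (Suc n)) < infdist (k + x) (- D)"
        using reals_Archimedean by blast
      then show False using le[of n] by simp
    qed
    then have nD: "k + x \<in> - D"
      using in_closed_iff_infdist_zero[of "- D" "k + x"] ne D(2) by auto
    have "closed ((\<lambda>k. k + x) -` closure D)" by (intro closed_vimage closed_closure continuous_intros)
    moreover have "K \<subseteq> (\<lambda>k. k + x) -` closure D" using inD closure_subset[of D] by auto
    ultimately have cl: "\<forall>k\<in>K'. k + x \<in> closure D"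
      unfolding K'_def using closure_minimal by blast
    then have "k + x \<in> frontier D"
      using k(1) nD D(2) by (auto simp: frontier_def interior_open)
    then obtain p where p: "p \<in> F" "k + x \<in> ball p (\<rho> p / 2)" using F(3) by blast
    have "x = (k + x) - k" by simp
    moreover have "k + x \<in> cball p (\<rho> p / 2) \<inter> - D" using p nD by auto
    ultimately have "x \<in> {c - k | c k. c \<in> cball p (\<rho> p / 2) \<inter> - D \<and> k \<in> K'}"
      using k(1) by blast
    then have "x \<in> N p" using cl by (simp add: N_def)
    then show ?thesis using p(1) by blast
  qed
  ultimately show ?thesis by (intro AE_I'[of "\<Union>p\<in>F. N p"]) auto
qed

section \<open>Exit probabilities\<close>

lemma sets_countable_Ball:
  assumes "countable T" "\<And>s. s \<in> T \<Longrightarrow> {\<omega>\<in>space M. Q s \<omega>} \<in> sets M"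
  shows "{\<omega>\<in>space M. \<forall>s\<in>T. Q s \<omega>} \<in> sets M"
proof (cases "T = {}")
  case False
  have "{\<omega>\<in>space M. \<forall>s\<in>T. Q s \<omega>} = (\<Inter>s\<in>T. {\<omega>\<in>space M. Q s \<omega>})" using False by auto
  then show ?thesis using assms(2) sets.countable_INT'[OF assms(1) False, of "\<lambda>s. {\<omega>\<in>space M. Q s \<omega>}" M] by auto
qed simp

text \<open>Continuity from above along finite sets exhausting T. It carries translation invariance
  and isotropy from finitely many times to the grid.\<close>

lemma measure_countable_Ball_eq:
  assumes "finite_measure M" "finite_measure N" "countable T"
    and M: "\<And>s. s \<in> T \<Longrightarrow> {\<omega>\<in>space M. Q s \<omega>} \<in> sets M"
    and N: "\<And>s. s \<in> T \<Longrightarrow> {\<omega>\<in>space N. R s \<omega>} \<in> sets N"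
    and eq: "\<And>J. finite J \<Longrightarrow> J \<subseteq> T \<Longrightarrow>
      measure M {\<omega>\<in>space M. \<forall>s\<in>J. Q s \<omega>} = measure N {\<omega>\<in>space N. \<forall>s\<in>J. R s \<omega>}"
  shows "measure M {\<omega>\<in>space M. \<forall>s\<in>T. Q s \<omega>} = measure N {\<omega>\<in>space N. \<forall>s\<in>T. R s \<omega>}"
proof (cases "T = {}")
  case True
  then show ?thesis using eq[of "{}"] by simp
next
  case False
  interpret M: finite_measure M by fact
  interpret N: finite_measure N by fact
  define J where "J n = from_nat_into T ` {..n}" for n :: nat
  have J: "finite (J n)" "J n \<subseteq> T" for n
    using from_nat_into[OF False] by (auto simp: J_def)
  have mono: "m \<le> n \<Longrightarrow> J m \<subseteq> J n" for m n by (auto simp: J_def)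
  have T: "T = (\<Union>n. J n)"
  proof
    show "T \<subseteq> (\<Union>n. J n)"
    proof
      fix s assume "s \<in> T"
      then obtain n where "s = from_nat_into T n" using from_nat_into_surj[OF assms(3)] by metis
      then show "s \<in> (\<Union>n. J n)" by (auto simp: J_def)
    qed
  qed (use J in blast)
  have l1: "(\<lambda>n. measure M {\<omega>\<in>space M. \<forall>s\<in>J n. Q s \<omega>}) \<longlonglongrightarrow>
      measure M (\<Inter>n. {\<omega>\<in>space M. \<forall>s\<in>J n. Q s \<omega>})"
  proof (rule M.finite_Lim_measure_decseq)
    show "range (\<lambda>n. {\<omega>\<in>space M. \<forall>s\<in>J n. Q s \<omega>}) \<subseteq> sets M"
      using sets_countable_Ball[OF countable_finite[OF J(1)], of _ M Q] M J(2)
      by (intro image_subsetI) (simp add: subset_iff)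
    show "decseq (\<lambda>n. {\<omega>\<in>space M. \<forall>s\<in>J n. Q s \<omega>})"
      unfolding decseq_def using mono by blast
  qed
  have l2: "(\<lambda>n. measure N {\<omega>\<in>space N. \<forall>s\<in>J n. R s \<omega>}) \<longlonglongrightarrow>
      measure N (\<Inter>n. {\<omega>\<in>space N. \<forall>s\<in>J n. R s \<omega>})"
  proof (rule N.finite_Lim_measure_decseq)
    show "range (\<lambda>n. {\<omega>\<in>space N. \<forall>s\<in>J n. R s \<omega>}) \<subseteq> sets N"
      using sets_countable_Ball[OF countable_finite[OF J(1)], of _ N R] N J(2)
      by (intro image_subsetI) (simp add: subset_iff)
    show "decseq (\<lambda>n. {\<omega>\<in>space N. \<forall>s\<in>J n. R s \<omega>})"
      unfolding decseq_def using mono by blast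
  qed
  have i1: "(\<Inter>n. {\<omega>\<in>space M. \<forall>s\<in>J n. Q s \<omega>}) = {\<omega>\<in>space M. \<forall>s\<in>T. Q s \<omega>}"
    and i2: "(\<Inter>n. {\<omega>\<in>space N. \<forall>s\<in>J n. R s \<omega>}) = {\<omega>\<in>space N. \<forall>s\<in>T. R s \<omega>}"
    unfolding T by auto
  show ?thesis
    by (rule LIMSEQ_unique[OF l1[unfolded eq[OF J] i1] l2[unfolded i2]])
qed

text \<open>Equal measures make B - A a null set, so E differs from A by a subset of a null set and
  becomes measurable in the completion. The exit event is handled in this way.\<close>

lemma measure_completion_sandwich:
  assumes "finite_measure M" "A \<in> sets M" "B \<in> sets M" "A \<subseteq> E" "E \<subseteq> B" "measure M A = measure M B"
  shows "measure (completion M) E = measure M B"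
proof -
  interpret finite_measure M by fact
  have "measure M (B - A) = 0" using assms by (subst finite_measure_Diff) auto
  then have "B - A \<in> null_sets M" using assms(2,3) by (auto simp: null_sets_def emeasure_eq_measure)
  moreover have "E - A \<subseteq> B - A" using assms(5) by blast
  ultimately have "A \<union> (E - A) \<in> sets (completion M)"
    using assms(2) by (intro sets_completionI[of _ A "E - A" "B - A"]) auto
  then have E: "E \<in> sets (completion M)" using assms(4) by (simp add: Un_absorb1)
  interpret C: finite_measure "completion M"
    by (rule finite_measureI) (simp add: emeasure_eq_measure)
  have "measure (completion M) A \<le> measure (completion M) E"
    "measure (completion M) E \<le> measure (completion M) B"
    using C.finite_measure_mono[OF assms(4) E] C.finite_measure_mono[OF assms(5)] assms(3) by auto
  then show ?thesis using assms by simp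
qed

lemma borel_measurable_completion_AE:
  assumes g: "g \<in> borel_measurable M" and "AE x in M. f x = g x"
  shows "f \<in> borel_measurable (completion M)"
proof (rule measurableI)
  fix A :: "'b set" assume A: "A \<in> sets borel"
  have 1: "{x\<in>space (completion M). f x \<noteq> g x} \<in> sets (completion M)"
    using sets_completion_AE[where M = M and P = "\<lambda>x. f x \<noteq> g x"] assms(2) by (simp add: pred_def)
  have "AE x in M. \<not> (f x \<noteq> g x \<and> f x \<in> A)" using assms(2) by eventually_elim simp
  from sets_completion_AE[OF this]
  have 2: "{x\<in>space (completion M). f x \<noteq> g x \<and> f x \<in> A} \<in> sets (completion M)"
    by (simp add: pred_def)
  have 3: "g -` A \<inter> space (completion M) \<in> sets (completion M)"
    using measurable_sets[OF measurable_completion[OF g] A] .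
  have "f -` A \<inter> space (completion M) =
      (g -` A \<inter> space (completion M) - {x\<in>space (completion M). f x \<noteq> g x}) \<union>
      {x\<in>space (completion M). f x \<noteq> g x \<and> f x \<in> A}" by auto
  then show "f -` A \<inter> space (completion M) \<in> sets (completion M)"
    using 1 2 3 by (simp only: sets.Un sets.Diff)
qed simp

text \<open>A path that is still in the open set D at time t stays there for a short while by
  right-continuity, which makes the infimum strictly larger than t.\<close>

lemma exit_time_greater_iff:
  assumes "cadlag (\<lambda>s. X s \<omega>)" "open D" "t \<ge> 0"
  shows "exit_time X D \<omega> > ereal t \<longleftrightarrow> (\<forall>s\<in>{0..t}. X s \<omega> \<in> D)"
proof
  assume gr: "exit_time X D \<omega> > ereal t"
  show "\<forall>s\<in>{0..t}. X s \<omega> \<in> D"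
  proof (rule ballI, rule ccontr)
    fix s assume s: "s \<in> {0..t}" "X s \<omega> \<notin> D"
    then have "exit_time X D \<omega> \<le> ereal s" unfolding exit_time_def by (intro Inf_lower) auto
    also have "\<dots> \<le> ereal t" using s by simp
    finally show False using gr by simp
  qed
next
  assume in_D: "\<forall>s\<in>{0..t}. X s \<omega> \<in> D"
  have lim: "((\<lambda>s. X s \<omega>) \<longlongrightarrow> X t \<omega>) (at_right t)" using assms unfolding cadlag_def by blast
  have "\<forall>\<^sub>F s in at_right t. X s \<omega> \<in> D"
    using in_D assms by (intro topological_tendstoD[OF lim]) auto
  then obtain b where b: "b > t" "\<And>s. t < s \<Longrightarrow> s < b \<Longrightarrow> X s \<omega> \<in> D"
    unfolding eventually_at_right_field by blast
  have "ereal b \<le> exit_time X D \<omega>"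
    unfolding exit_time_def
  proof (rule Inf_greatest)
    fix z assume "z \<in> ereal ` {t. 0 \<le> t \<and> X t \<omega> \<notin> D}"
    then obtain s where s: "z = ereal s" "0 \<le> s" "X s \<omega> \<notin> D" by blast
    have "\<not> s < b" using s b(2)[of s] in_D by (cases "s \<le> t") auto
    then show "ereal b \<le> z" using s by simp
  qed
  then show "exit_time X D \<omega> > ereal t" using b(1) less_le_trans[of "ereal t" "ereal b"] by simp
qed

locale ti_isotropic_process =
  fixes P :: "real^'d \<Rightarrow> 'w measure" and X :: "real \<Rightarrow> 'w \<Rightarrow> real^'d"
  assumes process: "cadlag_process P X"
    and transl: "translation_invariant P X"
    and iso: "isotropic P X"
begin

lemma prob_space_P: "prob_space (P x)"
  using process by (simp add: cadlag_process_def)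

sublocale prob_space "P 0" by (rule prob_space_P)

lemma finite_measure_P: "finite_measure (P x)"
  using prob_space_P by (rule prob_space.finite_measure)

lemma sets_P: "sets (P x) = sets (P 0)"
  using process by (simp add: cadlag_process_def)

lemma space_P: "space (P x) = space (P 0)"
  using sets_P by (rule sets_eq_imp_space_eq)

lemma measurable_X: "t \<ge> 0 \<Longrightarrow> X t \<in> borel_measurable (P 0)"
  using process by (simp add: cadlag_process_def)

lemma cadlag_X: "\<omega> \<in> space (P 0) \<Longrightarrow> cadlag (\<lambda>t. X t \<omega>)"
  using process by (simp add: cadlag_process_def)

lemma AE_X_0: "AE \<omega> in P 0. X 0 \<omega> = 0"
  using process by (simp add: cadlag_process_def)

lemma time_grid_nonneg: "t \<ge> 0 \<Longrightarrow> s \<in> time_grid t \<Longrightarrow> s \<ge> 0"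
  using time_grid_subset by fastforce

lemma prob_grid_translate:
  assumes "t \<ge> 0" "C \<in> sets borel"
  shows "measure (P x) {\<omega>\<in>space (P x). \<forall>s\<in>time_grid t. X s \<omega> \<in> C} =
    measure (P 0) {\<omega>\<in>space (P 0). \<forall>s\<in>time_grid t. X s \<omega> + x \<in> C}"
proof (rule measure_countable_Ball_eq[OF finite_measure_P finite_measure_P countable_time_grid])
  fix s assume s: "s \<in> time_grid t"
  have [measurable]: "X s \<in> borel_measurable (P 0)" "C \<in> sets borel"
    using measurable_X time_grid_nonneg[OF assms(1) s] assms by auto
  have "{\<omega>\<in>space (P 0). X s \<omega> \<in> C} \<in> sets (P 0)" by measurable
  then show "{\<omega>\<in>space (P x). X s \<omega> \<in> C} \<in> sets (P x)" by (simp only: space_P[of x] sets_P[of x])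
  show "{\<omega>\<in>space (P 0). X s \<omega> + x \<in> C} \<in> sets (P 0)" by measurable
next
  fix J assume "finite J" "J \<subseteq> time_grid t"
  then show "measure (P x) {\<omega>\<in>space (P x). \<forall>s\<in>J. X s \<omega> \<in> C} =
      measure (P 0) {\<omega>\<in>space (P 0). \<forall>s\<in>J. X s \<omega> + x \<in> C}"
    using transl[unfolded translation_invariant_def, rule_format, of J "\<lambda>_. C" x] assms
      time_grid_nonneg[OF assms(1)] by auto
qed

text \<open>The grid substitute for the probability under \<open>P x\<close> of no exit up to t.
  Written under \<open>P 0\<close> it is a section of a product-measurable set, so Fubini
  applies.\<close>

definition survival_prob :: "(real^'d) set \<Rightarrow> real \<Rightarrow> real^'d \<Rightarrow> real" where
  "survival_prob D t x = measure (P 0) {\<omega>\<in>space (P 0). \<forall>s\<in>time_grid t. X s \<omega> + x \<in> D}"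

abbreviation path :: "real \<Rightarrow> 'w \<Rightarrow> (real^'d) set" where
  "path t \<omega> \<equiv> (\<lambda>s. X s \<omega>) ` time_grid t"

lemma bounded_path: "t \<ge> 0 \<Longrightarrow> \<omega> \<in> space (P 0) \<Longrightarrow> bounded (path t \<omega>)"
  by (rule bounded_subset[OF cadlag_bounded[OF cadlag_X] image_mono[OF time_grid_subset]])

lemma measurable_X_shift:
  assumes "t \<ge> 0" "s \<in> time_grid t"
  shows "(\<lambda>z. X s (fst z) + snd z) \<in> borel_measurable (P 0 \<Otimes>\<^sub>M lborel)"
proof -
  have [measurable]: "X s \<in> borel_measurable (P 0)"
    using measurable_X time_grid_nonneg assms by blast
  show ?thesis by measurable
qed

lemma sets_survival:
  assumes "t \<ge> 0" "open D"
  shows "{z\<in>space (P 0 \<Otimes>\<^sub>M lborel). \<forall>s\<in>time_grid t. X s (fst z) + snd z \<in> D} \<in> sets (P 0 \<Otimes>\<^sub>M lborel)"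
proof (rule sets_countable_Ball[OF countable_time_grid])
  fix s assume "s \<in> time_grid t"
  from measurable_sets[OF measurable_X_shift[OF assms(1) this], of D]
  show "{z\<in>space (P 0 \<Otimes>\<^sub>M lborel). X s (fst z) + snd z \<in> D} \<in> sets (P 0 \<Otimes>\<^sub>M lborel)"
    using assms(2) by (simp add: vimage_def Int_def conj_commute)
qed

lemma sets_survival_margin:
  assumes "t \<ge> 0"
  shows "{z\<in>space (P 0 \<Otimes>\<^sub>M lborel). \<exists>n::nat. \<forall>s\<in>time_grid t. 1 / real (Suc n) \<le> infdist (X s (fst z) + snd z) (- D)}
    \<in> sets (P 0 \<Otimes>\<^sub>M lborel)"
proof -
  have "{z\<in>space (P 0 \<Otimes>\<^sub>M lborel). \<forall>s\<in>time_grid t. 1 / real (Suc n) \<le> infdist (X s (fst z) + snd z) (- D)}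
    \<in> sets (P 0 \<Otimes>\<^sub>M lborel)" for n
  proof (rule sets_countable_Ball[OF countable_time_grid])
    fix s assume "s \<in> time_grid t"
    note [measurable] = measurable_X_shift[OF assms this]
    have [measurable]: "(\<lambda>x. infdist x (- D)) \<in> borel_measurable borel"
      by (intro borel_measurable_continuous_onI continuous_intros)
    show "{z\<in>space (P 0 \<Otimes>\<^sub>M lborel). 1 / real (Suc n) \<le> infdist (X s (fst z) + snd z) (- D)} \<in> sets (P 0 \<Otimes>\<^sub>M lborel)"
      by measurable
  qed
  then have "(\<Union>n. {z\<in>space (P 0 \<Otimes>\<^sub>M lborel). \<forall>s\<in>time_grid t. 1 / real (Suc n) \<le> infdist (X s (fst z) + snd z) (- D)})
    \<in> sets (P 0 \<Otimes>\<^sub>M lborel)" by blast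
  also have "(\<Union>n. {z\<in>space (P 0 \<Otimes>\<^sub>M lborel). \<forall>s\<in>time_grid t. 1 / real (Suc n) \<le> infdist (X s (fst z) + snd z) (- D)}) =
    {z\<in>space (P 0 \<Otimes>\<^sub>M lborel). \<exists>n::nat. \<forall>s\<in>time_grid t. 1 / real (Suc n) \<le> infdist (X s (fst z) + snd z) (- D)}"
    by auto
  finally show ?thesis .
qed

text \<open>The survival event contains the event that the grid positions keep a distance 1/(n+1)
  from the complement for some n, a closed condition inherited by all times. It is contained in the
  event that the grid positions lie in D. For almost every x both have the same probability.\<close>

lemma AE_exit_time_prob:
  assumes D: "bounded D" "open D" and C1: "C1_boundary \<kappa> D" and t: "t \<ge> 0"
  shows "AE x in lborel. measure (completion (P x)) {\<omega>\<in>space (P x). exit_time X D \<omega> > ereal t} = survival_prob D t x"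
proof -
  interpret pair_sigma_finite "P 0" "lborel :: (real^'d) measure"
    by (intro pair_sigma_finite.intro sigma_finite_measure_axioms sigma_finite_lborel)
  define stay where "stay = (\<lambda>\<omega> x. \<forall>s\<in>time_grid t. X s \<omega> + x \<in> D)"
  define margin where "margin = (\<lambda>n \<omega> x. \<forall>s\<in>time_grid t. 1 / real (Suc n) \<le> infdist (X s \<omega> + x) (- D))"
  have ne: "- D \<noteq> {}" using D(1) not_bounded_UNIV by (metis Compl_UNIV_eq double_complement)
  have meas: "{z\<in>space (P 0 \<Otimes>\<^sub>M lborel). stay (fst z) (snd z) \<longrightarrow> (\<exists>n. margin n (fst z) (snd z))} \<in> sets (P 0 \<Otimes>\<^sub>M lborel)"
    unfolding stay_def margin_def
    using sets_survival[OF t D(2)] sets_survival_margin[OF t] by (rule sets.sets_Collect_imp[rotated])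
  have "AE \<omega> in P 0. AE x in lborel. stay \<omega> x \<longrightarrow> (\<exists>n. margin n \<omega> x)"
  proof (rule AE_I2)
    fix \<omega> assume "\<omega> \<in> space (P 0)"
    from AE_not_touching[OF D C1 bounded_path[OF t this]]
    show "AE x in lborel. stay \<omega> x \<longrightarrow> (\<exists>n. margin n \<omega> x)"
      unfolding stay_def margin_def by simp
  qed
  \<comment> \<open>\<open>AE_not_touching\<close> concerns almost every translation of one fixed
    path; Fubini turns this into almost every path for almost every starting point.\<close>
  then have "AE x in lborel. AE \<omega> in P 0. stay \<omega> x \<longrightarrow> (\<exists>n. margin n \<omega> x)"
    using AE_commute[OF meas] by simp
  then show ?thesis
  proof (rule AE_mp[OF _ AE_I2], intro impI)
    fix x :: "real^'d"
    assume ae: "AE \<omega> in P 0. stay \<omega> x \<longrightarrow> (\<exists>n. margin n \<omega> x)"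
    define C where "C n = {y. 1 / real (Suc n) \<le> infdist y (- D)}" for n :: nat
    have clC: "closed (C n)" for n
      unfolding C_def by (intro closed_Collect_le continuous_intros)
    have CD: "C n \<subseteq> D" for n
    proof
      fix y assume "y \<in> C n"
      then have "infdist y (- D) > 0" unfolding C_def by (simp add: less_le_trans[of 0 "1 / real (Suc n)"])
      then show "y \<in> D" using infdist_zero[of y "- D"] by fastforce
    qed
    have Cmono: "C m \<subseteq> C n" if "m \<le> n" for m n
      using frac_le[of 1 1 "real (Suc m)" "real (Suc n)"] that unfolding C_def by auto
    define A where "A n = {\<omega>\<in>space (P x). \<forall>s\<in>time_grid t. X s \<omega> \<in> C n}" for n
    define A' where "A' n = {\<omega>\<in>space (P 0). \<forall>s\<in>time_grid t. X s \<omega> + x \<in> C n}" for n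
    define B where "B = {\<omega>\<in>space (P x). \<forall>s\<in>time_grid t. X s \<omega> \<in> D}"
    define B' where "B' = {\<omega>\<in>space (P 0). \<forall>s\<in>time_grid t. X s \<omega> + x \<in> D}"
    have grid: "{\<omega>\<in>space (P 0). \<forall>s\<in>time_grid t. X s \<omega> + v \<in> S} \<in> sets (P 0)" if "S \<in> sets borel" for S v
    proof (rule sets_countable_Ball[OF countable_time_grid])
      fix s assume s: "s \<in> time_grid t"
      have [measurable]: "X s \<in> borel_measurable (P 0)" "S \<in> sets borel"
        using measurable_X time_grid_nonneg[OF t s] that by auto
      show "{\<omega>\<in>space (P 0). X s \<omega> + v \<in> S} \<in> sets (P 0)" by measurable
    qed
    have sA: "A n \<in> sets (P x)" for n
      unfolding A_def space_P[of x] sets_P[of x] using grid[of "C n" 0] clC by simp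
    have sB: "B \<in> sets (P x)" unfolding B_def space_P[of x] sets_P[of x] using grid[of D 0] D by simp
    have sA': "A' n \<in> sets (P 0)" for n unfolding A'_def using grid clC by simp
    have sB': "B' \<in> sets (P 0)" unfolding B'_def using grid D by simp
    have AA': "measure (P x) (A n) = measure (P 0) (A' n)" for n
      unfolding A_def A'_def using clC by (intro prob_grid_translate t) auto
    have BB': "measure (P x) B = measure (P 0) B'"
      unfolding B_def B'_def using D by (intro prob_grid_translate t) auto
    have incA: "incseq A" "incseq A'" unfolding A_def A'_def incseq_def using Cmono by blast+
    \<comment> \<open>Invariance is transferred for each n separately, since only then does the
      event constrain all times by one fixed set; the union over n is reached by monotone
      limits.\<close>
    have "(\<lambda>n. measure (P x) (A n)) \<longlonglongrightarrow> measure (P x) (\<Union>n. A n)"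
      using sA incA finite_measure.finite_Lim_measure_incseq[OF finite_measure_P] by blast
    moreover have "(\<lambda>n. measure (P 0) (A' n)) \<longlonglongrightarrow> measure (P 0) (\<Union>n. A' n)"
      using sA' incA finite_Lim_measure_incseq by blast
    ultimately have "measure (P x) (\<Union>n. A n) = measure (P 0) (\<Union>n. A' n)"
      unfolding AA' by (rule LIMSEQ_unique)
    also have "\<dots> = measure (P 0) B'"
    proof (rule finite_measure_eq_AE)
      show "AE \<omega> in P 0. \<omega> \<in> (\<Union>n. A' n) \<longleftrightarrow> \<omega> \<in> B'"
        using ae
      proof (rule AE_mp[OF _ AE_I2], intro impI)
        fix \<omega> assume "\<omega> \<in> space (P 0)" "stay \<omega> x \<longrightarrow> (\<exists>n. margin n \<omega> x)"
        then show "\<omega> \<in> (\<Union>n. A' n) \<longleftrightarrow> \<omega> \<in> B'"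
          unfolding stay_def margin_def A'_def B'_def using CD unfolding C_def by blast
      qed
    qed (use sA' sB' in auto)
    finally have eq: "measure (P x) (\<Union>n. A n) = measure (P x) B" by (simp add: BB')
    have "measure (completion (P x)) {\<omega>\<in>space (P x). exit_time X D \<omega> > ereal t} = measure (P x) B"
    proof (rule measure_completion_sandwich[OF finite_measure_P _ sB _ _ eq])
      show "(\<Union>n. A n) \<in> sets (P x)" using sA by blast
      have iff: "exit_time X D \<omega> > ereal t \<longleftrightarrow> (\<forall>s\<in>{0..t}. X s \<omega> \<in> D)" if "\<omega> \<in> space (P x)" for \<omega>
        using exit_time_greater_iff[of X \<omega>, OF _ D(2) t] cadlag_X that unfolding space_P[of x] by blast
      show "(\<Union>n. A n) \<subseteq> {\<omega>\<in>space (P x). exit_time X D \<omega> > ereal t}"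
      proof
        fix \<omega> assume "\<omega> \<in> (\<Union>n. A n)"
        then obtain n where n: "\<omega> \<in> space (P x)" "\<And>s. s \<in> time_grid t \<Longrightarrow> X s \<omega> \<in> C n"
          unfolding A_def by blast
        have "X s \<omega> \<in> C n" if "s \<in> {0..t}" for s
          using n(1) unfolding space_P[of x] by (rule cadlag_mem_closed[OF cadlag_X clC n(2) that])
        then show "\<omega> \<in> {\<omega>\<in>space (P x). exit_time X D \<omega> > ereal t}"
          using n(1) iff CD by blast
      qed
      show "{\<omega>\<in>space (P x). exit_time X D \<omega> > ereal t} \<subseteq> B"
        unfolding B_def using iff time_grid_subset[OF t] by blast
    qed
    then show "measure (completion (P x)) {\<omega>\<in>space (P x). exit_time X D \<omega> > ereal t} = survival_prob D t x"
      by (simp add: BB' survival_prob_def B'_def)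
  qed
qed

end

section \<open>Running suprema and the heat loss\<close>

context ti_isotropic_process
begin

lemma measurable_survival_prob:
  assumes "t \<ge> 0" "open D"
  shows "survival_prob D t \<in> borel_measurable lborel"
proof -
  interpret pair_sigma_finite "P 0" "lborel :: (real^'d) measure"
    by (intro pair_sigma_finite.intro sigma_finite_measure_axioms sigma_finite_lborel)
  define S where "S = {z\<in>space (P 0 \<Otimes>\<^sub>M lborel). \<forall>s\<in>time_grid t. X s (fst z) + snd z \<in> D}"
  have "survival_prob D t = (\<lambda>x. enn2real (emeasure (P 0) ((\<lambda>\<omega>. (\<omega>, x)) -` S)))"
    by (rule ext) (auto simp: survival_prob_def S_def measure_def space_pair_measure intro!: arg_cong[where f = "\<lambda>A. enn2real (emeasure (P 0) A)"])
  moreover have "(\<lambda>x. emeasure (P 0) ((\<lambda>\<omega>. (\<omega>, x)) -` S)) \<in> borel_measurable lborel"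
    unfolding S_def by (rule measurable_emeasure_Pair2[OF sets_survival[OF assms]])
  ultimately show ?thesis by simp
qed

text \<open>The exit probability agrees almost everywhere with a Borel function of x. This makes it
  Lebesgue measurable and lets the integral over \<open>lebesgue\<close> be computed over
  \<open>lborel\<close>.\<close>

lemma spectral_heat_content_eq:
  assumes D: "bounded D" "open D" and C1: "C1_boundary \<kappa> D" and t: "t \<ge> 0"
  shows "spectral_heat_content P X D t = (LINT x:D|lborel. survival_prob D t x)"
proof -
  define q where "q x = measure (completion (P x)) {\<omega>\<in>space (P x). exit_time X D \<omega> > ereal t}" for x
  have ae: "AE x in lborel. q x = survival_prob D t x"
    unfolding q_def by (rule AE_exit_time_prob[OF assms])
  note sm = measurable_survival_prob[OF t D(2)]
  have qm: "q \<in> borel_measurable lebesgue"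
    by (rule borel_measurable_completion_AE[OF sm ae])
  have im: "(\<lambda>x. indicator D x :: real) \<in> borel_measurable lborel" using D(2) by simp
  have gm: "(\<lambda>x. indicator D x *\<^sub>R survival_prob D t x) \<in> borel_measurable lborel"
    using borel_measurable_times[OF im sm] by simp
  have fm: "(\<lambda>x. indicator D x *\<^sub>R q x) \<in> borel_measurable lebesgue"
    using borel_measurable_times[OF measurable_completion[OF im] qm] by simp
  have "spectral_heat_content P X D t = (\<integral>x. indicator D x *\<^sub>R q x \<partial>lebesgue)"
    by (simp add: spectral_heat_content_def set_lebesgue_integral_def q_def)
  also have "\<dots> = (\<integral>x. indicator D x *\<^sub>R survival_prob D t x \<partial>lebesgue)"
  proof (rule integral_cong_AE[OF fm measurable_completion[OF gm]])
    show "AE x in lebesgue. indicator D x *\<^sub>R q x = indicator D x *\<^sub>R survival_prob D t x"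
      using AE_completion[OF ae] by eventually_elim simp
  qed
  also have "\<dots> = (\<integral>x. indicator D x *\<^sub>R survival_prob D t x \<partial>lborel)"
    by (rule integral_completion[OF gm])
  finally show ?thesis by (simp add: set_lebesgue_integral_def)
qed

lemma heat_loss_eq:
  assumes D: "bounded D" "open D" and C1: "C1_boundary \<kappa> D" and t: "t \<ge> 0"
  shows "measure lborel D - spectral_heat_content P X D t = (\<integral>\<omega>. measure lborel (exit_layer D (path t \<omega>)) \<partial>P 0)"
    and "integrable (P 0) (\<lambda>\<omega>. measure lborel (exit_layer D (path t \<omega>)))"
proof -
  interpret pair_sigma_finite "P 0" "lborel :: (real^'d) measure"
    by (intro pair_sigma_finite.intro sigma_finite_measure_axioms sigma_finite_lborel)
  define S where "S = {z\<in>space (P 0 \<Otimes>\<^sub>M lborel). \<forall>s\<in>time_grid t. X s (fst z) + snd z \<in> D}"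
  \<comment> \<open>For fixed \<omega> the section of W is the exit layer of the path; for fixed x
    in D it is the complement of the survival event.\<close>
  define W where "W = space (P 0) \<times> D - S"
  define f where "f = (\<lambda>\<omega> x. indicator W (\<omega>, x) :: real)"
  have D': "D \<in> sets lborel" using D(2) by simp
  have finD: "emeasure lborel D < \<infinity>" using D(1) emeasure_bounded_finite by blast
  have S: "S \<in> sets (P 0 \<Otimes>\<^sub>M lborel)" unfolding S_def by (rule sets_survival[OF t D(2)])
  have PD: "space (P 0) \<times> D \<in> sets (P 0 \<Otimes>\<^sub>M lborel)" using D' by (intro pair_measureI) auto
  have W: "W \<in> sets (P 0 \<Otimes>\<^sub>M lborel)" unfolding W_def using S PD by blast
  have "emeasure (P 0 \<Otimes>\<^sub>M lborel) W \<le> emeasure (P 0 \<Otimes>\<^sub>M lborel) (space (P 0) \<times> D)"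
    by (rule emeasure_mono[OF _ PD]) (auto simp: W_def)
  also have "\<dots> = emeasure (P 0) (space (P 0)) * emeasure lborel D"
    by (rule lborel.emeasure_pair_measure_Times[OF sets.top D'])
  also have "\<dots> < \<infinity>" using finD by (simp add: emeasure_space_1)
  finally have int: "integrable (P 0 \<Otimes>\<^sub>M lborel) (case_prod f)"
    using W by (simp add: f_def case_prod_beta')
  have fx: "(\<integral>x. f \<omega> x \<partial>lborel) = measure lborel (exit_layer D (path t \<omega>))" if "\<omega> \<in> space (P 0)" for \<omega>
  proof -
    have "(\<lambda>x. f \<omega> x) = indicator (exit_layer D (path t \<omega>))"
      using that by (auto simp: fun_eq_iff f_def W_def S_def exit_layer_def space_pair_measure
          indicator_def add.commute)
    then show ?thesis
      using exit_layer_borel[OF D(2), of "path t \<omega>"] by simp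
  qed
  have f\<omega>: "(\<integral>\<omega>. f \<omega> x \<partial>P 0) = indicator D x *\<^sub>R (1 - survival_prob D t x)" for x
  proof -
    define B where "B = {\<omega>\<in>space (P 0). \<forall>s\<in>time_grid t. X s \<omega> + x \<in> D}"
    have "B = (\<lambda>\<omega>. (\<omega>, x)) -` S"
      by (auto simp: B_def S_def space_pair_measure)
    then have B: "B \<in> events" using sets_Pair2[OF S] by simp
    have "(\<integral>\<omega>. f \<omega> x \<partial>P 0) = (\<integral>\<omega>. indicator D x * indicator (space (P 0) - B) \<omega> \<partial>P 0)"
      by (rule Bochner_Integration.integral_cong)
        (auto simp: f_def W_def S_def B_def space_pair_measure indicator_def)
    also have "\<dots> = indicator D x * prob (space (P 0) - B)" using B by simp
    also have "prob (space (P 0) - B) = 1 - survival_prob D t x"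
      using prob_compl[OF B] by (simp add: survival_prob_def B_def)
    finally show ?thesis by simp
  qed
  have iD: "integrable lborel (\<lambda>x. indicator D x :: real)"
    using D' finD by (simp add: integrable_indicator_iff)
  have s01: "0 \<le> survival_prob D t x" "survival_prob D t x \<le> 1" for x
    unfolding survival_prob_def by auto
  have i_s: "integrable lborel (\<lambda>x. indicator D x *\<^sub>R survival_prob D t x)"
  proof (rule Bochner_Integration.integrable_bound[OF iD])
    show "(\<lambda>x. indicator D x *\<^sub>R survival_prob D t x) \<in> borel_measurable lborel"
      using borel_measurable_times[OF borel_measurable_integrable[OF iD] measurable_survival_prob[OF t D(2)]]
      by simp
    show "AE x in lborel. norm (indicator D x *\<^sub>R survival_prob D t x) \<le> norm (indicator D x :: real)"
      using s01 by (intro AE_I2) (auto simp: indicator_def)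
  qed
  have "measure lborel D - spectral_heat_content P X D t =
      (\<integral>x. indicator D x \<partial>lborel) - (\<integral>x. indicator D x *\<^sub>R survival_prob D t x \<partial>lborel)"
    using D' by (simp add: spectral_heat_content_eq[OF assms] set_lebesgue_integral_def)
  also have "\<dots> = (\<integral>x. indicator D x *\<^sub>R (1 - survival_prob D t x) \<partial>lborel)"
    using Bochner_Integration.integral_diff[OF iD i_s] by (simp add: right_diff_distrib)
  also have "\<dots> = (\<integral>x. (\<integral>\<omega>. f \<omega> x \<partial>P 0) \<partial>lborel)" by (simp only: f\<omega>)
  also have "\<dots> = (\<integral>\<omega>. (\<integral>x. f \<omega> x \<partial>lborel) \<partial>P 0)" by (rule Fubini_integral[OF int])
  also have "\<dots> = (\<integral>\<omega>. measure lborel (exit_layer D (path t \<omega>)) \<partial>P 0)"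
    by (rule Bochner_Integration.integral_cong[OF refl fx])
  finally show "measure lborel D - spectral_heat_content P X D t =
      (\<integral>\<omega>. measure lborel (exit_layer D (path t \<omega>)) \<partial>P 0)" .
  have "integrable (P 0) (\<lambda>\<omega>. \<integral>x. f \<omega> x \<partial>lborel)"
    by (rule integrable_fst[OF int])
  then show "integrable (P 0) (\<lambda>\<omega>. measure lborel (exit_layer D (path t \<omega>)))"
    by (subst (asm) Bochner_Integration.integrable_cong[OF refl fx]) auto
qed

section \<open>Suprema of the process in arbitrary directions\<close>

definition sup_dir :: "real^'d \<Rightarrow> real \<Rightarrow> 'w \<Rightarrow> real" where
  "sup_dir v t \<omega> = (SUP s\<in>time_grid t. X s \<omega> \<bullet> v)"

lemma bdd_sup_dir:
  assumes "t \<ge> 0" "\<omega> \<in> space (P 0)"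
  shows "bdd_above ((\<lambda>s. X s \<omega> \<bullet> v) ` time_grid t)"
  by (rule bdd_above_mono[OF SUP_time_grid(2)[OF cadlag_X[OF assms(2)] assms(1)]
        image_mono[OF time_grid_subset[OF assms(1)]]])

lemma sup_dir_upper: "t \<ge> 0 \<Longrightarrow> \<omega> \<in> space (P 0) \<Longrightarrow> s \<in> time_grid t \<Longrightarrow> X s \<omega> \<bullet> v \<le> sup_dir v t \<omega>"
  unfolding sup_dir_def by (rule cSUP_upper[OF _ bdd_sup_dir])

lemma sup_dir_le_iff:
  assumes "t \<ge> 0" "\<omega> \<in> space (P 0)"
  shows "sup_dir v t \<omega> \<le> c \<longleftrightarrow> (\<forall>s\<in>time_grid t. X s \<omega> \<bullet> v \<le> c)"
  unfolding sup_dir_def using cSUP_le_iff[OF _ bdd_sup_dir[OF assms]] zero_in_time_grid[OF assms(1)]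
  by blast

lemma measurable_sup_dir: 
  assumes "t \<ge> 0"
  shows "sup_dir v t \<in> borel_measurable (P 0)"
  unfolding sup_dir_def
proof (rule borel_measurable_cSUP[OF countable_time_grid])
  fix s assume s: "s \<in> time_grid t"
  have [measurable]: "X s \<in> borel_measurable (P 0)"
    using measurable_X time_grid_nonneg[OF assms s] by auto
  show "(\<lambda>\<omega>. X s \<omega> \<bullet> v) \<in> borel_measurable (P 0)" by measurable
qed (rule bdd_sup_dir[OF assms])

lemma running_sup_eq:
  "t \<ge> 0 \<Longrightarrow> \<omega> \<in> space (P 0) \<Longrightarrow> running_sup X i t \<omega> = sup_dir (axis i 1) t \<omega>"
  unfolding running_sup_def sup_dir_def using SUP_time_grid(1)[OF cadlag_X, of \<omega> t "axis i 1"]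
  by (simp add: inner_axis)

text \<open>An orthogonal A mapping \<open>axis i 1\<close> to v has a transpose U whose i-th output
  coordinate is the inner product with v. Isotropy for U, applied to half-spaces in coordinate i at
  grid times, then compares the two suprema.\<close>

lemma prob_sup_dir_le:
  assumes "t \<ge> 0" "norm v = 1"
  shows "prob {\<omega>\<in>space (P 0). sup_dir v t \<omega> \<le> c} = prob {\<omega>\<in>space (P 0). sup_dir (axis i 1) t \<omega> \<le> c}"
proof -
  obtain A where A: "orthogonal_matrix A" "A *v axis i 1 = v"
    using orthogonal_matrix_exists_basis[OF assms(2)] by blast
  define U where "U = transpose A"
  have U: "orthogonal_matrix U" using A(1) by (simp add: U_def orthogonal_matrix_transpose)
  have Ui: "(U *v y) $ i = y \<bullet> v" for y
  proof -
    have "(U *v y) $ i = (y v* A) \<bullet> axis i 1" by (simp add: U_def inner_axis)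
    then show ?thesis by (simp add: dot_lmul_matrix A(2))
  qed
  have "prob {\<omega>\<in>space (P 0). \<forall>s\<in>time_grid t. X s \<omega> \<bullet> axis i 1 \<le> c} =
      prob {\<omega>\<in>space (P 0). \<forall>s\<in>time_grid t. X s \<omega> \<bullet> v \<le> c}"
  proof (rule measure_countable_Ball_eq[OF finite_measure_P finite_measure_P countable_time_grid])
    fix s assume s: "s \<in> time_grid t"
    have [measurable]: "X s \<in> borel_measurable (P 0)"
      using measurable_X time_grid_nonneg[OF assms(1) s] by auto
    show "{\<omega>\<in>space (P 0). X s \<omega> \<bullet> axis i 1 \<le> c} \<in> events"
      "{\<omega>\<in>space (P 0). X s \<omega> \<bullet> v \<le> c} \<in> events" by measurable
  next
    fix J assume J: "finite J" "J \<subseteq> time_grid t"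
    then have "J \<subseteq> {0..}" using time_grid_nonneg[OF assms(1)] by auto
    have "{y. y $ i \<le> c} = {y. axis i 1 \<bullet> y \<le> c}" by (simp add: inner_axis')
    then have "{y::real^'d. y $ i \<le> c} \<in> sets borel"
      using closed_halfspace_le[of "axis i (1::real)" c] by simp
    then show "prob {\<omega>\<in>space (P 0). \<forall>s\<in>J. X s \<omega> \<bullet> axis i 1 \<le> c} =
        prob {\<omega>\<in>space (P 0). \<forall>s\<in>J. X s \<omega> \<bullet> v \<le> c}"
      using iso[unfolded isotropic_def, rule_format, of U J "\<lambda>_. {y. y $ i \<le> c}"] U J(1) \<open>J \<subseteq> {0..}\<close>
      by (simp add: Ui inner_axis)
  qed
  then show ?thesis
    using sup_dir_le_iff[OF assms(1)] by (simp cong: conj_cong)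
qed

lemma distr_sup_dir:
  assumes "t \<ge> 0" "norm v = 1"
  shows "distr (P 0) borel (sup_dir v t) = distr (P 0) borel (sup_dir (axis i 1) t)"
proof (rule cdf_unique)
  have eq: "cdf (distr (P 0) borel (sup_dir w t)) c = prob {\<omega>\<in>space (P 0). sup_dir w t \<omega> \<le> c}" for w c
    using measurable_sup_dir[OF assms(1)]
    by (simp add: cdf_def measure_distr vimage_def Int_def conj_commute)
  show "cdf (distr (P 0) borel (sup_dir v t)) = cdf (distr (P 0) borel (sup_dir (axis i 1) t))"
    by (rule ext) (simp only: eq prob_sup_dir_le[OF assms])
qed (intro real_distribution_distr measurable_sup_dir[OF assms(1)])+

lemma prob_sup_dir_greater:
  assumes "t \<ge> 0" "norm v = 1"
  shows "prob {\<omega>\<in>space (P 0). sup_dir v t \<omega> > c} = prob {\<omega>\<in>space (P 0). running_sup X i t \<omega> > c}"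
proof -
  have eq: "measure (distr (P 0) borel (sup_dir w t)) {c<..} = prob {\<omega>\<in>space (P 0). sup_dir w t \<omega> > c}" for w
    using measurable_sup_dir[OF assms(1)]
    by (simp add: measure_distr vimage_def Int_def conj_commute)
  show ?thesis
    using eq[of v] eq[of "axis i 1"] distr_sup_dir[OF assms, of i] running_sup_eq[OF assms(1), of _ i]
    by (simp cong: conj_cong)
qed

lemma expectation_sup_dir:
  assumes "t \<ge> 0" "norm v = 1"
  shows "(\<integral>\<omega>. min (sup_dir v t \<omega>) 1 \<partial>P 0) = mu P X i t"
proof -
  have eq: "(\<integral>y. min y 1 \<partial>distr (P 0) borel (sup_dir w t)) = (\<integral>\<omega>. min (sup_dir w t \<omega>) 1 \<partial>P 0)" for w
    by (rule integral_distr[OF measurable_sup_dir[OF assms(1)]]) measurable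
  have "mu P X i t = (\<integral>\<omega>. min (sup_dir (axis i 1) t \<omega>) 1 \<partial>P 0)"
    unfolding mu_def by (rule Bochner_Integration.integral_cong) (simp_all add: running_sup_eq[OF assms(1)])
  then show ?thesis using eq[of v] eq[of "axis i 1"] distr_sup_dir[OF assms, of i] by simp
qed

lemma sup_dir_nonneg:
  assumes "t \<ge> 0" "\<omega> \<in> space (P 0)" "X 0 \<omega> = 0"
  shows "0 \<le> sup_dir v t \<omega>"
  using sup_dir_upper[OF assms(1,2) zero_in_time_grid[OF assms(1)], of v] assms(3) by simp

lemma integrable_sup_dir:
  assumes "t \<ge> 0"
  shows "integrable (P 0) (\<lambda>\<omega>. min (sup_dir v t \<omega>) 1)"
proof (rule integrable_const_bound[of _ 1])
  show "AE \<omega> in P 0. norm (min (sup_dir v t \<omega>) 1) \<le> 1"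
    using AE_X_0 AE_space by eventually_elim (use sup_dir_nonneg[OF assms] in \<open>auto simp: min_def\<close>)
  show "(\<lambda>\<omega>. min (sup_dir v t \<omega>) 1) \<in> borel_measurable (P 0)"
    using measurable_sup_dir[OF assms] by measurable
qed

lemma mu_nonneg:
  assumes "t \<ge> 0"
  shows "0 \<le> mu P X i t"
proof -
  have "0 \<le> (\<integral>\<omega>. min (sup_dir (axis i 1) t \<omega>) 1 \<partial>P 0)"
  proof (rule integral_nonneg_AE)
    show "AE \<omega> in P 0. 0 \<le> min (sup_dir (axis i 1) t \<omega>) 1"
      using AE_X_0 AE_space by eventually_elim (use sup_dir_nonneg[OF assms] in auto)
  qed
  then show ?thesis using expectation_sup_dir[OF assms, of "axis i 1" i] by simp
qed

definition unit_dir :: "'d \<times> bool \<Rightarrow> real^'d" where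
  "unit_dir z = (if snd z then axis (fst z) 1 else - axis (fst z) 1)"

lemma norm_unit_dir [simp]: "norm (unit_dir z) = 1"
  by (simp add: unit_dir_def)

text \<open>Bounds the radius of a path by 2d suprema which share one law, so that error terms
  proportional to the radius can be integrated against \<open>mu\<close>.\<close>

lemma norm_path_le:
  assumes "t \<ge> 0" "\<omega> \<in> space (P 0)" "X 0 \<omega> = 0" "s \<in> time_grid t"
  shows "norm (X s \<omega>) \<le> (\<Sum>z\<in>UNIV. sup_dir (unit_dir z) t \<omega>)"
proof -
  have "norm (X s \<omega>) \<le> (\<Sum>j\<in>UNIV. \<bar>X s \<omega> $ j\<bar>)" by (rule norm_le_l1_cart)
  also have "\<dots> \<le> (\<Sum>j\<in>UNIV. \<Sum>b\<in>UNIV. sup_dir (unit_dir (j, b)) t \<omega>)"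
  proof (rule sum_mono)
    fix j
    have "X s \<omega> $ j \<le> sup_dir (unit_dir (j, True)) t \<omega>" "- X s \<omega> $ j \<le> sup_dir (unit_dir (j, False)) t \<omega>"
      using sup_dir_upper[OF assms(1,2,4), of "unit_dir (j, True)"]
        sup_dir_upper[OF assms(1,2,4), of "unit_dir (j, False)"]
      by (simp_all add: unit_dir_def inner_axis)
    then show "\<bar>X s \<omega> $ j\<bar> \<le> (\<Sum>b\<in>UNIV. sup_dir (unit_dir (j, b)) t \<omega>)"
      using sup_dir_nonneg[OF assms(1-3), of "unit_dir (j, True)"]
        sup_dir_nonneg[OF assms(1-3), of "unit_dir (j, False)"]
      by (simp add: UNIV_bool abs_le_iff)
  qed
  also have "\<dots> = (\<Sum>z\<in>UNIV. sup_dir (unit_dir z) t \<omega>)"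
    by (simp add: sum.cartesian_product flip: UNIV_Times_UNIV)
  finally show ?thesis .
qed

text \<open>If all 2d suprema along \<open>unit_dir\<close> are at most \<epsilon> / (2d), the layer
  estimate applies with their sum S as radius. Otherwise the difference is bounded by the volume of
  D plus the sum of the weights, and the indicators of the exceptional events are summed as in a
  union bound. Expectations then use that all directions have the same law.\<close>

lemma heat_loss_estimate:
  fixes F :: "'a set" and u :: "'a \<Rightarrow> real^'d" and a :: "'a \<Rightarrow> real"
  assumes D: "bounded D" "open D" and C1: "C1_boundary \<kappa> D" and t: "t \<ge> 0"
    and F: "finite F" and u: "\<And>p. p \<in> F \<Longrightarrow> norm (u p) = 1" and a: "\<And>p. p \<in> F \<Longrightarrow> a p \<ge> 0"
    and \<epsilon>: "0 < \<epsilon>" "\<epsilon> \<le> 1" and "\<eta> \<ge> 0"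
    and layer: "\<And>K r h. countable K \<Longrightarrow> 0 \<in> K \<Longrightarrow> 0 < r \<Longrightarrow> r \<le> \<epsilon> \<Longrightarrow> (\<And>k. k \<in> K \<Longrightarrow> norm k \<le> r) \<Longrightarrow>
      (\<And>p. p \<in> F \<Longrightarrow> h p = (SUP k\<in>K. k \<bullet> u p)) \<Longrightarrow>
      \<bar>measure lborel (exit_layer D K) - (\<Sum>p\<in>F. a p * h p)\<bar> \<le> \<eta> * r * ((\<Sum>p\<in>F. a p) + 1)"
  shows "\<bar>measure lborel D - spectral_heat_content P X D t - (\<Sum>p\<in>F. a p) * mu P X i t\<bar> \<le>
      \<eta> * ((\<Sum>p\<in>F. a p) + 1) * (2 * real CARD('d) * mu P X i t) +
      (measure lborel D + (\<Sum>p\<in>F. a p)) *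
        (2 * real CARD('d) * prob {\<omega>\<in>space (P 0). running_sup X i t \<omega> > \<epsilon> / (2 * real CARD('d))})"
proof -
  define A where "A = (\<Sum>p\<in>F. a p)"
  define vol where "vol = measure lborel D"
  \<comment> \<open>There are 2d suprema, so S <= \<epsilon> <= 1 when each is at most c, and the
    cut-off at 1 is then inactive in every direction that occurs.\<close>
  define c where "c = \<epsilon> / (2 * real CARD('d))"
  define V where "V \<omega> = measure lborel (exit_layer D (path t \<omega>))" for \<omega>
  define g where "g v \<omega> = min (sup_dir v t \<omega>) 1" for v \<omega>
  define B where "B z = {\<omega>\<in>space (P 0). sup_dir (unit_dir z) t \<omega> > c}" for z
  have A: "A \<ge> 0" unfolding A_def using a by (rule sum_nonneg)
  have vol: "vol \<ge> 0" by (simp add: vol_def)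
  have card: "real CARD('d \<times> bool) = 2 * real CARD('d)" by simp
  have fin: "emeasure lborel D < \<infinity>" using D(1) emeasure_bounded_finite by blast
  have V: "0 \<le> V \<omega>" "V \<omega> \<le> vol" for \<omega>
  proof -
    show "0 \<le> V \<omega>" by (simp add: V_def)
    show "V \<omega> \<le> vol" unfolding V_def vol_def
      using D(2) fin exit_layer_borel[OF D(2), of "path t \<omega>"]
      by (intro measure_mono_fmeasurable fmeasurableI) (auto simp: exit_layer_def)
  qed
  have B: "B z \<in> events" for z
    unfolding B_def using measurable_sup_dir[OF t] by measurable
  have gi: "integrable (P 0) (g v)" for v
    unfolding g_def by (rule integrable_sup_dir[OF t])
  have gm: "(\<integral>\<omega>. g v \<omega> \<partial>P 0) = mu P X i t" if "norm v = 1" for v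
    unfolding g_def by (rule expectation_sup_dir[OF t that])
  have Bi: "integrable (P 0) (\<lambda>\<omega>. indicator (B z) \<omega> :: real)" for z
    using B by (simp add: emeasure_eq_measure)
  have Bm: "(\<integral>\<omega>. indicator (B z) \<omega> \<partial>P 0) = prob {\<omega>\<in>space (P 0). running_sup X i t \<omega> > c}" for z
    using B[of z] prob_sup_dir_greater[OF t norm_unit_dir[of z], of c i] by (simp add: B_def)
  have pw: "\<bar>V \<omega> - (\<Sum>p\<in>F. a p * g (u p) \<omega>)\<bar> \<le>
      \<eta> * (A + 1) * (\<Sum>z\<in>UNIV. g (unit_dir z) \<omega>) + (vol + A) * (\<Sum>z\<in>UNIV. indicator (B z) \<omega>)"
    if \<omega>: "\<omega> \<in> space (P 0)" and 0: "X 0 \<omega> = 0" for \<omega>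
  proof -
    note nn = sup_dir_nonneg[OF t \<omega> 0]
    have g01: "0 \<le> g v \<omega>" "g v \<omega> \<le> 1" for v using nn by (auto simp: g_def)
    have sg: "0 \<le> (\<Sum>z\<in>UNIV. g (unit_dir z) \<omega>)" using g01 by (intro sum_nonneg)
    have sB: "0 \<le> (\<Sum>z\<in>UNIV. indicator (B z) \<omega> :: real)" by (intro sum_nonneg) simp
    have \<eta>A: "0 \<le> \<eta> * (A + 1)" using A \<open>\<eta> \<ge> 0\<close> by simp
    have pos1: "0 \<le> \<eta> * (A + 1) * (\<Sum>z\<in>UNIV. g (unit_dir z) \<omega>)" using \<eta>A sg by (rule mult_nonneg_nonneg)
    have pos2: "0 \<le> (vol + A) * (\<Sum>z\<in>UNIV. indicator (B z) \<omega>)" using A vol sB by (intro mult_nonneg_nonneg) auto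
    show ?thesis
    proof (cases "\<exists>z. \<omega> \<in> B z")
      case True
      then obtain z where z: "\<omega> \<in> B z" by blast
      have "(1::real) = indicator (B z) \<omega>" using z by simp
      also have "\<dots> \<le> (\<Sum>z\<in>UNIV. indicator (B z) \<omega>)"
        by (rule member_le_sum) auto
      finally have "(vol + A) * 1 \<le> (vol + A) * (\<Sum>z\<in>UNIV. indicator (B z) \<omega>)"
        using A vol by (intro mult_left_mono) auto
      moreover have "0 \<le> (\<Sum>p\<in>F. a p * g (u p) \<omega>)" using a g01 by (intro sum_nonneg) auto
      moreover have "(\<Sum>p\<in>F. a p * g (u p) \<omega>) \<le> A"
        unfolding A_def using a g01 by (intro sum_mono) (simp add: mult_left_le)
      ultimately show ?thesis using V[of \<omega>] pos1 by (simp add: abs_le_iff)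
    next
      case False
      define S where "S = (\<Sum>z\<in>UNIV. sup_dir (unit_dir z) t \<omega>)"
      have le: "sup_dir (unit_dir z) t \<omega> \<le> c" for z
      proof -
        have "\<omega> \<notin> B z" using False by blast
        then show ?thesis using \<omega> by (simp add: B_def)
      qed
      have "S \<le> real CARD('d \<times> bool) * c"
        unfolding S_def using sum_bounded_above[of UNIV "\<lambda>z. sup_dir (unit_dir z) t \<omega>" c] le by simp
      then have S\<epsilon>: "S \<le> \<epsilon>" unfolding card by (simp add: c_def)
      have S0: "0 \<le> S" unfolding S_def using nn by (intro sum_nonneg)
      have zS: "sup_dir (unit_dir z) t \<omega> \<le> S" for z
        unfolding S_def using nn by (intro member_le_sum) auto
      have gS: "(\<Sum>z\<in>UNIV. g (unit_dir z) \<omega>) = S"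
        unfolding S_def g_def
      proof (rule sum.cong)
        fix z show "min (sup_dir (unit_dir z) t \<omega>) 1 = sup_dir (unit_dir z) t \<omega>"
          using zS[of z] S\<epsilon> \<epsilon> by simp
      qed simp
      have norm: "norm k \<le> S" if "k \<in> path t \<omega>" for k
        using that norm_path_le[OF t \<omega> 0] unfolding S_def by blast
      have uS: "sup_dir (u p) t \<omega> \<le> S" if p: "p \<in> F" for p
        unfolding sup_dir_le_iff[OF t \<omega>]
      proof
        fix s assume "s \<in> time_grid t"
        then have "norm (X s \<omega>) \<le> S" using norm by blast
        then show "X s \<omega> \<bullet> u p \<le> S" using norm_cauchy_schwarz[of "X s \<omega>" "u p"] u[OF p] by simp
      qed
      have gu: "g (u p) \<omega> = sup_dir (u p) t \<omega>" if "p \<in> F" for p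
        using uS[OF that] S\<epsilon> \<epsilon> by (simp add: g_def)
      have K0: "0 \<in> path t \<omega>" using zero_in_time_grid[OF t] 0 by (metis image_eqI)
      have "\<bar>V \<omega> - (\<Sum>p\<in>F. a p * g (u p) \<omega>)\<bar> \<le> \<eta> * S * (A + 1)"
      \<comment> \<open>The layer estimate requires a positive radius; for S = 0 the path stays at 0
        on the grid and both sides vanish.\<close>
      proof (cases "S = 0")
        case True
        then have "k = 0" if "k \<in> path t \<omega>" for k using norm[OF that] by simp
        then have "exit_layer D (path t \<omega>) = {}" unfolding exit_layer_def by force
        moreover have "g (u p) \<omega> = 0" if "p \<in> F" for p
          using gu[OF that] uS[OF that] nn[of "u p"] True by simp
        ultimately show ?thesis using True by (simp add: V_def)
      next
        case False
        have "(\<Sum>p\<in>F. a p * g (u p) \<omega>) = (\<Sum>p\<in>F. a p * sup_dir (u p) t \<omega>)"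
          using gu by simp
        then show ?thesis
          unfolding V_def A_def using False S0 S\<epsilon> norm K0
            layer[of "path t \<omega>" S "\<lambda>p. sup_dir (u p) t \<omega>"]
          by (simp add: sup_dir_def image_image)
      qed
      then show ?thesis using pos2 unfolding gS by (simp add: mult.assoc mult.commute[of S])
    qed
  qed
  have fi: "integrable (P 0) (\<lambda>\<omega>. V \<omega> - (\<Sum>p\<in>F. a p * g (u p) \<omega>))"
    unfolding V_def using gi heat_loss_eq(2)[OF D C1 t]
    by (intro Bochner_Integration.integrable_diff Bochner_Integration.integrable_sum integrable_mult_right)
  have lhs: "measure lborel D - spectral_heat_content P X D t - A * mu P X i t =
      (\<integral>\<omega>. V \<omega> - (\<Sum>p\<in>F. a p * g (u p) \<omega>) \<partial>P 0)"
  proof -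
    have "(\<integral>\<omega>. (\<Sum>p\<in>F. a p * g (u p) \<omega>) \<partial>P 0) = (\<Sum>p\<in>F. a p * mu P X i t)"
      using gi gm[OF u] by (subst Bochner_Integration.integral_sum) auto
    moreover have "integrable (P 0) V" unfolding V_def by (rule heat_loss_eq(2)[OF D C1 t])
    moreover have "integrable (P 0) (\<lambda>\<omega>. \<Sum>p\<in>F. a p * g (u p) \<omega>)"
      using gi by (intro Bochner_Integration.integrable_sum) auto
    ultimately show ?thesis
      using heat_loss_eq(1)[OF D C1 t] by (simp add: V_def[symmetric] A_def sum_distrib_right)
  qed
  define R where "R \<omega> = \<eta> * (A + 1) * (\<Sum>z\<in>UNIV. g (unit_dir z) \<omega>) +
      (vol + A) * (\<Sum>z\<in>UNIV. indicator (B z) \<omega>)" for \<omega>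
  have Ri: "integrable (P 0) R"
    unfolding R_def using gi Bi
    by (intro Bochner_Integration.integrable_add integrable_mult_right Bochner_Integration.integrable_sum)
  have "(\<integral>\<omega>. R \<omega> \<partial>P 0) = \<eta> * (A + 1) * (\<integral>\<omega>. (\<Sum>z\<in>UNIV. g (unit_dir z) \<omega>) \<partial>P 0) +
      (vol + A) * (\<integral>\<omega>. (\<Sum>z\<in>UNIV. indicator (B z) \<omega>) \<partial>P 0)"
    unfolding R_def using gi Bi
    by (subst Bochner_Integration.integral_add)
      (auto intro!: integrable_mult_right Bochner_Integration.integrable_sum simp del: Bochner_Integration.integral_sum)
  also have "(\<integral>\<omega>. (\<Sum>z\<in>UNIV. g (unit_dir z) \<omega>) \<partial>P 0) = 2 * real CARD('d) * mu P X i t"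
    using gi by (subst Bochner_Integration.integral_sum) (auto simp: gm)
  also have "(\<integral>\<omega>. (\<Sum>z\<in>UNIV. indicator (B z) \<omega> :: real) \<partial>P 0) =
      2 * real CARD('d) * prob {\<omega>\<in>space (P 0). running_sup X i t \<omega> > c}"
    using Bi by (subst Bochner_Integration.integral_sum) (simp_all only: Bm sum_constant card)
  finally have rhs: "(\<integral>\<omega>. R \<omega> \<partial>P 0) = \<eta> * (A + 1) * (2 * real CARD('d) * mu P X i t) +
      (vol + A) * (2 * real CARD('d) * prob {\<omega>\<in>space (P 0). running_sup X i t \<omega> > c})" .
  have "\<bar>\<integral>\<omega>. V \<omega> - (\<Sum>p\<in>F. a p * g (u p) \<omega>) \<partial>P 0\<bar> \<le> (\<integral>\<omega>. R \<omega> \<partial>P 0)"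
  proof -
    have "AE \<omega> in P 0. \<bar>V \<omega> - (\<Sum>p\<in>F. a p * g (u p) \<omega>)\<bar> \<le> R \<omega>"
      using AE_X_0 AE_space
    proof eventually_elim
      case (elim \<omega>)
      then show ?case using pw[of \<omega>] by (simp add: R_def)
    qed
    from integral_mono_AE[OF integrable_abs[OF fi] Ri this] show ?thesis
      by (rule order_trans[OF integral_abs_bound])
  qed
  then show ?thesis unfolding lhs[symmetric, unfolded A_def] rhs A_def vol_def c_def .
qed

text \<open>Division of the estimate by \<open>mu P X i t\<close>, which is positive for small t.
  The probability term tends to 0 after division and is eventually below \<eta>. The number A
  depends on \<phi> and \<eta> but not on t.\<close>

lemma eventually_heat_loss_ratio:
  fixes \<phi> :: "real^'d \<Rightarrow> real^'d"
  assumes D: "bounded D" "open D" and C1: "C1_boundary \<kappa> D"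
    and mu: "\<forall>\<^sub>F t in at_right 0. mu P X i t \<noteq> 0"
    and lim: "\<And>\<epsilon>. \<epsilon> > 0 \<Longrightarrow>
      ((\<lambda>t. 1 / mu P X i t * prob {\<omega>\<in>space (P 0). running_sup X i t \<omega> > \<epsilon>}) \<longlongrightarrow> 0) (at_right 0)"
    and \<phi>: "\<And>i. C_k 1 (\<lambda>x. \<phi> x $ i)" "\<And>x. norm (\<phi> x) \<le> 1" and \<eta>: "0 < \<eta>" "\<eta> \<le> 1"
  obtains A where "A \<ge> 0" "ereal A \<le> perimeter D" "div_integral D \<phi> \<le> (1 + \<eta>) * A"
    "\<forall>\<^sub>F t in at_right 0. \<bar>(measure lborel D - spectral_heat_content P X D t) / mu P X i t - A\<bar> \<le>
      \<eta> * (A + 1) * (2 * real CARD('d)) + \<eta>"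
proof (rule boundary_layer_approx[OF D C1 \<phi> \<eta>])
  fix F :: "(real^'d) set" and u :: "real^'d \<Rightarrow> real^'d" and a and \<epsilon>\<^sub>0
  assume F: "finite F" and u: "\<And>p. p \<in> F \<Longrightarrow> norm (u p) = 1"
    and a: "\<And>p. p \<in> F \<Longrightarrow> a p \<ge> 0" and \<epsilon>\<^sub>0: "\<epsilon>\<^sub>0 > 0" and per: "ereal (\<Sum>p\<in>F. a p) \<le> perimeter D"
    and div: "div_integral D \<phi> \<le> (1 + \<eta>) * (\<Sum>p\<in>F. a p)"
    and layer: "\<And>K r h. countable K \<Longrightarrow> 0 \<in> K \<Longrightarrow> 0 < r \<Longrightarrow> r \<le> \<epsilon>\<^sub>0 \<Longrightarrow> (\<And>k. k \<in> K \<Longrightarrow> norm k \<le> r) \<Longrightarrow>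
      (\<And>p. p \<in> F \<Longrightarrow> h p = (SUP k\<in>K. k \<bullet> u p)) \<Longrightarrow>
      \<bar>measure lborel (exit_layer D K) - (\<Sum>p\<in>F. a p * h p)\<bar> \<le> \<eta> * r * ((\<Sum>p\<in>F. a p) + 1)"
  define A where "A = (\<Sum>p\<in>F. a p)"
  define \<epsilon> where "\<epsilon> = min \<epsilon>\<^sub>0 1"
  define n where "n = 2 * real CARD('d)"
  define p where "p t = prob {\<omega>\<in>space (P 0). running_sup X i t \<omega> > \<epsilon> / n}" for t
  define c where "c = (measure lborel D + A) * n"
  have \<epsilon>: "0 < \<epsilon>" "\<epsilon> \<le> 1" "\<epsilon> \<le> \<epsilon>\<^sub>0" using \<epsilon>\<^sub>0 by (auto simp: \<epsilon>_def)
  have n: "n > 0" by (simp add: n_def)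
  have A: "A \<ge> 0" unfolding A_def using a by (rule sum_nonneg)
  have c: "c \<ge> 0" unfolding c_def using A n by (intro mult_nonneg_nonneg add_nonneg_nonneg) auto
  have est: "\<bar>measure lborel D - spectral_heat_content P X D t - A * mu P X i t\<bar> \<le>
      \<eta> * (A + 1) * (n * mu P X i t) + (measure lborel D + A) * (n * p t)" if "t \<ge> 0" for t
    unfolding A_def n_def p_def
  proof (rule heat_loss_estimate[OF D C1 that F u a \<epsilon>(1,2)])
    show "0 \<le> \<eta>" using \<eta> by simp
    show "\<bar>measure lborel (exit_layer D K) - (\<Sum>p\<in>F. a p * h p)\<bar> \<le> \<eta> * r * ((\<Sum>p\<in>F. a p) + 1)"
      if "countable K" "0 \<in> K" "0 < r" "r \<le> \<epsilon>" "\<And>k. k \<in> K \<Longrightarrow> norm k \<le> r"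
        "\<And>p. p \<in> F \<Longrightarrow> h p = (SUP k\<in>K. k \<bullet> u p)" for K r h
      by (rule layer[OF that(1-3) order_trans[OF that(4) \<epsilon>(3)] that(5,6)])
  qed
  have "((\<lambda>t. c * (1 / mu P X i t * p t)) \<longlongrightarrow> c * 0) (at_right 0)"
    unfolding p_def using lim[of "\<epsilon> / n"] \<epsilon> n by (intro tendsto_mult_left) simp
  then have "\<forall>\<^sub>F t in at_right 0. c * (1 / mu P X i t * p t) < \<eta>"
    using \<eta> order_tendstoD(2)[of _ 0] by simp
  then have "\<forall>\<^sub>F t in at_right 0. \<bar>(measure lborel D - spectral_heat_content P X D t) / mu P X i t - A\<bar> \<le>
      \<eta> * (A + 1) * n + \<eta>"
    using mu eventually_at_right_less[of "0::real"]
  proof eventually_elim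
    case (elim t)
    have m: "mu P X i t > 0" using mu_nonneg[of t i] elim by simp
    have "(measure lborel D - spectral_heat_content P X D t) / mu P X i t - A =
        (measure lborel D - spectral_heat_content P X D t - A * mu P X i t) / mu P X i t"
      using m by (simp add: field_simps)
    then have "\<bar>(measure lborel D - spectral_heat_content P X D t) / mu P X i t - A\<bar> =
        \<bar>measure lborel D - spectral_heat_content P X D t - A * mu P X i t\<bar> / mu P X i t"
      using m by (simp add: abs_divide)
    also have "\<dots> \<le> (\<eta> * (A + 1) * (n * mu P X i t) + c * p t) / mu P X i t"
      using est[of t] elim m by (intro divide_right_mono) (simp_all add: c_def mult.assoc)
    also have "\<dots> = \<eta> * (A + 1) * n + c * (1 / mu P X i t * p t)"
      using m by (simp add: add_divide_distrib)
    finally show ?case using elim(1) by simp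
  qed
  then show thesis
    using that[of A] A per div unfolding A_def n_def by blast
qed

text \<open>Below the perimeter, a field nearly attaining the supremum bounds A from below; above
  it, A <= \<open>perimeter D\<close> suffices. Working with order limits in the extended reals lets
  the first half run without a finite perimeter.\<close>

lemma heat_loss_ratio_tendsto_perimeter:
  assumes D: "bounded D" "open D" and C1: "C1_boundary \<kappa> D"
    and mu: "\<forall>\<^sub>F t in at_right 0. mu P X i t \<noteq> 0"
    and lim: "\<And>\<epsilon>. \<epsilon> > 0 \<Longrightarrow>
      ((\<lambda>t. 1 / mu P X i t * prob {\<omega>\<in>space (P 0). running_sup X i t \<omega> > \<epsilon>}) \<longlongrightarrow> 0) (at_right 0)"
  shows "((\<lambda>t. ereal ((measure lborel D - spectral_heat_content P X D t) / mu P X i t)) \<longlongrightarrow> perimeter D)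
    (at_right 0)"
proof (rule order_tendstoI)
  define n where "n = 2 * real CARD('d)"
  have n: "n > 0" by (simp add: n_def)
  let ?f = "\<lambda>t. (measure lborel D - spectral_heat_content P X D t) / mu P X i t"
  have small: "\<exists>\<eta>::real. 0 < \<eta> \<and> \<eta> \<le> 1 \<and> n * \<eta> \<le> 1 \<and> Q \<eta>" if "\<forall>\<^sub>F \<eta> in at_right 0. Q \<eta>" for Q
  proof -
    have "\<forall>\<^sub>F \<eta> in at_right (0::real). \<eta> < min 1 (1 / n)"
      using n eventually_at_right_real[of 0 "min 1 (1 / n)"] by (auto elim: eventually_mono)
    then have "\<forall>\<^sub>F \<eta> in at_right 0. 0 < \<eta> \<and> \<eta> \<le> 1 \<and> n * \<eta> \<le> 1 \<and> Q \<eta>"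
      using that eventually_at_right_less[of "0::real"]
      by eventually_elim (use n in \<open>auto simp: field_simps\<close>)
    then show ?thesis using eventually_happens[of _ "at_right (0::real)"] by auto
  qed
  {
    fix b assume "b < perimeter D"
    then obtain \<phi> :: "real^'d \<Rightarrow> real^'d" where test: "\<And>i. test_function (\<lambda>x. \<phi> x $ i)"
      and le: "\<And>x. (\<Sum>i\<in>UNIV. (\<phi> x $ i)\<^sup>2) \<le> 1"
      and b: "b < ereal (LINT x:D|lborel. \<Sum>i\<in>UNIV. partial_deriv i (\<lambda>y. \<phi> y $ i) x)"
      unfolding perimeter_def less_SUP_iff by blast
    have C: "C_k 1 (\<lambda>x. \<phi> x $ i)" for i using test[of i] unfolding test_function_def by blast
    have norm: "norm (\<phi> x) \<le> 1" for x
      using le[of x] by (simp add: norm_vec_def L2_set_def)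
    define I where "I = max 0 (div_integral D \<phi>)"
    have "b < ereal I" using b unfolding div_integral_eq[OF D C] I_def
      by (rule less_le_trans) simp
    then obtain b' where b': "b \<le> ereal b'" "b' < I"
      using ereal_dense2[of b "ereal I"] by (metis ereal_less_eq(3) less_ereal.simps(1) less_imp_le)
    \<comment> \<open>This is the guaranteed lower bound A (1 - n \<eta>) - n \<eta> - \<eta> with A
      replaced by the smaller value I / (1 + \<eta>); the replacement is monotone because n \<eta>
      <= 1.\<close>
    have "((\<lambda>\<eta>. I / (1 + \<eta>) * (1 - n * \<eta>) - n * \<eta> - \<eta>) \<longlongrightarrow> I / (1 + 0) * (1 - n * 0) - n * 0 - 0) (at_right 0)"
      by (intro tendsto_intros) auto
    then have "\<forall>\<^sub>F \<eta> in at_right 0. b' < I / (1 + \<eta>) * (1 - n * \<eta>) - n * \<eta> - \<eta>"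
      using b'(2) order_tendstoD(1) by fastforce
    then obtain \<eta> where \<eta>: "0 < \<eta>" "\<eta> \<le> 1" "n * \<eta> \<le> 1" "b' < I / (1 + \<eta>) * (1 - n * \<eta>) - n * \<eta> - \<eta>"
      using small by blast
    obtain A where A: "A \<ge> 0" "div_integral D \<phi> \<le> (1 + \<eta>) * A"
      "\<forall>\<^sub>F t in at_right 0. \<bar>?f t - A\<bar> \<le> \<eta> * (A + 1) * n + \<eta>"
      unfolding n_def by (rule eventually_heat_loss_ratio[OF D C1 mu lim C norm \<eta>(1,2)]) (assumption | rule that)+
    have "I \<le> (1 + \<eta>) * A" using A(1,2) \<eta>(1) by (simp add: I_def)
    then have "I / (1 + \<eta>) \<le> A" using \<eta>(1) by (simp add: divide_le_eq mult.commute)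
    then have "I / (1 + \<eta>) * (1 - n * \<eta>) \<le> A * (1 - n * \<eta>)" using \<eta>(3) by (intro mult_right_mono) auto
    then have b'': "b' < A - (\<eta> * (A + 1) * n + \<eta>)" using \<eta>(4) by (simp add: algebra_simps)
    show "\<forall>\<^sub>F t in at_right 0. b < ereal (?f t)"
      using A(3)
    proof eventually_elim
      case (elim t)
      then have "b' < ?f t" using b'' by (simp add: abs_le_iff)
      then show ?case using b'(1) by (meson le_less_trans less_ereal.simps(1))
    qed
  }
  {
    fix b assume b: "perimeter D < b"
    \<comment> \<open>Only the bound of A by the perimeter matters in this half, so the zero field
      can be used.\<close>
    have C0: "C_k 1 (\<lambda>x. (0::real^'d) $ i)" for i :: 'd by (rule C_k_const)
    have N0: "norm (0::real^'d) \<le> 1" by simp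
    note approx = eventually_heat_loss_ratio[OF D C1 mu lim C0 N0]
    obtain A\<^sub>0 where "A\<^sub>0 \<ge> 0" "ereal A\<^sub>0 \<le> perimeter D"
      by (rule approx[OF _ zero_less_one order_refl]) (assumption | rule that)+
    \<comment> \<open>Excludes the value minus infinity; with b above it, the perimeter is then a
      real number.\<close>
    then have "0 \<le> perimeter D" by (metis ereal_less_eq(5) order_trans)
    with b obtain p where p: "perimeter D = ereal p" by (cases "perimeter D") auto
    obtain b' where b': "p < b'" "ereal b' \<le> b"
      using ereal_dense2[of "ereal p" b] b unfolding p by (metis less_ereal.simps(1) less_imp_le)
    have "((\<lambda>\<eta>. p + \<eta> * (p + 1) * n + \<eta>) \<longlongrightarrow> p + 0 * (p + 1) * n + 0) (at_right 0)"
      by (intro tendsto_intros)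
    then have "\<forall>\<^sub>F \<eta> in at_right 0. p + \<eta> * (p + 1) * n + \<eta> < b'"
      using b'(1) order_tendstoD(2) by fastforce
    then obtain \<eta> where \<eta>: "0 < \<eta>" "\<eta> \<le> 1" "p + \<eta> * (p + 1) * n + \<eta> < b'"
      using small by blast
    obtain A where A: "ereal A \<le> perimeter D"
      "\<forall>\<^sub>F t in at_right 0. \<bar>?f t - A\<bar> \<le> \<eta> * (A + 1) * n + \<eta>"
      unfolding n_def by (rule approx[OF _ \<eta>(1,2)]) (assumption | rule that)+
    have "A \<le> p" using A(1) by (simp add: p)
    then have "\<eta> * (A + 1) * n \<le> \<eta> * (p + 1) * n"
      using \<eta>(1) n by (intro mult_right_mono mult_left_mono) auto
    show "\<forall>\<^sub>F t in at_right 0. ereal (?f t) < b"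
      using A(2)
    proof eventually_elim
      case (elim t)
      then have "?f t < b'"
        using \<open>A \<le> p\<close> \<open>\<eta> * (A + 1) * n \<le> \<eta> * (p + 1) * n\<close> \<eta>(3) by (simp add: abs_le_iff)
      then show ?case using b'(2) by (meson less_le_trans less_ereal.simps(1))
    qed
  }
qed

end

theorem theorem1p1:
  fixes \<Omega> :: "(real^'d) set"
    and P :: "real^'d \<Rightarrow> 'w measure"
    and X :: "real \<Rightarrow> 'w \<Rightarrow> real^'d"
    and i :: 'd
  assumes "open \<Omega>" and "bounded \<Omega>" and "C1_boundary 1 \<Omega>"
    and "cadlag_process P X" and "translation_invariant P X" and "isotropic P X"
    and "\<forall>\<^sub>F t in at_right 0. mu P X i t \<noteq> 0"
    and "\<And>\<epsilon>. \<epsilon> > 0 \<Longrightarrow>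
      ((\<lambda>t. 1 / mu P X i t * measure (P 0) {\<omega>\<in>space (P 0). running_sup X i t \<omega> > \<epsilon>})
        \<longlongrightarrow> 0) (at_right 0)"
  shows "((\<lambda>t. ereal ((measure lborel \<Omega> - spectral_heat_content P X \<Omega> t) / mu P X i t))
           \<longlongrightarrow> perimeter \<Omega>) (at_right 0)"
proof -
  interpret ti_isotropic_process P X by (rule ti_isotropic_process.intro[OF assms(4-6)])
  show ?thesis by (rule heat_loss_ratio_tendsto_perimeter[OF assms(2,1,3,7,8)])
qed

end
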